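(* Let $\kappa$ be a field, $G$ a group and $\sigma\in pm(G)$ a factor set. There exists an isomorphism of $\kappa$-algebras $\phi:\kappa_{par}^{\sigma}G\to\mathcal{A}_\sigma$ such that $\phi([g]^\sigma)=\chi(\{1,g\})\,(\{1,g\},g)$ for all $g\in G$.
   Context: Algebras are associative and unital, and homomorphisms preserve the unit. A partial projective $\sigma$-representation of $G$ in a unital $\kappa$-algebra $R$ (with $1_R\neq 0$) is a map $\Gamma:G\to R$ for which there is a function $\sigma:G\times G\to\kappa$ (called the factor set) such that for all $g,h\in G$: (i) if $\sigma(g,h)=0$ then $\Gamma(g^{-1})\Gamma(gh)=0$ and $\Gamma(gh)\Gamma(h^{-1})=0$; (ii) if $\Gamma(g)\Gamma(h)=0$ then $\sigma(g,h)=0$; (iii) $\Gamma(1_G)=1_R$; (iv) $\Gamma(g^{-1})\Gamma(g)\Gamma(h)=\sigma(g,h)\Gamma(g^{-1})\Gamma(gh)$; (v) $\Gamma(g)\Gamma(h)\Gamma(h^{-1})=\sigma(g,h)\Gamma(gh)\Gamma(h^{-1})$. The set of all factor sets of $G$ (over all such $R$ and $\Gamma$) is $pm(G)$. For $\sigma\in pm(G)$, the twisted partial group algebra $\kappa_{par}^{\sigma}G$ is the universal $\kappa$-algebra generated by symbols $[g]^\sigma$ ($g\in G$) subject to, for all $g,h\in G$: $\sigma(g,h)=0\Rightarrow [g^{-1}]^\sigma[gh]^\sigma=[gh]^\sigma[h^{-1}]^\sigma=0$; $[g^{-1}]^\sigma[g]^\sigma[h]^\sigma=\sigma(g,h)[g^{-1}]^\sigma[gh]^\sigma$;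 $[g]^\sigma[h]^\sigma[h^{-1}]^\sigma=\sigma(g,h)[gh]^\sigma[h^{-1}]^\sigma$; $[g]^\sigma[1_G]^\sigma=[1_G]^\sigma[g]^\sigma=[g]^\sigma$. Let $\Omega=\{\xi\subseteq G:1\in\xi\}$. The $\sigma$-prohibitions of type I are the sets $\{h,hg,hgs\}$ with $h,g,s\in G$ and $\sigma(g,s)=0$; those of type II are the sets $\{h,hg,hgs,hgst\}$ with $h,g,s,t\in G$ and $\sigma(g,st)\sigma(s,t)\neq\sigma(g,s)\sigma(gs,t)$. $\mathcal{P}_\sigma$ is the set of all $\sigma$-prohibitions (of both types), and $\Omega_\sigma=\{\xi\in\Omega: V\nsubseteq\xi \text{ for all } V\in\mathcal{P}_\sigma\}$. For $U\in\Omega$ put $\chi(U)=1$ if $U\in\Omega_\sigma$ and $\chi(U)=0$ otherwise. $\mathcal{A}_\sigma$ is the $\kappa$-vector space with basis $\{(U,g):U\in\Omega_\sigma,\ |U|<\infty,\ g\in U\}$, with the bilinear multiplication determined by $(U,g)\star(V,h)=\sigma(g,h)\chi(U\cup gV)\,(U\cup gV,gh)$, where the right-hand side is read as $0$ when $\chi(U\cup gV)=0$. This is an associative $\kappa$-algebra with unit $(\{1\},1)$. Similarly $\chi(\{1,g\})(\{1,g\},g)$ is read as $0$ when $\{1,g\}\notin\Omega_\sigma$.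
   Formalization: The relation [1_G]=1 is added to the presentation of the twisted partial group algebra: in a unital presentation the listed relations [g][1]=[1][g]=[g] alone do not force [1_G] to be the unit (send all [g] to 0 in κ), and the claimed isomorphism would fail. *)

theory Defs
  imports "HOL-Algebra.QuotRing" "HOL-Algebra.Module" "HOL-Algebra.Coset"
begin

section \<open>Associative unital algebras\<close>

text \<open>The library locale \<^locale>\<open>algebra\<close> requires the algebra to be commutative.\<close>

locale assoc_algebra = module + ring M +
  assumes smult_mult_left:
      "\<lbrakk>a \<in> carrier R; x \<in> carrier M; y \<in> carrier M\<rbrakk> \<Longrightarrow>
        (a \<odot>\<^bsub>M\<^esub> x) \<otimes>\<^bsub>M\<^esub> y = a \<odot>\<^bsub>M\<^esub> (x \<otimes>\<^bsub>M\<^esub> y)"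
    and smult_mult_right:
      "\<lbrakk>a \<in> carrier R; x \<in> carrier M; y \<in> carrier M\<rbrakk> \<Longrightarrow>
        x \<otimes>\<^bsub>M\<^esub> (a \<odot>\<^bsub>M\<^esub> y) = a \<odot>\<^bsub>M\<^esub> (x \<otimes>\<^bsub>M\<^esub> y)"

definition algebra_iso ::
  "('k, 'm) ring_scheme \<Rightarrow> ('k, 'a, 'n) module_scheme \<Rightarrow> ('k, 'b, 'p) module_scheme \<Rightarrow> ('a \<Rightarrow> 'b) set"
  where "algebra_iso K A B =
    {\<phi> \<in> ring_iso A B. \<forall>c\<in>carrier K. \<forall>x\<in>carrier A. \<phi> (c \<odot>\<^bsub>A\<^esub> x) = c \<odot>\<^bsub>B\<^esub> \<phi> x}"

definition quot_algebra ::
  "('k, 'a, 'n) module_scheme \<Rightarrow> 'a set \<Rightarrow> ('k, 'a set) module"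
  where "quot_algebra A I =
    ring.extend (A Quot I)
      (module.fields (\<lambda>c X. \<Union>x\<in>X. I +>\<^bsub>A\<^esub> (c \<odot>\<^bsub>A\<^esub> x)))"

definition supp :: "('k, 'm) ring_scheme \<Rightarrow> ('b \<Rightarrow> 'k) \<Rightarrow> 'b set"
  where "supp K f = {b. f b \<noteq> \<zero>\<^bsub>K\<^esub>}"

definition basis_vec :: "('k, 'm) ring_scheme \<Rightarrow> 'b \<Rightarrow> 'b \<Rightarrow> 'k"
  where "basis_vec K b = (\<lambda>r. if r = b then \<one>\<^bsub>K\<^esub> else \<zero>\<^bsub>K\<^esub>)"

text \<open>The vector space with basis \<open>B\<close>, realised as the finitely supported functions vanishing
  off \<open>B\<close>, with the bilinear multiplication that sends a pair \<open>(p, q)\<close> of basis elements to the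
  vector \<open>\<mu> p q\<close>, and with the basis element \<open>u\<close> as unit.\<close>

definition basis_algebra ::
  "('k, 'm) ring_scheme \<Rightarrow> 'b set \<Rightarrow> ('b \<Rightarrow> 'b \<Rightarrow> 'b \<Rightarrow> 'k) \<Rightarrow> 'b \<Rightarrow> ('k, 'b \<Rightarrow> 'k) module"
  where "basis_algebra K B \<mu> u =
    \<lparr>carrier = {f. (\<forall>b. f b \<in> carrier K) \<and> finite (supp K f) \<and> supp K f \<subseteq> B},
     monoid.mult = (\<lambda>x y r. \<Oplus>\<^bsub>K\<^esub>p\<in>supp K x. \<Oplus>\<^bsub>K\<^esub>q\<in>supp K y. x p \<otimes>\<^bsub>K\<^esub> y q \<otimes>\<^bsub>K\<^esub> \<mu> p q r),
     one = basis_vec K u,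
     zero = (\<lambda>r. \<zero>\<^bsub>K\<^esub>),
     add = (\<lambda>x y r. x r \<oplus>\<^bsub>K\<^esub> y r),
     smult = (\<lambda>c x r. c \<otimes>\<^bsub>K\<^esub> x r)\<rparr>"


section \<open>Partial projective representations and their factor sets\<close>

definition partial_proj_rep ::
  "('k, 'm) ring_scheme \<Rightarrow> ('g, 'n) monoid_scheme \<Rightarrow> ('k, 'r, 'p) module_scheme \<Rightarrow>
    ('g \<Rightarrow> 'g \<Rightarrow> 'k) \<Rightarrow> ('g \<Rightarrow> 'r) \<Rightarrow> bool"
  where "partial_proj_rep K G R \<sigma> \<Gamma> \<longleftrightarrow>
    \<Gamma> \<in> carrier G \<rightarrow> carrier R \<and> \<sigma> \<in> carrier G \<rightarrow> carrier G \<rightarrow> carrier K \<and>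
    \<Gamma> \<one>\<^bsub>G\<^esub> = \<one>\<^bsub>R\<^esub> \<and>
    (\<forall>g\<in>carrier G. \<forall>h\<in>carrier G.
      (\<sigma> g h = \<zero>\<^bsub>K\<^esub> \<longrightarrow>
        \<Gamma> (inv\<^bsub>G\<^esub> g) \<otimes>\<^bsub>R\<^esub> \<Gamma> (g \<otimes>\<^bsub>G\<^esub> h) = \<zero>\<^bsub>R\<^esub> \<and>
        \<Gamma> (g \<otimes>\<^bsub>G\<^esub> h) \<otimes>\<^bsub>R\<^esub> \<Gamma> (inv\<^bsub>G\<^esub> h) = \<zero>\<^bsub>R\<^esub>) \<and>
      (\<Gamma> g \<otimes>\<^bsub>R\<^esub> \<Gamma> h = \<zero>\<^bsub>R\<^esub> \<longrightarrow> \<sigma> g h = \<zero>\<^bsub>K\<^esub>) \<and>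
      \<Gamma> (inv\<^bsub>G\<^esub> g) \<otimes>\<^bsub>R\<^esub> \<Gamma> g \<otimes>\<^bsub>R\<^esub> \<Gamma> h =
        \<sigma> g h \<odot>\<^bsub>R\<^esub> (\<Gamma> (inv\<^bsub>G\<^esub> g) \<otimes>\<^bsub>R\<^esub> \<Gamma> (g \<otimes>\<^bsub>G\<^esub> h)) \<and>
      \<Gamma> g \<otimes>\<^bsub>R\<^esub> \<Gamma> h \<otimes>\<^bsub>R\<^esub> \<Gamma> (inv\<^bsub>G\<^esub> h) =
        \<sigma> g h \<odot>\<^bsub>R\<^esub> (\<Gamma> (g \<otimes>\<^bsub>G\<^esub> h) \<otimes>\<^bsub>R\<^esub> \<Gamma> (inv\<^bsub>G\<^esub> h)))"

text \<open>HOL cannot quantify over types inside a definition, so the type \<open>'r\<close> in which the algebras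
  \<open>R\<close> live is a parameter. A theorem with hypothesis \<open>\<sigma> \<in> pm TYPE('r) K G\<close> holds for every \<open>'r\<close>
  and hence for every factor set, whatever \<open>R\<close> it comes from.\<close>

definition pm ::
  "'r itself \<Rightarrow> ('k, 'm) ring_scheme \<Rightarrow> ('g, 'n) monoid_scheme \<Rightarrow> ('g \<Rightarrow> 'g \<Rightarrow> 'k) set"
  where "pm T K G =
    {\<sigma>. \<exists>(R :: ('k, 'r) module) \<Gamma>.
      assoc_algebra K R \<and> \<one>\<^bsub>R\<^esub> \<noteq> \<zero>\<^bsub>R\<^esub> \<and> partial_proj_rep K G R \<sigma> \<Gamma>}"


section \<open>The twisted partial group algebra\<close>

text \<open>The free unital algebra on \<open>carrier G\<close>: its basis consists of the words in \<open>carrier G\<close>,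
  multiplied by concatenation.\<close>

definition free_algebra ::
  "('k, 'm) ring_scheme \<Rightarrow> ('g, 'n) monoid_scheme \<Rightarrow> ('k, 'g list \<Rightarrow> 'k) module"
  where "free_algebra K G =
    basis_algebra K (lists (carrier G)) (\<lambda>v w. basis_vec K (v @ w)) []"

definition free_gen :: "('k, 'm) ring_scheme \<Rightarrow> 'g \<Rightarrow> 'g list \<Rightarrow> 'k"
  where "free_gen K g = basis_vec K [g]"

text \<open>A relation \<open>a = b\<close> is represented by \<open>a - b\<close>. In an algebra merely generated as a unital
  algebra, the relations \<open>[g][1] = [1][g] = [g]\<close> would not force \<open>[1]\<close> to be the unit (it would
  be an additional idempotent). They are meant to say that \<open>[1]\<close> is the unit, which is the
  singleton in the last line.\<close>

definition par_relators ::
  "('k, 'm) ring_scheme \<Rightarrow> ('g, 'n) monoid_scheme \<Rightarrow> ('g \<Rightarrow> 'g \<Rightarrow> 'k) \<Rightarrow> ('g list \<Rightarrow> 'k) set"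
  where "par_relators K G \<sigma> =
    (let F = free_algebra K G; e = free_gen K in
      {e (inv\<^bsub>G\<^esub> g) \<otimes>\<^bsub>F\<^esub> e (g \<otimes>\<^bsub>G\<^esub> h) | g h.
        g \<in> carrier G \<and> h \<in> carrier G \<and> \<sigma> g h = \<zero>\<^bsub>K\<^esub>} \<union>
      {e (g \<otimes>\<^bsub>G\<^esub> h) \<otimes>\<^bsub>F\<^esub> e (inv\<^bsub>G\<^esub> h) | g h.
        g \<in> carrier G \<and> h \<in> carrier G \<and> \<sigma> g h = \<zero>\<^bsub>K\<^esub>} \<union>
      {e (inv\<^bsub>G\<^esub> g) \<otimes>\<^bsub>F\<^esub> e g \<otimes>\<^bsub>F\<^esub> e h \<ominus>\<^bsub>F\<^esub>
          \<sigma> g h \<odot>\<^bsub>F\<^esub> (e (inv\<^bsub>G\<^esub> g) \<otimes>\<^bsub>F\<^esub> e (g \<otimes>\<^bsub>G\<^esub> h)) | g h.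
        g \<in> carrier G \<and> h \<in> carrier G} \<union>
      {e g \<otimes>\<^bsub>F\<^esub> e h \<otimes>\<^bsub>F\<^esub> e (inv\<^bsub>G\<^esub> h) \<ominus>\<^bsub>F\<^esub>
          \<sigma> g h \<odot>\<^bsub>F\<^esub> (e (g \<otimes>\<^bsub>G\<^esub> h) \<otimes>\<^bsub>F\<^esub> e (inv\<^bsub>G\<^esub> h)) | g h.
        g \<in> carrier G \<and> h \<in> carrier G} \<union>
      {e g \<otimes>\<^bsub>F\<^esub> e \<one>\<^bsub>G\<^esub> \<ominus>\<^bsub>F\<^esub> e g | g. g \<in> carrier G} \<union>
      {e \<one>\<^bsub>G\<^esub> \<otimes>\<^bsub>F\<^esub> e g \<ominus>\<^bsub>F\<^esub> e g | g. g \<in> carrier G} \<union>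
      {e \<one>\<^bsub>G\<^esub> \<ominus>\<^bsub>F\<^esub> \<one>\<^bsub>F\<^esub>})"

definition par_ideal ::
  "('k, 'm) ring_scheme \<Rightarrow> ('g, 'n) monoid_scheme \<Rightarrow> ('g \<Rightarrow> 'g \<Rightarrow> 'k) \<Rightarrow> ('g list \<Rightarrow> 'k) set"
  where "par_ideal K G \<sigma> = Idl\<^bsub>free_algebra K G\<^esub> (par_relators K G \<sigma>)"

definition twisted_par_algebra ::
  "('k, 'm) ring_scheme \<Rightarrow> ('g, 'n) monoid_scheme \<Rightarrow> ('g \<Rightarrow> 'g \<Rightarrow> 'k) \<Rightarrow>
    ('k, ('g list \<Rightarrow> 'k) set) module"
  where "twisted_par_algebra K G \<sigma> = quot_algebra (free_algebra K G) (par_ideal K G \<sigma>)"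

definition par_gen ::
  "('k, 'm) ring_scheme \<Rightarrow> ('g, 'n) monoid_scheme \<Rightarrow> ('g \<Rightarrow> 'g \<Rightarrow> 'k) \<Rightarrow> 'g \<Rightarrow>
    ('g list \<Rightarrow> 'k) set"
  where "par_gen K G \<sigma> g = par_ideal K G \<sigma> +>\<^bsub>free_algebra K G\<^esub> free_gen K g"


section \<open>Prohibitions and the algebra of admissible pairs\<close>

definition Omega :: "('g, 'n) monoid_scheme \<Rightarrow> 'g set set"
  where "Omega G = {\<xi>. \<xi> \<subseteq> carrier G \<and> \<one>\<^bsub>G\<^esub> \<in> \<xi>}"

definition prohibitions_I ::
  "('k, 'm) ring_scheme \<Rightarrow> ('g, 'n) monoid_scheme \<Rightarrow> ('g \<Rightarrow> 'g \<Rightarrow> 'k) \<Rightarrow> 'g set set"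
  where "prohibitions_I K G \<sigma> =
    {{h, h \<otimes>\<^bsub>G\<^esub> g, h \<otimes>\<^bsub>G\<^esub> g \<otimes>\<^bsub>G\<^esub> s} | h g s.
      h \<in> carrier G \<and> g \<in> carrier G \<and> s \<in> carrier G \<and> \<sigma> g s = \<zero>\<^bsub>K\<^esub>}"

definition prohibitions_II ::
  "('k, 'm) ring_scheme \<Rightarrow> ('g, 'n) monoid_scheme \<Rightarrow> ('g \<Rightarrow> 'g \<Rightarrow> 'k) \<Rightarrow> 'g set set"
  where "prohibitions_II K G \<sigma> =
    {{h, h \<otimes>\<^bsub>G\<^esub> g, h \<otimes>\<^bsub>G\<^esub> g \<otimes>\<^bsub>G\<^esub> s, h \<otimes>\<^bsub>G\<^esub> g \<otimes>\<^bsub>G\<^esub> s \<otimes>\<^bsub>G\<^esub> t} | h g s t.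
      h \<in> carrier G \<and> g \<in> carrier G \<and> s \<in> carrier G \<and> t \<in> carrier G \<and>
      \<sigma> g (s \<otimes>\<^bsub>G\<^esub> t) \<otimes>\<^bsub>K\<^esub> \<sigma> s t \<noteq> \<sigma> g s \<otimes>\<^bsub>K\<^esub> \<sigma> (g \<otimes>\<^bsub>G\<^esub> s) t}"

definition prohibitions ::
  "('k, 'm) ring_scheme \<Rightarrow> ('g, 'n) monoid_scheme \<Rightarrow> ('g \<Rightarrow> 'g \<Rightarrow> 'k) \<Rightarrow> 'g set set"
  where "prohibitions K G \<sigma> = prohibitions_I K G \<sigma> \<union> prohibitions_II K G \<sigma>"

definition Omega_tw ::
  "('k, 'm) ring_scheme \<Rightarrow> ('g, 'n) monoid_scheme \<Rightarrow> ('g \<Rightarrow> 'g \<Rightarrow> 'k) \<Rightarrow> 'g set set"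
  where "Omega_tw K G \<sigma> = {\<xi> \<in> Omega G. \<forall>V\<in>prohibitions K G \<sigma>. \<not> V \<subseteq> \<xi>}"

definition chi ::
  "('k, 'm) ring_scheme \<Rightarrow> ('g, 'n) monoid_scheme \<Rightarrow> ('g \<Rightarrow> 'g \<Rightarrow> 'k) \<Rightarrow> 'g set \<Rightarrow> 'k"
  where "chi K G \<sigma> U = (if U \<in> Omega_tw K G \<sigma> then \<one>\<^bsub>K\<^esub> else \<zero>\<^bsub>K\<^esub>)"

definition adm_pairs ::
  "('k, 'm) ring_scheme \<Rightarrow> ('g, 'n) monoid_scheme \<Rightarrow> ('g \<Rightarrow> 'g \<Rightarrow> 'k) \<Rightarrow> ('g set \<times> 'g) set"
  where "adm_pairs K G \<sigma> = {(U, g). U \<in> Omega_tw K G \<sigma> \<and> finite U \<and> g \<in> U}"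

text \<open>When \<open>\<chi>(U \<union> gV) = 0\<close> the pair on the right is not in the basis, but its coefficient is \<open>0\<close>, so
  that the product is the zero vector.\<close>

definition star_basis ::
  "('k, 'm) ring_scheme \<Rightarrow> ('g, 'n) monoid_scheme \<Rightarrow> ('g \<Rightarrow> 'g \<Rightarrow> 'k) \<Rightarrow>
    'g set \<times> 'g \<Rightarrow> 'g set \<times> 'g \<Rightarrow> 'g set \<times> 'g \<Rightarrow> 'k"
  where "star_basis K G \<sigma> = (\<lambda>(U, g) (V, h) r.
    \<sigma> g h \<otimes>\<^bsub>K\<^esub> chi K G \<sigma> (U \<union> (g <#\<^bsub>G\<^esub> V)) \<otimes>\<^bsub>K\<^esub>
      basis_vec K (U \<union> (g <#\<^bsub>G\<^esub> V), g \<otimes>\<^bsub>G\<^esub> h) r)"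

definition adm_algebra ::
  "('k, 'm) ring_scheme \<Rightarrow> ('g, 'n) monoid_scheme \<Rightarrow> ('g \<Rightarrow> 'g \<Rightarrow> 'k) \<Rightarrow>
    ('k, 'g set \<times> 'g \<Rightarrow> 'k) module"
  where "adm_algebra K G \<sigma> =
    basis_algebra K (adm_pairs K G \<sigma>) (star_basis K G \<sigma>) ({\<one>\<^bsub>G\<^esub>}, \<one>\<^bsub>G\<^esub>)"

end

theory Submission
  imports Defs
begin

text \<open>Let \<open>\<Gamma>\<close> satisfy the defining relations in an algebra. The elements
  \<open>e(g) = \<sigma>(g, g\<^sup>-\<^sup>1)\<^sup>-\<^sup>1 \<Gamma>(g) \<Gamma>(g\<^sup>-\<^sup>1)\<close> (read as \<open>0\<close> when \<open>\<sigma>(g, g\<^sup>-\<^sup>1) = 0\<close>) are commuting idempotents with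
  \<open>\<Gamma>(g) e(h) = e(gh) \<Gamma>(g)\<close> and \<open>\<Gamma>(g) \<Gamma>(h) = \<sigma>(g, h) e(g) \<Gamma>(gh)\<close>. Writing \<open>E(U)\<close> for the product of the
  \<open>e(u)\<close> with \<open>u \<in> U\<close>, this gives \<open>E(U) = 0\<close> whenever \<open>U\<close> contains a prohibition: for type I because
  \<open>\<Gamma>(g) \<Gamma>(s) = 0\<close>, for type II by comparing the two bracketings of \<open>\<Gamma>(g) \<Gamma>(s) \<Gamma>(t)\<close>.

  The elements \<open>\<gamma>(g) = \<chi>({1, g}) ({1, g}, g)\<close> satisfy the relations, which yields a homomorphism \<open>\<phi>\<close> from
  the free algebra. It is onto because \<open>(U, g)\<close> is the product of the \<open>({1, u}, 1)\<close> with \<open>u \<in> U\<close> and of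
  \<open>\<gamma>(g)\<close>, and \<open>({1, u}, 1)\<close> is a multiple of \<open>\<gamma>(u) \<gamma>(u\<^sup>-\<^sup>1)\<close>. The linear map \<open>\<psi>: (U, g) \<mapsto> E(U) [g]\<close> satisfies
  \<open>\<psi>(\<gamma>(g) y) = [g] \<psi>(y)\<close>, so \<open>\<psi> \<circ> \<phi>\<close> is the quotient map and the kernel of \<open>\<phi>\<close> is the ideal of
  relations.\<close>


section \<open>Algebras given by structure constants\<close>

text \<open>The obstacle is that \<sigma> may vanish and is not a cocycle. In the target algebra
  every scalar identity is required only when a certain finite set is admissible, and there the
  prohibitions supply nonvanishing and the cocycle identity along chains
  \<open>a, ag, ags, agst\<close>. Beyond that only the values of \<sigma> at pairs containing the
  unit of the group enter. They are extracted from \<open>pm\<close> once, after which the given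
  representation disappears. In an arbitrary algebra satisfying the relations,
  \<open>\<sigma>(g, inv g) = 0\<close> forces \<open>\<Gamma>(g)\<close> and
  \<open>\<Gamma>(inv g)\<close> to vanish, so that division by this scalar is harmless. The map
  \<psi> is never shown to be multiplicative: compatibility with left multiplication by generators
  suffices, because every word arises from the empty one by prepending letters. The prohibitions
  reconcile the two sides: where an inadmissible union makes a product zero by definition, the
  corresponding product of idempotents is zero as a consequence of the relations.\<close>

lemma (in cring) basis_vec_closed:
  assumes "b \<in> B"
  shows "basis_vec R b \<in> carrier (basis_algebra R B \<mu> u)"
proof -
  have "supp R (basis_vec R b) \<subseteq> {b}"
    by (auto simp: supp_def basis_vec_def)
  then show ?thesis
    using assms by (auto simp: basis_algebra_def basis_vec_def intro: finite_subset)
qed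

text \<open>The carrier of \<open>basis_algebra\<close> depends on \<open>K\<close> and
  \<open>B\<close> only, so \<open>mu_closed\<close> is not circular although it mentions \<mu> on
  both sides. Associativity and the unit law are left to \<open>assoc_algebra_A\<close>, so that
  bilinearity is already available while they are being verified for a concrete \<mu>.\<close>

locale structure_constants = cring K for K (structure) +
  fixes B :: "'b set" and \<mu> :: "'b \<Rightarrow> 'b \<Rightarrow> 'b \<Rightarrow> 'a" and u :: 'b
  assumes mu_closed: "\<lbrakk>p \<in> B; q \<in> B\<rbrakk> \<Longrightarrow> \<mu> p q \<in> carrier (basis_algebra K B \<mu> u)"
    and unit_in_basis: "u \<in> B"
begin

abbreviation "A \<equiv> basis_algebra K B \<mu> u"

lemma carrier_A: "carrier A = {f. (\<forall>b. f b \<in> carrier K) \<and> finite (supp K f) \<and> supp K f \<subseteq> B}"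
  by (simp add: basis_algebra_def)

lemma zero_A: "\<zero>\<^bsub>A\<^esub> r = \<zero>"
  and one_A: "\<one>\<^bsub>A\<^esub> = basis_vec K u"
  and add_A: "(x \<oplus>\<^bsub>A\<^esub> y) r = x r \<oplus> y r"
  and smult_A: "(c \<odot>\<^bsub>A\<^esub> x) r = c \<otimes> x r"
  by (simp_all add: basis_algebra_def)

lemma coeff_closed [simp]: "x \<in> carrier A \<Longrightarrow> x b \<in> carrier K"
  by (simp add: carrier_A)

lemma coeff_notin: "\<lbrakk>x \<in> carrier A; b \<notin> B\<rbrakk> \<Longrightarrow> x b = \<zero>"
  by (auto simp: carrier_A supp_def simp del: coeff_closed)

declare basis_vec_closed [simp]

lemma zero_A_closed [simp]: "\<zero>\<^bsub>A\<^esub> \<in> carrier A"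
  by (simp add: carrier_A zero_A supp_def del: coeff_closed)

lemma supp_add:
  "\<lbrakk>x \<in> carrier A; y \<in> carrier A\<rbrakk> \<Longrightarrow> supp K (x \<oplus>\<^bsub>A\<^esub> y) \<subseteq> supp K x \<union> supp K y"
  by (auto simp: supp_def add_A)

lemma supp_smult:
  "\<lbrakk>c \<in> carrier K; x \<in> carrier A\<rbrakk> \<Longrightarrow> supp K (c \<odot>\<^bsub>A\<^esub> x) \<subseteq> supp K x"
  by (auto simp: supp_def smult_A)

lemma add_A_closed [simp]: "\<lbrakk>x \<in> carrier A; y \<in> carrier A\<rbrakk> \<Longrightarrow> x \<oplus>\<^bsub>A\<^esub> y \<in> carrier A"
proof -
  assume xy: "x \<in> carrier A" "y \<in> carrier A"
  from xy have "supp K (x \<oplus>\<^bsub>A\<^esub> y) \<subseteq> supp K x \<union> supp K y"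
    by (rule supp_add)
  then show ?thesis
    using xy unfolding carrier_A by (auto simp: add_A intro: finite_subset)
qed

lemma smult_A_closed [simp]: "\<lbrakk>c \<in> carrier K; x \<in> carrier A\<rbrakk> \<Longrightarrow> c \<odot>\<^bsub>A\<^esub> x \<in> carrier A"
proof -
  assume cx: "c \<in> carrier K" "x \<in> carrier A"
  from cx have "supp K (c \<odot>\<^bsub>A\<^esub> x) \<subseteq> supp K x"
    by (rule supp_smult)
  then show ?thesis
    using cx unfolding carrier_A by (auto simp: smult_A intro: finite_subset)
qed

lemma module_A: "module K A"
proof (rule moduleI)
  show "abelian_group A"
  proof (rule abelian_groupI)
    fix x assume x: "x \<in> carrier A"
    have "\<ominus> \<one> \<odot>\<^bsub>A\<^esub> x \<in> carrier A"
      using x by simp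
    moreover have "(\<ominus> \<one> \<odot>\<^bsub>A\<^esub> x) \<oplus>\<^bsub>A\<^esub> x = \<zero>\<^bsub>A\<^esub>"
      using x by (auto simp: fun_eq_iff add_A smult_A zero_A l_minus l_neg)
    ultimately show "\<exists>y\<in>carrier A. y \<oplus>\<^bsub>A\<^esub> x = \<zero>\<^bsub>A\<^esub>"
      by blast
  qed (auto simp: fun_eq_iff add_A zero_A a_ac)
qed (auto simp: fun_eq_iff add_A smult_A l_distr r_distr m_assoc is_cring)

text \<open>Induction on a finite set containing the support, splitting off one coordinate at a
  time. It replaces manipulation of finite sums both for equality of linear maps and for
  surjectivity of \<phi>.\<close>

lemma linear_induct [consumes 1, case_names zero add]:
  assumes "x \<in> carrier A"
    and "P \<zero>\<^bsub>A\<^esub>"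
    and step: "\<And>x c b. \<lbrakk>x \<in> carrier A; P x; c \<in> carrier K; b \<in> B\<rbrakk>
      \<Longrightarrow> P (x \<oplus>\<^bsub>A\<^esub> c \<odot>\<^bsub>A\<^esub> basis_vec K b)"
  shows "P x"
proof -
  have "x \<in> carrier A \<longrightarrow> supp K x \<subseteq> F \<longrightarrow> P x" if "finite F" for F x
    using that
  proof (induction F arbitrary: x)
    case empty
    show ?case
    proof (intro impI)
      assume "supp K x \<subseteq> {}"
      then have "x = \<zero>\<^bsub>A\<^esub>"
        by (auto simp: fun_eq_iff supp_def zero_A)
      then show "P x" using assms(2) by simp
    qed
  next
    case (insert b F)
    show ?case
    proof (intro impI)
      assume x: "x \<in> carrier A" and s: "supp K x \<subseteq> insert b F"
      let ?y = "x(b := \<zero>)"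
      have sy: "supp K ?y \<subseteq> F" "supp K ?y \<subseteq> supp K x"
        using s by (auto simp: supp_def)
      then have y: "?y \<in> carrier A"
        using x unfolding carrier_A by (auto intro: finite_subset)
      then have Py: "P ?y" using insert.IH sy by blast
      show "P x"
      \<comment> \<open>The set \<open>F\<close> need not lie in \<open>B\<close>; at a point
        outside \<open>B\<close> the coefficient is already zero and nothing is split off.\<close>
      proof (cases "b \<in> B")
        case True
        have "x = ?y \<oplus>\<^bsub>A\<^esub> x b \<odot>\<^bsub>A\<^esub> basis_vec K b"
          using x by (auto simp: fun_eq_iff add_A smult_A basis_vec_def)
        then show ?thesis using step[OF y Py _ True, of "x b"] x by simp
      next
        case False
        then have "?y = x" using coeff_notin[OF x] by auto
        then show ?thesis using Py by simp
      qed
    qed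
  qed
  moreover have "finite (supp K x)"
    using assms(1) by (simp add: carrier_A del: coeff_closed)
  ultimately show ?thesis using assms(1) by blast
qed

lemma mu_coeff [simp]: "\<lbrakk>p \<in> B; q \<in> B\<rbrakk> \<Longrightarrow> \<mu> p q r \<in> carrier K"
  using coeff_closed[OF mu_closed] .

lemma supp_subset: "x \<in> carrier A \<Longrightarrow> supp K x \<subseteq> B"
  and supp_finite: "x \<in> carrier A \<Longrightarrow> finite (supp K x)"
  by (simp_all add: carrier_A del: coeff_closed)

lemma mult_A: "(x \<otimes>\<^bsub>A\<^esub> y) r =
    (\<Oplus>p\<in>supp K x. \<Oplus>q\<in>supp K y. x p \<otimes> y q \<otimes> \<mu> p q r)"
  by (simp add: basis_algebra_def del: coeff_closed)

text \<open>Supports change under addition and scaling, so the defining double sums of different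
  products have different index sets. Over a common finite superset they can be compared term by
  term; the superset stays inside \<open>B\<close> to keep the coefficients of \<mu> in
  \<open>K\<close>.\<close>

lemma mult_A_superset:
  assumes x: "x \<in> carrier A" and y: "y \<in> carrier A"
    and S: "finite S" "supp K x \<subseteq> S" "S \<subseteq> B"
    and T: "finite T" "supp K y \<subseteq> T" "T \<subseteq> B"
  shows "(x \<otimes>\<^bsub>A\<^esub> y) r = (\<Oplus>p\<in>S. \<Oplus>q\<in>T. x p \<otimes> y q \<otimes> \<mu> p q r)"
proof -
  have cl: "x p \<otimes> y q \<otimes> \<mu> p q r \<in> carrier K" if "p \<in> S" "q \<in> T" for p q
    using that S T x y by (intro m_closed mu_coeff coeff_closed) auto
  have inner: "(\<Oplus>q\<in>supp K y. x p \<otimes> y q \<otimes> \<mu> p q r) = (\<Oplus>q\<in>T. x p \<otimes> y q \<otimes> \<mu> p q r)"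
    if "p \<in> S" for p
    using that cl S T x y
    by (intro add.finprod_mono_neutral_cong_left) (auto simp: supp_def subset_iff)
  have "(x \<otimes>\<^bsub>A\<^esub> y) r = (\<Oplus>p\<in>supp K x. \<Oplus>q\<in>T. x p \<otimes> y q \<otimes> \<mu> p q r)"
    unfolding mult_A
  proof (rule add.finprod_cong')
    show "(\<Oplus>q\<in>supp K y. x p \<otimes> y q \<otimes> \<mu> p q r) = (\<Oplus>q\<in>T. x p \<otimes> y q \<otimes> \<mu> p q r)"
      if "p \<in> supp K x" for p
      using that S(2) inner by blast
  qed (use S(2) cl in \<open>auto intro!: finsum_closed\<close>)
  also have "\<dots> = (\<Oplus>p\<in>S. \<Oplus>q\<in>T. x p \<otimes> y q \<otimes> \<mu> p q r)"
  proof (rule add.finprod_mono_neutral_cong_left)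
    fix p assume "p \<in> S - supp K x"
    then have "x p = \<zero>" by (simp add: supp_def)
    then show "(\<Oplus>q\<in>T. x p \<otimes> y q \<otimes> \<mu> p q r) = \<zero>"
      using \<open>p \<in> S - supp K x\<close> S T y by (intro add.finprod_one_eqI) (auto simp: subset_iff)
  qed (use S cl in \<open>auto intro!: finsum_closed\<close>)
  finally show ?thesis .
qed

lemma mult_A_closed [simp]:
  assumes x: "x \<in> carrier A" and y: "y \<in> carrier A"
  shows "x \<otimes>\<^bsub>A\<^esub> y \<in> carrier A"
proof -
  let ?U = "\<Union>p\<in>supp K x. \<Union>q\<in>supp K y. supp K (\<mu> p q)"
  note sx = supp_subset[OF x] and sy = supp_subset[OF y]
  have cl: "x p \<otimes> y q \<otimes> \<mu> p q r \<in> carrier K" if "p \<in> supp K x" "q \<in> supp K y" for p q r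
    using that sx sy x y by (intro m_closed mu_coeff coeff_closed) auto
  have "supp K (x \<otimes>\<^bsub>A\<^esub> y) \<subseteq> ?U"
  proof
    fix r assume r: "r \<in> supp K (x \<otimes>\<^bsub>A\<^esub> y)"
    show "r \<in> ?U"
    proof (rule ccontr)
      assume "r \<notin> ?U"
      then have z: "\<mu> p q r = \<zero>" if "p \<in> supp K x" "q \<in> supp K y" for p q
        using that by (auto simp: supp_def)
      have "(x \<otimes>\<^bsub>A\<^esub> y) r = \<zero>"
        unfolding mult_A using z x y by (intro add.finprod_one_eqI) auto
      with r show False by (simp add: supp_def)
    qed
  qed
  moreover have "finite ?U"
    using supp_finite x y sx sy mu_closed by blast
  moreover have "?U \<subseteq> B"
    using supp_subset[OF mu_closed] sx sy by blast
  moreover have "(x \<otimes>\<^bsub>A\<^esub> y) r \<in> carrier K" for r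
    unfolding mult_A using cl by (auto intro!: finsum_closed)
  ultimately show ?thesis
    unfolding carrier_A using finite_subset by blast
qed

lemma mult_basis_vec:
  assumes "p \<in> B" "q \<in> B"
  shows "basis_vec K p \<otimes>\<^bsub>A\<^esub> basis_vec K q = \<mu> p q"
proof
  fix r
  \<comment> \<open>Singletons are taken instead of the supports because the support of a basis
    vector is empty when \<open>K\<close> is the zero ring.\<close>
  have "(basis_vec K p \<otimes>\<^bsub>A\<^esub> basis_vec K q) r =
      (\<Oplus>p'\<in>{p}. \<Oplus>q'\<in>{q}. basis_vec K p p' \<otimes> basis_vec K q q' \<otimes> \<mu> p' q' r)"
    using assms by (intro mult_A_superset) (auto simp: supp_def, auto simp: basis_vec_def split: if_splits)
  also have "\<dots> = \<mu> p q r"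
    using assms by (simp add: basis_vec_def)
  finally show "(basis_vec K p \<otimes>\<^bsub>A\<^esub> basis_vec K q) r = \<mu> p q r" .
qed

text \<open>All three products are expanded over the union of the supports of \<open>x\<close> and
  \<open>y\<close>, where the claim is distributivity in \<open>K\<close> under the sum.\<close>

lemma mult_l_distr:
  assumes "x \<in> carrier A" "y \<in> carrier A" "z \<in> carrier A"
  shows "(x \<oplus>\<^bsub>A\<^esub> y) \<otimes>\<^bsub>A\<^esub> z = x \<otimes>\<^bsub>A\<^esub> z \<oplus>\<^bsub>A\<^esub> y \<otimes>\<^bsub>A\<^esub> z"
proof
  fix r
  let ?S = "supp K x \<union> supp K y" and ?T = "supp K z"
  note s = assms[THEN supp_subset] assms[THEN supp_finite]
  have cl: "w p \<otimes> z q \<otimes> \<mu> p q r \<in> carrier K" if "p \<in> ?S" "q \<in> ?T" "w \<in> carrier A" for p q w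
    using that assms s by (intro m_closed mu_coeff coeff_closed) auto
  have *: "(w \<otimes>\<^bsub>A\<^esub> z) r = (\<Oplus>p\<in>?S. \<Oplus>q\<in>?T. w p \<otimes> z q \<otimes> \<mu> p q r)"
    if "w \<in> carrier A" "supp K w \<subseteq> ?S" for w
    using that s assms by (intro mult_A_superset) auto
  have "((x \<oplus>\<^bsub>A\<^esub> y) \<otimes>\<^bsub>A\<^esub> z) r =
      (\<Oplus>p\<in>?S. \<Oplus>q\<in>?T. (x \<oplus>\<^bsub>A\<^esub> y) p \<otimes> z q \<otimes> \<mu> p q r)"
    using assms by (intro * supp_add) auto
  also have "\<dots> = (\<Oplus>p\<in>?S. (\<Oplus>q\<in>?T. x p \<otimes> z q \<otimes> \<mu> p q r) \<oplus> (\<Oplus>q\<in>?T. y p \<otimes> z q \<otimes> \<mu> p q r))"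
  proof (rule add.finprod_cong')
    fix p assume p: "p \<in> ?S"
    have "(\<Oplus>q\<in>?T. (x \<oplus>\<^bsub>A\<^esub> y) p \<otimes> z q \<otimes> \<mu> p q r) =
        (\<Oplus>q\<in>?T. (x p \<otimes> z q \<otimes> \<mu> p q r) \<oplus> (y p \<otimes> z q \<otimes> \<mu> p q r))"
      using p s assms cl[of p] by (intro add.finprod_cong') (auto simp: add_A l_distr subset_iff)
    also have "\<dots> = (\<Oplus>q\<in>?T. x p \<otimes> z q \<otimes> \<mu> p q r) \<oplus> (\<Oplus>q\<in>?T. y p \<otimes> z q \<otimes> \<mu> p q r)"
      using p assms cl by (intro finsum_addf) auto
    finally show "(\<Oplus>q\<in>?T. (x \<oplus>\<^bsub>A\<^esub> y) p \<otimes> z q \<otimes> \<mu> p q r) = \<dots>" .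
  qed (use assms cl in \<open>auto intro!: finsum_closed a_closed\<close>)
  also have "\<dots> = (\<Oplus>p\<in>?S. \<Oplus>q\<in>?T. x p \<otimes> z q \<otimes> \<mu> p q r) \<oplus> (\<Oplus>p\<in>?S. \<Oplus>q\<in>?T. y p \<otimes> z q \<otimes> \<mu> p q r)"
    using assms cl by (intro finsum_addf) (auto intro!: finsum_closed)
  also have "\<dots> = (x \<otimes>\<^bsub>A\<^esub> z \<oplus>\<^bsub>A\<^esub> y \<otimes>\<^bsub>A\<^esub> z) r"
    using *[OF assms(1)] *[OF assms(2)] by (simp add: add_A)
  finally show "((x \<oplus>\<^bsub>A\<^esub> y) \<otimes>\<^bsub>A\<^esub> z) r = (x \<otimes>\<^bsub>A\<^esub> z \<oplus>\<^bsub>A\<^esub> y \<otimes>\<^bsub>A\<^esub> z) r" .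
qed

lemma mult_r_distr:
  assumes "x \<in> carrier A" "y \<in> carrier A" "z \<in> carrier A"
  shows "z \<otimes>\<^bsub>A\<^esub> (x \<oplus>\<^bsub>A\<^esub> y) = z \<otimes>\<^bsub>A\<^esub> x \<oplus>\<^bsub>A\<^esub> z \<otimes>\<^bsub>A\<^esub> y"
proof
  fix r
  let ?S = "supp K x \<union> supp K y" and ?T = "supp K z"
  note s = assms[THEN supp_subset] assms[THEN supp_finite]
  have cl: "z p \<otimes> w q \<otimes> \<mu> p q r \<in> carrier K" if "p \<in> ?T" "q \<in> ?S" "w \<in> carrier A" for p q w
    using that assms s by (intro m_closed mu_coeff coeff_closed) auto
  have *: "(z \<otimes>\<^bsub>A\<^esub> w) r = (\<Oplus>p\<in>?T. \<Oplus>q\<in>?S. z p \<otimes> w q \<otimes> \<mu> p q r)"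
    if "w \<in> carrier A" "supp K w \<subseteq> ?S" for w
    using that s assms by (intro mult_A_superset) auto
  have "(z \<otimes>\<^bsub>A\<^esub> (x \<oplus>\<^bsub>A\<^esub> y)) r =
      (\<Oplus>p\<in>?T. \<Oplus>q\<in>?S. z p \<otimes> (x \<oplus>\<^bsub>A\<^esub> y) q \<otimes> \<mu> p q r)"
    using assms by (intro * supp_add) auto
  also have "\<dots> = (\<Oplus>p\<in>?T. (\<Oplus>q\<in>?S. z p \<otimes> x q \<otimes> \<mu> p q r) \<oplus> (\<Oplus>q\<in>?S. z p \<otimes> y q \<otimes> \<mu> p q r))"
  proof (rule add.finprod_cong')
    fix p assume p: "p \<in> ?T"
    have "(\<Oplus>q\<in>?S. z p \<otimes> (x \<oplus>\<^bsub>A\<^esub> y) q \<otimes> \<mu> p q r) =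
        (\<Oplus>q\<in>?S. (z p \<otimes> x q \<otimes> \<mu> p q r) \<oplus> (z p \<otimes> y q \<otimes> \<mu> p q r))"
      using p s assms cl[of p] by (intro add.finprod_cong') (auto simp: add_A l_distr r_distr subset_iff)
    also have "\<dots> = (\<Oplus>q\<in>?S. z p \<otimes> x q \<otimes> \<mu> p q r) \<oplus> (\<Oplus>q\<in>?S. z p \<otimes> y q \<otimes> \<mu> p q r)"
      using p assms cl by (intro finsum_addf) auto
    finally show "(\<Oplus>q\<in>?S. z p \<otimes> (x \<oplus>\<^bsub>A\<^esub> y) q \<otimes> \<mu> p q r) = \<dots>" .
  qed (use assms cl in \<open>auto intro!: finsum_closed a_closed\<close>)
  also have "\<dots> = (\<Oplus>p\<in>?T. \<Oplus>q\<in>?S. z p \<otimes> x q \<otimes> \<mu> p q r) \<oplus> (\<Oplus>p\<in>?T. \<Oplus>q\<in>?S. z p \<otimes> y q \<otimes> \<mu> p q r)"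
    using assms cl by (intro finsum_addf) (auto intro!: finsum_closed)
  also have "\<dots> = (z \<otimes>\<^bsub>A\<^esub> x \<oplus>\<^bsub>A\<^esub> z \<otimes>\<^bsub>A\<^esub> y) r"
    using *[OF assms(1)] *[OF assms(2)] by (simp add: add_A)
  finally show "(z \<otimes>\<^bsub>A\<^esub> (x \<oplus>\<^bsub>A\<^esub> y)) r = (z \<otimes>\<^bsub>A\<^esub> x \<oplus>\<^bsub>A\<^esub> z \<otimes>\<^bsub>A\<^esub> y) r" .
qed

text \<open>Scaling can shrink the support, since \<open>c\<close> may be zero or a zero divisor;
  hence both sides are summed over the support of the unscaled vector.\<close>

lemma mult_smult_left:
  assumes "c \<in> carrier K" "x \<in> carrier A" "y \<in> carrier A"
  shows "(c \<odot>\<^bsub>A\<^esub> x) \<otimes>\<^bsub>A\<^esub> y = c \<odot>\<^bsub>A\<^esub> (x \<otimes>\<^bsub>A\<^esub> y)"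
proof
  fix r
  let ?S = "supp K x" and ?T = "supp K y"
  note s = assms(2,3)[THEN supp_subset] assms(2,3)[THEN supp_finite]
  have cl: "x p \<otimes> y q \<otimes> \<mu> p q r \<in> carrier K" if "p \<in> ?S" "q \<in> ?T" for p q
    using that assms s by (intro m_closed mu_coeff coeff_closed) auto
  have "((c \<odot>\<^bsub>A\<^esub> x) \<otimes>\<^bsub>A\<^esub> y) r = (\<Oplus>p\<in>?S. \<Oplus>q\<in>?T. (c \<otimes> x p) \<otimes> y q \<otimes> \<mu> p q r)"
    using s assms supp_smult by (subst mult_A_superset[of _ _ ?S ?T]) (simp_all add: smult_A)
  also have "\<dots> = (\<Oplus>p\<in>?S. c \<otimes> (\<Oplus>q\<in>?T. x p \<otimes> y q \<otimes> \<mu> p q r))"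
  proof (rule add.finprod_cong')
    fix p assume p: "p \<in> ?S"
    have "(\<Oplus>q\<in>?T. (c \<otimes> x p) \<otimes> y q \<otimes> \<mu> p q r) = (\<Oplus>q\<in>?T. c \<otimes> (x p \<otimes> y q \<otimes> \<mu> p q r))"
      using p s assms cl[of p] by (intro add.finprod_cong') (auto simp: m_assoc subset_iff)
    also have "\<dots> = c \<otimes> (\<Oplus>q\<in>?T. x p \<otimes> y q \<otimes> \<mu> p q r)"
      using p s assms cl by (intro finsum_rdistr[symmetric]) auto
    finally show "(\<Oplus>q\<in>?T. (c \<otimes> x p) \<otimes> y q \<otimes> \<mu> p q r) = \<dots>" .
  qed (use assms cl in \<open>auto intro!: finsum_closed\<close>)
  also have "\<dots> = c \<otimes> (\<Oplus>p\<in>?S. \<Oplus>q\<in>?T. x p \<otimes> y q \<otimes> \<mu> p q r)"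
    using s assms cl by (intro finsum_rdistr[symmetric]) (auto intro!: finsum_closed)
  finally show "((c \<odot>\<^bsub>A\<^esub> x) \<otimes>\<^bsub>A\<^esub> y) r = (c \<odot>\<^bsub>A\<^esub> (x \<otimes>\<^bsub>A\<^esub> y)) r"
    by (simp add: smult_A mult_A)
qed

lemma mult_smult_right:
  assumes "c \<in> carrier K" "x \<in> carrier A" "y \<in> carrier A"
  shows "x \<otimes>\<^bsub>A\<^esub> (c \<odot>\<^bsub>A\<^esub> y) = c \<odot>\<^bsub>A\<^esub> (x \<otimes>\<^bsub>A\<^esub> y)"
proof
  fix r
  let ?S = "supp K x" and ?T = "supp K y"
  note s = assms(2,3)[THEN supp_subset] assms(2,3)[THEN supp_finite]
  have cl: "x p \<otimes> y q \<otimes> \<mu> p q r \<in> carrier K" if "p \<in> ?S" "q \<in> ?T" for p q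
    using that assms s by (intro m_closed mu_coeff coeff_closed) auto
  have "(x \<otimes>\<^bsub>A\<^esub> (c \<odot>\<^bsub>A\<^esub> y)) r = (\<Oplus>p\<in>?S. \<Oplus>q\<in>?T. x p \<otimes> (c \<otimes> y q) \<otimes> \<mu> p q r)"
    using s assms supp_smult by (subst mult_A_superset[of _ _ ?S ?T]) (simp_all add: smult_A)
  also have "\<dots> = (\<Oplus>p\<in>?S. c \<otimes> (\<Oplus>q\<in>?T. x p \<otimes> y q \<otimes> \<mu> p q r))"
  proof (rule add.finprod_cong')
    fix p assume p: "p \<in> ?S"
    have "(\<Oplus>q\<in>?T. x p \<otimes> (c \<otimes> y q) \<otimes> \<mu> p q r) = (\<Oplus>q\<in>?T. c \<otimes> (x p \<otimes> y q \<otimes> \<mu> p q r))"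
      using p s assms cl[of p]
      by (intro add.finprod_cong') (auto simp: m_assoc m_lcomm subset_iff)
    also have "\<dots> = c \<otimes> (\<Oplus>q\<in>?T. x p \<otimes> y q \<otimes> \<mu> p q r)"
      using p s assms cl by (intro finsum_rdistr[symmetric]) auto
    finally show "(\<Oplus>q\<in>?T. x p \<otimes> (c \<otimes> y q) \<otimes> \<mu> p q r) = \<dots>" .
  qed (use assms cl in \<open>auto intro!: finsum_closed\<close>)
  also have "\<dots> = c \<otimes> (\<Oplus>p\<in>?S. \<Oplus>q\<in>?T. x p \<otimes> y q \<otimes> \<mu> p q r)"
    using s assms cl by (intro finsum_rdistr[symmetric]) (auto intro!: finsum_closed)
  finally show "(x \<otimes>\<^bsub>A\<^esub> (c \<odot>\<^bsub>A\<^esub> y)) r = (c \<odot>\<^bsub>A\<^esub> (x \<otimes>\<^bsub>A\<^esub> y)) r"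
    by (simp add: smult_A mult_A)
qed

end


section \<open>Linear maps\<close>

definition linear_map ::
  "('k, 'm) ring_scheme \<Rightarrow> ('k, 'a, 'n) module_scheme \<Rightarrow> ('k, 'b, 'p) module_scheme \<Rightarrow> ('a \<Rightarrow> 'b) \<Rightarrow> bool"
  where "linear_map K M N f \<longleftrightarrow>
    (\<forall>x\<in>carrier M. f x \<in> carrier N) \<and>
    (\<forall>x\<in>carrier M. \<forall>y\<in>carrier M. f (x \<oplus>\<^bsub>M\<^esub> y) = f x \<oplus>\<^bsub>N\<^esub> f y) \<and>
    (\<forall>c\<in>carrier K. \<forall>x\<in>carrier M. f (c \<odot>\<^bsub>M\<^esub> x) = c \<odot>\<^bsub>N\<^esub> f x)"

lemma linear_mapI:
  assumes "\<And>x. x \<in> carrier M \<Longrightarrow> f x \<in> carrier N"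
    and "\<And>x y. \<lbrakk>x \<in> carrier M; y \<in> carrier M\<rbrakk> \<Longrightarrow> f (x \<oplus>\<^bsub>M\<^esub> y) = f x \<oplus>\<^bsub>N\<^esub> f y"
    and "\<And>c x. \<lbrakk>c \<in> carrier K; x \<in> carrier M\<rbrakk> \<Longrightarrow> f (c \<odot>\<^bsub>M\<^esub> x) = c \<odot>\<^bsub>N\<^esub> f x"
  shows "linear_map K M N f"
  using assms by (simp add: linear_map_def)

lemma linear_mapD:
  assumes "linear_map K M N f"
  shows linear_map_closed: "x \<in> carrier M \<Longrightarrow> f x \<in> carrier N"
    and linear_map_add: "\<lbrakk>x \<in> carrier M; y \<in> carrier M\<rbrakk> \<Longrightarrow> f (x \<oplus>\<^bsub>M\<^esub> y) = f x \<oplus>\<^bsub>N\<^esub> f y"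
    and linear_map_smult: "\<lbrakk>c \<in> carrier K; x \<in> carrier M\<rbrakk> \<Longrightarrow> f (c \<odot>\<^bsub>M\<^esub> x) = c \<odot>\<^bsub>N\<^esub> f x"
  using assms by (auto simp: linear_map_def)

lemma linear_map_zero:
  assumes "module K M" "module K N" "linear_map K M N f"
  shows "f \<zero>\<^bsub>M\<^esub> = \<zero>\<^bsub>N\<^esub>"
proof -
  interpret M: module K M by fact
  interpret N: module K N by fact
  have "f (\<zero>\<^bsub>K\<^esub> \<odot>\<^bsub>M\<^esub> \<zero>\<^bsub>M\<^esub>) = \<zero>\<^bsub>K\<^esub> \<odot>\<^bsub>N\<^esub> f \<zero>\<^bsub>M\<^esub>"
    using linear_map_smult[OF assms(3)] by blast
  then show ?thesis
    using linear_map_closed[OF assms(3)] by simp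
qed

definition lin_ext ::
  "('k, 'm) ring_scheme \<Rightarrow> ('k, 'a, 'n) module_scheme \<Rightarrow> ('b \<Rightarrow> 'a) \<Rightarrow> ('b \<Rightarrow> 'k) \<Rightarrow> 'a"
  where "lin_ext K N f x = (\<Oplus>\<^bsub>N\<^esub>b\<in>supp K x. x b \<odot>\<^bsub>N\<^esub> f b)"

context structure_constants
begin

text \<open>Multilinear identities are reduced to basis vectors through this lemma, one variable at
  a time with the others fixed.\<close>

lemma linear_map_eqI:
  assumes N: "module K N"
    and f: "linear_map K A N f" and g: "linear_map K A N g"
    and eq: "\<And>b. b \<in> B \<Longrightarrow> f (basis_vec K b) = g (basis_vec K b)"
    and x: "x \<in> carrier A"
  shows "f x = g x"
  using x
proof (induction rule: linear_induct)
  case zero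
  show ?case
    using linear_map_zero[OF module_A N f] linear_map_zero[OF module_A N g] by simp
next
  case (add x c b)
  then show ?case
    by (simp add: linear_mapD[OF f] linear_mapD[OF g] eq)
qed

lemma
  assumes N: "module K N" and f: "\<And>b. b \<in> B \<Longrightarrow> f b \<in> carrier N"
  shows linear_map_lin_ext: "linear_map K A N (lin_ext K N f)"
    and lin_ext_basis_vec: "b \<in> B \<Longrightarrow> lin_ext K N f (basis_vec K b) = f b"
proof -
  interpret N: module K N by fact
  have cl: "x b \<odot>\<^bsub>N\<^esub> f b \<in> carrier N" if "x \<in> carrier A" "b \<in> B" for x b
    using that f by (intro N.smult_closed coeff_closed)
  have superset: "lin_ext K N f x = (\<Oplus>\<^bsub>N\<^esub>b\<in>S. x b \<odot>\<^bsub>N\<^esub> f b)"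
    if x: "x \<in> carrier A" and S: "finite S" "supp K x \<subseteq> S" "S \<subseteq> B" for x S
    unfolding lin_ext_def
  proof (rule N.add.finprod_mono_neutral_cong_left)
    fix b assume b: "b \<in> S - supp K x"
    then have "x b = \<zero>" by (simp add: supp_def)
    then show "x b \<odot>\<^bsub>N\<^esub> f b = \<zero>\<^bsub>N\<^esub>" using b S f by auto
  qed (use S x cl in auto)
  show "linear_map K A N (lin_ext K N f)"
  proof (rule linear_mapI)
    fix x assume x: "x \<in> carrier A"
    then show "lin_ext K N f x \<in> carrier N"
      unfolding lin_ext_def using supp_subset[OF x] cl[OF x] by (intro N.finsum_closed) auto
  next
    fix x y assume x: "x \<in> carrier A" and y: "y \<in> carrier A"
    let ?S = "supp K x \<union> supp K y"
    have S: "finite ?S" "?S \<subseteq> B"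
      using supp_finite[OF x] supp_finite[OF y] supp_subset[OF x] supp_subset[OF y] by auto
    have "lin_ext K N f (x \<oplus>\<^bsub>A\<^esub> y) = (\<Oplus>\<^bsub>N\<^esub>b\<in>?S. (x \<oplus>\<^bsub>A\<^esub> y) b \<odot>\<^bsub>N\<^esub> f b)"
      using S x y supp_add by (intro superset) auto
    also have "\<dots> = (\<Oplus>\<^bsub>N\<^esub>b\<in>?S. x b \<odot>\<^bsub>N\<^esub> f b \<oplus>\<^bsub>N\<^esub> y b \<odot>\<^bsub>N\<^esub> f b)"
    proof (rule N.add.finprod_cong')
      fix b assume "b \<in> ?S"
      then show "(x \<oplus>\<^bsub>A\<^esub> y) b \<odot>\<^bsub>N\<^esub> f b = x b \<odot>\<^bsub>N\<^esub> f b \<oplus>\<^bsub>N\<^esub> y b \<odot>\<^bsub>N\<^esub> f b"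
        unfolding add_A using S f by (intro N.smult_l_distr coeff_closed x y) auto
    qed (use S cl[OF x] cl[OF y] in \<open>auto\<close>)
    also have "\<dots> = (\<Oplus>\<^bsub>N\<^esub>b\<in>?S. x b \<odot>\<^bsub>N\<^esub> f b) \<oplus>\<^bsub>N\<^esub> (\<Oplus>\<^bsub>N\<^esub>b\<in>?S. y b \<odot>\<^bsub>N\<^esub> f b)"
      using S cl x y by (intro N.finsum_addf) auto
    also have "\<dots> = lin_ext K N f x \<oplus>\<^bsub>N\<^esub> lin_ext K N f y"
      using superset[OF x S(1) _ S(2)] superset[OF y S(1) _ S(2)] by simp
    finally show "lin_ext K N f (x \<oplus>\<^bsub>A\<^esub> y) = lin_ext K N f x \<oplus>\<^bsub>N\<^esub> lin_ext K N f y" .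
  next
    fix c x assume c: "c \<in> carrier K" and x: "x \<in> carrier A"
    note S = supp_finite[OF x] supp_subset[OF x]
    have "lin_ext K N f (c \<odot>\<^bsub>A\<^esub> x) = (\<Oplus>\<^bsub>N\<^esub>b\<in>supp K x. (c \<odot>\<^bsub>A\<^esub> x) b \<odot>\<^bsub>N\<^esub> f b)"
      using S c x supp_smult by (intro superset) auto
    also have "\<dots> = (\<Oplus>\<^bsub>N\<^esub>b\<in>supp K x. c \<odot>\<^bsub>N\<^esub> (x b \<odot>\<^bsub>N\<^esub> f b))"
    proof (rule N.add.finprod_cong')
      fix b assume "b \<in> supp K x"
      then show "(c \<odot>\<^bsub>A\<^esub> x) b \<odot>\<^bsub>N\<^esub> f b = c \<odot>\<^bsub>N\<^esub> (x b \<odot>\<^bsub>N\<^esub> f b)"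
        unfolding smult_A using S f by (intro N.smult_assoc1 coeff_closed c x) auto
    qed (use S c cl[OF x] in auto)
    also have "\<dots> = c \<odot>\<^bsub>N\<^esub> lin_ext K N f x"
      unfolding lin_ext_def using S c cl[OF x] by (intro N.finsum_smult_ldistr[symmetric]) auto
    finally show "lin_ext K N f (c \<odot>\<^bsub>A\<^esub> x) = c \<odot>\<^bsub>N\<^esub> lin_ext K N f x" .
  qed
  show "lin_ext K N f (basis_vec K b) = f b" if b: "b \<in> B"
  proof -
    have "lin_ext K N f (basis_vec K b) = (\<Oplus>\<^bsub>N\<^esub>b'\<in>{b}. basis_vec K b b' \<odot>\<^bsub>N\<^esub> f b')"
      using b by (intro superset) (auto simp: supp_def, auto simp: basis_vec_def split: if_splits)
    also have "\<dots> = f b"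
      using b f by (simp add: basis_vec_def)
    finally show ?thesis .
  qed
qed

lemma linear_map_mult_left:
  assumes "linear_map K A N f" "z \<in> carrier A"
  shows "linear_map K A N (\<lambda>x. f (z \<otimes>\<^bsub>A\<^esub> x))"
  using assms(2)
  by (intro linear_mapI) (auto simp: linear_mapD[OF assms(1)] mult_r_distr mult_smult_right)

lemma linear_map_mult_right:
  assumes "linear_map K A N f" "z \<in> carrier A"
  shows "linear_map K A N (\<lambda>x. f (x \<otimes>\<^bsub>A\<^esub> z))"
  using assms(2)
  by (intro linear_mapI) (auto simp: linear_mapD[OF assms(1)] mult_l_distr mult_smult_left)

lemma linear_map_id: "linear_map K A A (\<lambda>x. x)"
  by (simp add: linear_map_def)

text \<open>Two applications of \<open>linear_map_eqI\<close>: \<open>y\<close> is freed while the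
  left factor is a basis vector, then \<open>x\<close> is freed.\<close>

lemma linear_map_multiplicativeI:
  assumes M: "assoc_algebra K M" and f: "linear_map K A M f"
    and mult: "\<And>p q. \<lbrakk>p \<in> B; q \<in> B\<rbrakk> \<Longrightarrow>
      f (\<mu> p q) = f (basis_vec K p) \<otimes>\<^bsub>M\<^esub> f (basis_vec K q)"
    and x: "x \<in> carrier A" and y: "y \<in> carrier A"
  shows "f (x \<otimes>\<^bsub>A\<^esub> y) = f x \<otimes>\<^bsub>M\<^esub> f y"
proof -
  interpret MR: ring M by (rule assoc_algebra.axioms(2)[OF M])
  interpret M: assoc_algebra K M by fact
  note M_module = M.module_axioms
  have *: "f (basis_vec K p \<otimes>\<^bsub>A\<^esub> y) = f (basis_vec K p) \<otimes>\<^bsub>M\<^esub> f y" if p: "p \<in> B" for p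
  proof (rule linear_map_eqI[OF M_module _ _ _ y])
    show "linear_map K A M (\<lambda>y. f (basis_vec K p \<otimes>\<^bsub>A\<^esub> y))"
      using p by (intro linear_map_mult_left f basis_vec_closed)
    show "linear_map K A M (\<lambda>y. f (basis_vec K p) \<otimes>\<^bsub>M\<^esub> f y)"
      using p by (intro linear_mapI) (auto simp: linear_mapD[OF f] MR.r_distr M.smult_mult_right)
  qed (simp add: p mult mult_basis_vec)
  show ?thesis
  proof (rule linear_map_eqI[OF M_module _ _ _ x])
    show "linear_map K A M (\<lambda>x. f (x \<otimes>\<^bsub>A\<^esub> y))"
      by (intro linear_map_mult_right f y)
    show "linear_map K A M (\<lambda>x. f x \<otimes>\<^bsub>M\<^esub> f y)"
      using y by (intro linear_mapI) (auto simp: linear_mapD[OF f] MR.l_distr M.smult_mult_left)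
  qed (rule *)
qed

text \<open>The associativity hypothesis keeps one product in the algebra on each side because
  \<open>\<mu> p q\<close> is a vector, not a basis element. The three arguments are then freed from
  right to left in the facts \<open>1\<close>, \<open>2\<close> and \<open>3\<close>.\<close>

lemma assoc_algebra_A:
  assumes unit: "\<And>q. q \<in> B \<Longrightarrow> \<mu> u q = basis_vec K q" "\<And>q. q \<in> B \<Longrightarrow> \<mu> q u = basis_vec K q"
    and assoc: "\<And>p q s. \<lbrakk>p \<in> B; q \<in> B; s \<in> B\<rbrakk> \<Longrightarrow>
      \<mu> p q \<otimes>\<^bsub>A\<^esub> basis_vec K s = basis_vec K p \<otimes>\<^bsub>A\<^esub> \<mu> q s"
  shows "assoc_algebra K A"
proof -
  note lin = linear_map_mult_left linear_map_mult_right linear_map_id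
  have 1: "(basis_vec K p \<otimes>\<^bsub>A\<^esub> basis_vec K q) \<otimes>\<^bsub>A\<^esub> z = basis_vec K p \<otimes>\<^bsub>A\<^esub> (basis_vec K q \<otimes>\<^bsub>A\<^esub> z)"
    if p: "p \<in> B" and q: "q \<in> B" and z: "z \<in> carrier A" for p q z
  proof (rule linear_map_eqI[OF module_A _ _ _ z])
    show "linear_map K A A (\<lambda>z. (basis_vec K p \<otimes>\<^bsub>A\<^esub> basis_vec K q) \<otimes>\<^bsub>A\<^esub> z)"
      using p q by (intro lin(1,3)) auto
    show "linear_map K A A (\<lambda>z. basis_vec K p \<otimes>\<^bsub>A\<^esub> (basis_vec K q \<otimes>\<^bsub>A\<^esub> z))"
      using p q by (intro lin(1)[where f = "\<lambda>x. basis_vec K p \<otimes>\<^bsub>A\<^esub> x"] lin(1,3)) auto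
  qed (simp add: mult_basis_vec assoc p q)
  have 2: "(basis_vec K p \<otimes>\<^bsub>A\<^esub> y) \<otimes>\<^bsub>A\<^esub> z = basis_vec K p \<otimes>\<^bsub>A\<^esub> (y \<otimes>\<^bsub>A\<^esub> z)"
    if p: "p \<in> B" and y: "y \<in> carrier A" and z: "z \<in> carrier A" for p y z
  proof (rule linear_map_eqI[OF module_A _ _ _ y])
    show "linear_map K A A (\<lambda>y. (basis_vec K p \<otimes>\<^bsub>A\<^esub> y) \<otimes>\<^bsub>A\<^esub> z)"
      using p z by (intro lin(1)[where f = "\<lambda>x. x \<otimes>\<^bsub>A\<^esub> z"] lin(2,3)) auto
    show "linear_map K A A (\<lambda>y. basis_vec K p \<otimes>\<^bsub>A\<^esub> (y \<otimes>\<^bsub>A\<^esub> z))"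
      using p z by (intro lin(2)[where f = "\<lambda>x. basis_vec K p \<otimes>\<^bsub>A\<^esub> x"] lin(1,3)) auto
  qed (simp add: 1 p z)
  have 3: "(x \<otimes>\<^bsub>A\<^esub> y) \<otimes>\<^bsub>A\<^esub> z = x \<otimes>\<^bsub>A\<^esub> (y \<otimes>\<^bsub>A\<^esub> z)"
    if x: "x \<in> carrier A" and y: "y \<in> carrier A" and z: "z \<in> carrier A" for x y z
  proof (rule linear_map_eqI[OF module_A _ _ _ x])
    show "linear_map K A A (\<lambda>x. (x \<otimes>\<^bsub>A\<^esub> y) \<otimes>\<^bsub>A\<^esub> z)"
      using y z by (intro lin(2)[where f = "\<lambda>x. x \<otimes>\<^bsub>A\<^esub> z"] lin(2,3)) auto
    show "linear_map K A A (\<lambda>x. x \<otimes>\<^bsub>A\<^esub> (y \<otimes>\<^bsub>A\<^esub> z))"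
      using y z by (intro lin(2,3)) auto
  qed (simp add: 2 y z)
  have one: "\<one>\<^bsub>A\<^esub> \<in> carrier A"
    using unit_in_basis by (simp add: one_A)
  have l_one: "\<one>\<^bsub>A\<^esub> \<otimes>\<^bsub>A\<^esub> x = x" if x: "x \<in> carrier A" for x
    using linear_map_eqI[OF module_A lin(1)[OF lin(3) one] lin(3) _ x]
    by (simp add: one_A unit_in_basis mult_basis_vec unit)
  have r_one: "x \<otimes>\<^bsub>A\<^esub> \<one>\<^bsub>A\<^esub> = x" if x: "x \<in> carrier A" for x
    using linear_map_eqI[OF module_A lin(2)[OF lin(3) one] lin(3) _ x]
    by (simp add: one_A unit_in_basis mult_basis_vec unit)
  interpret AM: module K A by (rule module_A)
  have "ring A"
    by (intro ringI monoidI AM.M.abelian_group_axioms)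
       (auto simp: 3 one l_one r_one mult_l_distr mult_r_distr)
  then show ?thesis
    by (intro assoc_algebra.intro module_A assoc_algebra_axioms.intro mult_smult_left mult_smult_right)
qed

end


section \<open>The idempotents of a partial projective representation\<close>

lemma l_coset_insert:
  "g <#\<^bsub>G\<^esub> insert v V = insert (g \<otimes>\<^bsub>G\<^esub> v) (g <#\<^bsub>G\<^esub> V)"
  by (auto simp: l_coset_def)

lemma l_coset_finite: "finite V \<Longrightarrow> finite (g <#\<^bsub>G\<^esub> V)"
  by (auto simp: l_coset_def)

lemma l_coset_Un: "g <#\<^bsub>G\<^esub> (V \<union> W) = (g <#\<^bsub>G\<^esub> V) \<union> (g <#\<^bsub>G\<^esub> W)"
  by (auto simp: l_coset_def)

text \<open>The relations of the twisted partial group algebra, stated for an arbitrary algebra.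
  Three instances occur: the representation witnessing membership in \<open>pm\<close>, the twisted
  partial group algebra itself, and the algebra of admissible pairs.\<close>

locale par_rels = G: group G + K: field K + MR: ring M + M: assoc_algebra K M
  for G :: "('g, 'n) monoid_scheme" and K :: "('k, 'm) ring_scheme"
    and M :: "('k, 'a, 'p) module_scheme" (structure) +
  fixes \<sigma> :: "'g \<Rightarrow> 'g \<Rightarrow> 'k" and \<Gamma> :: "'g \<Rightarrow> 'a"
  assumes \<sigma>_closed [simp]: "\<lbrakk>g \<in> carrier G; h \<in> carrier G\<rbrakk> \<Longrightarrow> \<sigma> g h \<in> carrier K"
    and \<Gamma>_closed [simp]: "g \<in> carrier G \<Longrightarrow> \<Gamma> g \<in> carrier M"
    and \<Gamma>_one: "\<Gamma> \<one>\<^bsub>G\<^esub> = \<one>"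
    and rel_zero_left: "\<lbrakk>g \<in> carrier G; h \<in> carrier G; \<sigma> g h = \<zero>\<^bsub>K\<^esub>\<rbrakk> \<Longrightarrow>
      \<Gamma> (inv\<^bsub>G\<^esub> g) \<otimes> \<Gamma> (g \<otimes>\<^bsub>G\<^esub> h) = \<zero>"
    and rel_zero_right: "\<lbrakk>g \<in> carrier G; h \<in> carrier G; \<sigma> g h = \<zero>\<^bsub>K\<^esub>\<rbrakk> \<Longrightarrow>
      \<Gamma> (g \<otimes>\<^bsub>G\<^esub> h) \<otimes> \<Gamma> (inv\<^bsub>G\<^esub> h) = \<zero>"
    and rel_left: "\<lbrakk>g \<in> carrier G; h \<in> carrier G\<rbrakk> \<Longrightarrow>
      \<Gamma> (inv\<^bsub>G\<^esub> g) \<otimes> \<Gamma> g \<otimes> \<Gamma> h = \<sigma> g h \<odot> (\<Gamma> (inv\<^bsub>G\<^esub> g) \<otimes> \<Gamma> (g \<otimes>\<^bsub>G\<^esub> h))"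
    and rel_right: "\<lbrakk>g \<in> carrier G; h \<in> carrier G\<rbrakk> \<Longrightarrow>
      \<Gamma> g \<otimes> \<Gamma> h \<otimes> \<Gamma> (inv\<^bsub>G\<^esub> h) = \<sigma> g h \<odot> (\<Gamma> (g \<otimes>\<^bsub>G\<^esub> h) \<otimes> \<Gamma> (inv\<^bsub>G\<^esub> h))"
begin

lemmas smult_rules = M.smult_mult_left M.smult_mult_right M.smult_assoc1

lemma smult_cancel:
  assumes c: "c \<in> carrier K" "c \<noteq> \<zero>\<^bsub>K\<^esub>" and xy: "x \<in> carrier M" "y \<in> carrier M"
    and eq: "c \<odot> x = c \<odot> y"
  shows "x = y"
proof -
  have u: "c \<in> Units K" using c by (simp add: K.field_Units)
  have "inv\<^bsub>K\<^esub> c \<odot> (c \<odot> z) = z" if "z \<in> carrier M" for z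
    using u c that by (simp flip: M.smult_assoc1)
  from this[OF xy(1)] this[OF xy(2)] show ?thesis unfolding eq by (rule trans[OF sym])
qed

text \<open>Source of vanishing from a scalar mismatch: it turns failure of the cocycle identity
  into \<open>E W = 0\<close>, and a value of \<sigma> other than 1 at a pair containing the unit
  into \<open>\<Gamma> g = 0\<close>.\<close>

lemma smult_eq_imp_zero:
  assumes ab: "a \<in> carrier K" "b \<in> carrier K" "a \<noteq> b" and z: "z \<in> carrier M"
    and eq: "a \<odot> z = b \<odot> z"
  shows "z = \<zero>"
proof -
  let ?c = "a \<ominus>\<^bsub>K\<^esub> b"
  have "?c \<odot> z \<oplus> b \<odot> z = a \<odot> z"
    using ab z by (simp add: K.minus_eq K.a_assoc K.l_neg flip: M.smult_l_distr)
  then have "?c \<odot> z = \<zero>"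
    using ab z by (simp add: eq)
  moreover have "?c \<oplus>\<^bsub>K\<^esub> b = a"
    using ab by (simp add: K.minus_eq K.a_assoc K.l_neg)
  then have "?c \<noteq> \<zero>\<^bsub>K\<^esub>"
    using ab by auto
  ultimately show ?thesis
    using ab z smult_cancel[of ?c z \<zero>] by simp
qed

text \<open>The square of \<open>\<Gamma>(g) \<Gamma>(inv g)\<close> is
  \<open>\<sigma>(g, inv g)\<close> times itself, so dividing by this scalar produces an idempotent.
  The case distinction is explicit because the library inverse of 0 is an unspecified
  element.\<close>

definition e :: "'g \<Rightarrow> 'a" where
  "e g = (if \<sigma> g (inv\<^bsub>G\<^esub> g) = \<zero>\<^bsub>K\<^esub> then \<zero>
    else inv\<^bsub>K\<^esub> (\<sigma> g (inv\<^bsub>G\<^esub> g)) \<odot> (\<Gamma> g \<otimes> \<Gamma> (inv\<^bsub>G\<^esub> g)))"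

text \<open>For \<open>h = inv g\<close> the product \<open>gh\<close> is the unit, so one factor in
  each vanishing relation is \<open>\<Gamma>(1) = 1\<close>.\<close>

lemma \<Gamma>_zero:
  assumes g: "g \<in> carrier G" and 0: "\<sigma> g (inv\<^bsub>G\<^esub> g) = \<zero>\<^bsub>K\<^esub>"
  shows "\<Gamma> g = \<zero>" "\<Gamma> (inv\<^bsub>G\<^esub> g) = \<zero>"
  using rel_zero_right[OF g _ 0] rel_zero_left[OF g _ 0] g by (simp_all add: \<Gamma>_one)

text \<open>Again the relations at \<open>h = inv g\<close>. Both identities carry the same scalar
  \<open>\<sigma>(g, inv g)\<close>, never \<open>\<sigma>(inv g, g)\<close>; this is why a single
  multiplier serves in \<open>eq_by_smult\<close>.\<close>

lemma \<Gamma>_inv_\<Gamma>: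
  assumes g: "g \<in> carrier G"
  shows "\<Gamma> g \<otimes> \<Gamma> (inv\<^bsub>G\<^esub> g) \<otimes> \<Gamma> g = \<sigma> g (inv\<^bsub>G\<^esub> g) \<odot> \<Gamma> g"
    "\<Gamma> (inv\<^bsub>G\<^esub> g) \<otimes> \<Gamma> g \<otimes> \<Gamma> (inv\<^bsub>G\<^esub> g) = \<sigma> g (inv\<^bsub>G\<^esub> g) \<odot> \<Gamma> (inv\<^bsub>G\<^esub> g)"
  using rel_right[OF g, of "inv\<^bsub>G\<^esub> g"] rel_left[OF g, of "inv\<^bsub>G\<^esub> g"] g
  by (simp_all add: \<Gamma>_one)

lemma e_closed [simp]: "g \<in> carrier G \<Longrightarrow> e g \<in> carrier M"
  by (auto simp: e_def K.field_Units)

lemma smult_e: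
  assumes g: "g \<in> carrier G"
  shows "\<sigma> g (inv\<^bsub>G\<^esub> g) \<odot> e g = \<Gamma> g \<otimes> \<Gamma> (inv\<^bsub>G\<^esub> g)"
proof (cases "\<sigma> g (inv\<^bsub>G\<^esub> g) = \<zero>\<^bsub>K\<^esub>")
  case True
  then show ?thesis using g \<Gamma>_zero[OF g] by (simp add: e_def)
next
  case False
  then have "\<sigma> g (inv\<^bsub>G\<^esub> g) \<in> Units K" using g by (simp add: K.field_Units)
  then show ?thesis using g False by (simp add: e_def flip: M.smult_assoc1)
qed

text \<open>Since \<open>\<Gamma>(g)\<close>, \<open>\<Gamma>(g\<^sup>-\<^sup>1)\<close> and \<open>e(g)\<close> all vanish when \<open>\<sigma>(g, g\<^sup>-\<^sup>1) = 0\<close>, equations linear in one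
  of them may be checked after multiplication by \<open>\<sigma>(g, g\<^sup>-\<^sup>1)\<close>.\<close>

lemma eq_by_smult:
  assumes g: "g \<in> carrier G" and xy: "x \<in> carrier M" "y \<in> carrier M"
    and zero: "\<lbrakk>e g = \<zero>; \<Gamma> g = \<zero>; \<Gamma> (inv\<^bsub>G\<^esub> g) = \<zero>\<rbrakk> \<Longrightarrow> x = y"
    and eq: "\<sigma> g (inv\<^bsub>G\<^esub> g) \<odot> x = \<sigma> g (inv\<^bsub>G\<^esub> g) \<odot> y"
  shows "x = y"
proof (cases "\<sigma> g (inv\<^bsub>G\<^esub> g) = \<zero>\<^bsub>K\<^esub>")
  case True
  then show ?thesis using zero \<Gamma>_zero[OF g] by (simp add: e_def)
next
  case False
  then show ?thesis using smult_cancel[OF _ False xy eq] g by simp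
qed

lemma e_\<Gamma>:
  assumes g: "g \<in> carrier G"
  shows "e g \<otimes> \<Gamma> g = \<Gamma> g"
proof (rule eq_by_smult[OF g])
  have "\<sigma> g (inv\<^bsub>G\<^esub> g) \<odot> (e g \<otimes> \<Gamma> g) = \<sigma> g (inv\<^bsub>G\<^esub> g) \<odot> e g \<otimes> \<Gamma> g"
    using g by (simp add: M.smult_mult_left)
  also have "\<dots> = \<sigma> g (inv\<^bsub>G\<^esub> g) \<odot> \<Gamma> g"
    using g by (simp only: smult_e \<Gamma>_inv_\<Gamma>)
  finally show "\<sigma> g (inv\<^bsub>G\<^esub> g) \<odot> (e g \<otimes> \<Gamma> g) = \<sigma> g (inv\<^bsub>G\<^esub> g) \<odot> \<Gamma> g" .
qed (use g in simp_all)

text \<open>Up to a scalar, \<open>e g\<close> starts with the factor \<open>\<Gamma> g\<close>.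
  This converts vanishing products that end in some \<open>\<Gamma> g\<close> into vanishing
  products of idempotents.\<close>

lemma mult_e_zero:
  assumes g: "g \<in> carrier G" and y: "y \<in> carrier M" and 0: "y \<otimes> \<Gamma> g = \<zero>"
  shows "y \<otimes> e g = \<zero>"
proof (rule eq_by_smult[OF g])
  have "\<sigma> g (inv\<^bsub>G\<^esub> g) \<odot> (y \<otimes> e g) = y \<otimes> \<Gamma> g \<otimes> \<Gamma> (inv\<^bsub>G\<^esub> g)"
    using g y by (simp add: smult_e MR.m_assoc flip: M.smult_mult_right)
  then show "\<sigma> g (inv\<^bsub>G\<^esub> g) \<odot> (y \<otimes> e g) = \<sigma> g (inv\<^bsub>G\<^esub> g) \<odot> \<zero>"
    using g by (simp add: 0)
qed (use g y in simp_all)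

text \<open>The relation \<open>rel_left\<close> controls \<open>\<Gamma>(g) \<Gamma>(h)\<close>
  only behind the factor \<open>\<Gamma>(inv g)\<close>. Multiplying by \<open>\<Gamma>(g)\<close>
  once more and collapsing \<open>\<Gamma>(g) \<Gamma>(inv g) \<Gamma>(g)\<close> to a multiple of
  \<open>\<Gamma>(g)\<close> frees the product.\<close>

lemma \<Gamma>_mult:
  assumes g: "g \<in> carrier G" and h: "h \<in> carrier G"
  shows "\<Gamma> g \<otimes> \<Gamma> h = \<sigma> g h \<odot> (e g \<otimes> \<Gamma> (g \<otimes>\<^bsub>G\<^esub> h))"
proof (rule eq_by_smult[OF g])
  let ?c = "\<sigma> g (inv\<^bsub>G\<^esub> g)"
  have "?c \<odot> (\<Gamma> g \<otimes> \<Gamma> h) = \<Gamma> g \<otimes> \<Gamma> (inv\<^bsub>G\<^esub> g) \<otimes> \<Gamma> g \<otimes> \<Gamma> h"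
    using g h by (simp add: \<Gamma>_inv_\<Gamma> M.smult_mult_left)
  also have "\<dots> = \<Gamma> g \<otimes> (\<Gamma> (inv\<^bsub>G\<^esub> g) \<otimes> \<Gamma> g \<otimes> \<Gamma> h)"
    using g h by (simp add: MR.m_assoc)
  also have "\<dots> = \<sigma> g h \<odot> (\<Gamma> g \<otimes> \<Gamma> (inv\<^bsub>G\<^esub> g) \<otimes> \<Gamma> (g \<otimes>\<^bsub>G\<^esub> h))"
    unfolding rel_left[OF g h] using g h by (simp add: MR.m_assoc M.smult_mult_right)
  also have "\<dots> = \<sigma> g h \<odot> (?c \<odot> e g \<otimes> \<Gamma> (g \<otimes>\<^bsub>G\<^esub> h))"
    using g h by (simp add: smult_e)
  also have "\<dots> = ?c \<odot> (\<sigma> g h \<odot> (e g \<otimes> \<Gamma> (g \<otimes>\<^bsub>G\<^esub> h)))"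
    using g h by (simp add: M.smult_mult_left K.m_comm flip: M.smult_assoc1)
  finally show "?c \<odot> (\<Gamma> g \<otimes> \<Gamma> h) = ?c \<odot> (\<sigma> g h \<odot> (e g \<otimes> \<Gamma> (g \<otimes>\<^bsub>G\<^esub> h)))" .
qed (use g h in simp_all)

text \<open>The relations are applied to the pair \<open>(gh, inv h)\<close>, whose product is
  \<open>g\<close>. With its scalar \<open>?d\<close>, both sides multiplied by \<open>?d\<close>
  become \<open>?x\<close>: the left one through \<open>rel_right\<close>, the right one through
  \<open>rel_left\<close>. The scalars \<open>?c\<close> and \<open>?c'\<close> only clear the
  denominators of the two idempotents.\<close>

lemma \<Gamma>_e:
  assumes g: "g \<in> carrier G" and h: "h \<in> carrier G"
  shows "\<Gamma> g \<otimes> e h = e (g \<otimes>\<^bsub>G\<^esub> h) \<otimes> \<Gamma> g"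
proof -
  let ?x = "\<Gamma> (g \<otimes>\<^bsub>G\<^esub> h) \<otimes> \<Gamma> (inv\<^bsub>G\<^esub> h)"
  let ?d = "\<sigma> (g \<otimes>\<^bsub>G\<^esub> h) (inv\<^bsub>G\<^esub> h)" and ?c = "\<sigma> h (inv\<^bsub>G\<^esub> h)"
    and ?c' = "\<sigma> (g \<otimes>\<^bsub>G\<^esub> h) (inv\<^bsub>G\<^esub> (g \<otimes>\<^bsub>G\<^esub> h))"
  have ghh: "g \<otimes>\<^bsub>G\<^esub> h \<otimes>\<^bsub>G\<^esub> inv\<^bsub>G\<^esub> h = g"
    using g h by (simp add: G.m_assoc)
  have left: "?d \<odot> (\<Gamma> g \<otimes> e h) = ?x"
  proof (rule eq_by_smult[OF h])
    have "?c \<odot> (?d \<odot> (\<Gamma> g \<otimes> e h)) = ?d \<odot> (\<Gamma> g \<otimes> (?c \<odot> e h))"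
      using g h by (simp add: M.smult_mult_right K.m_comm flip: M.smult_assoc1)
    also have "\<dots> = ?d \<odot> (\<Gamma> g \<otimes> \<Gamma> h) \<otimes> \<Gamma> (inv\<^bsub>G\<^esub> h)"
      using g h by (simp add: smult_e MR.m_assoc M.smult_mult_left)
    also have "\<dots> = ?x \<otimes> \<Gamma> h \<otimes> \<Gamma> (inv\<^bsub>G\<^esub> h)"
      using g h rel_right[of "g \<otimes>\<^bsub>G\<^esub> h" "inv\<^bsub>G\<^esub> h"] by (simp add: ghh)
    also have "\<dots> = \<Gamma> (g \<otimes>\<^bsub>G\<^esub> h) \<otimes> (\<Gamma> (inv\<^bsub>G\<^esub> h) \<otimes> \<Gamma> h \<otimes> \<Gamma> (inv\<^bsub>G\<^esub> h))"
      using g h by (simp add: MR.m_assoc)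
    also have "\<dots> = ?c \<odot> ?x"
      using g h by (simp add: \<Gamma>_inv_\<Gamma> M.smult_mult_right)
    finally show "?c \<odot> (?d \<odot> (\<Gamma> g \<otimes> e h)) = ?c \<odot> ?x" .
  qed (use g h in simp_all)
  have right: "?d \<odot> (e (g \<otimes>\<^bsub>G\<^esub> h) \<otimes> \<Gamma> g) = ?x"
  proof (rule eq_by_smult[of "g \<otimes>\<^bsub>G\<^esub> h"])
    have "?c' \<odot> (?d \<odot> (e (g \<otimes>\<^bsub>G\<^esub> h) \<otimes> \<Gamma> g)) = ?d \<odot> (?c' \<odot> e (g \<otimes>\<^bsub>G\<^esub> h) \<otimes> \<Gamma> g)"
      using g h by (simp add: M.smult_mult_left K.m_comm flip: M.smult_assoc1)
    also have "\<dots> = \<Gamma> (g \<otimes>\<^bsub>G\<^esub> h) \<otimes> (?d \<odot> (\<Gamma> (inv\<^bsub>G\<^esub> (g \<otimes>\<^bsub>G\<^esub> h)) \<otimes> \<Gamma> g))"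
      using g h by (simp add: smult_e MR.m_assoc M.smult_mult_right)
    also have "\<dots> = \<Gamma> (g \<otimes>\<^bsub>G\<^esub> h) \<otimes> (\<Gamma> (inv\<^bsub>G\<^esub> (g \<otimes>\<^bsub>G\<^esub> h)) \<otimes> \<Gamma> (g \<otimes>\<^bsub>G\<^esub> h) \<otimes> \<Gamma> (inv\<^bsub>G\<^esub> h))"
      using g h rel_left[of "g \<otimes>\<^bsub>G\<^esub> h" "inv\<^bsub>G\<^esub> h"] by (simp add: ghh)
    also have "\<dots> = \<Gamma> (g \<otimes>\<^bsub>G\<^esub> h) \<otimes> \<Gamma> (inv\<^bsub>G\<^esub> (g \<otimes>\<^bsub>G\<^esub> h)) \<otimes> \<Gamma> (g \<otimes>\<^bsub>G\<^esub> h) \<otimes> \<Gamma> (inv\<^bsub>G\<^esub> h)"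
      using g h by (simp add: MR.m_assoc)
    also have "\<dots> = ?c' \<odot> ?x"
      using g h by (simp add: \<Gamma>_inv_\<Gamma> M.smult_mult_left)
    finally show "?c' \<odot> (?d \<odot> (e (g \<otimes>\<^bsub>G\<^esub> h) \<otimes> \<Gamma> g)) = ?c' \<odot> ?x" .
  qed (use g h in simp_all)
  show ?thesis
  proof (cases "?d = \<zero>\<^bsub>K\<^esub>")
    case False
    with g h show ?thesis
      by (intro smult_cancel[OF _ False _ _ trans[OF left right[symmetric]]]) simp_all
  next
    \<comment> \<open>When \<open>?d\<close> vanishes it cannot be cancelled, but the vanishing
      relations for the same pair give \<open>\<Gamma>(g) \<Gamma>(h) = 0\<close> and
      \<open>\<Gamma>(inv (gh)) \<Gamma>(g) = 0\<close>, which kill the two sides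
      separately.\<close>
    case True
    have "\<Gamma> g \<otimes> \<Gamma> h = \<zero>"
      using rel_zero_right[OF _ _ True] g h by (simp add: ghh)
    then have "\<Gamma> g \<otimes> e h = \<zero>"
      using g h by (intro mult_e_zero) simp_all
    moreover have "e (g \<otimes>\<^bsub>G\<^esub> h) \<otimes> \<Gamma> g = \<zero>"
    proof (rule eq_by_smult[of "g \<otimes>\<^bsub>G\<^esub> h"])
      have "\<Gamma> (inv\<^bsub>G\<^esub> (g \<otimes>\<^bsub>G\<^esub> h)) \<otimes> \<Gamma> g = \<zero>"
        using rel_zero_left[OF _ _ True] g h by (simp add: ghh)
      then show "?c' \<odot> (e (g \<otimes>\<^bsub>G\<^esub> h) \<otimes> \<Gamma> g) = ?c' \<odot> \<zero>"
        using g h by (simp add: smult_e MR.m_assoc flip: M.smult_mult_left)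
    qed (use g h in simp_all)
    ultimately show ?thesis by simp
  qed
qed

lemma e_idem:
  assumes g: "g \<in> carrier G"
  shows "e g \<otimes> e g = e g"
proof (rule eq_by_smult[OF g])
  have "\<sigma> g (inv\<^bsub>G\<^esub> g) \<odot> (e g \<otimes> e g) = e g \<otimes> \<Gamma> g \<otimes> \<Gamma> (inv\<^bsub>G\<^esub> g)"
    using g by (simp add: smult_e MR.m_assoc flip: M.smult_mult_right)
  also have "\<dots> = \<sigma> g (inv\<^bsub>G\<^esub> g) \<odot> e g"
    using g by (simp add: e_\<Gamma> smult_e)
  finally show "\<sigma> g (inv\<^bsub>G\<^esub> g) \<odot> (e g \<otimes> e g) = \<sigma> g (inv\<^bsub>G\<^esub> g) \<odot> e g" .
qed (use g in simp_all)

text \<open>Up to a scalar \<open>e g\<close> is \<open>\<Gamma>(g) \<Gamma>(inv g)\<close>; moving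
  \<open>e h\<close> through both factors changes its index to \<open>inv g * h\<close> and then
  back to \<open>h\<close>.\<close>

lemma e_comm:
  assumes g: "g \<in> carrier G" and h: "h \<in> carrier G"
  shows "e g \<otimes> e h = e h \<otimes> e g"
proof (rule eq_by_smult[OF g])
  let ?c = "\<sigma> g (inv\<^bsub>G\<^esub> g)"
  have "?c \<odot> (e g \<otimes> e h) = \<Gamma> g \<otimes> (\<Gamma> (inv\<^bsub>G\<^esub> g) \<otimes> e h)"
    using g h by (simp add: smult_e MR.m_assoc flip: M.smult_mult_left)
  also have "\<dots> = \<Gamma> g \<otimes> e (inv\<^bsub>G\<^esub> g \<otimes>\<^bsub>G\<^esub> h) \<otimes> \<Gamma> (inv\<^bsub>G\<^esub> g)"
    using g h by (simp add: \<Gamma>_e[of "inv\<^bsub>G\<^esub> g"] MR.m_assoc)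
  also have "\<dots> = e h \<otimes> \<Gamma> g \<otimes> \<Gamma> (inv\<^bsub>G\<^esub> g)"
    using g h by (simp add: \<Gamma>_e[of g] flip: G.m_assoc)
  also have "\<dots> = ?c \<odot> (e h \<otimes> e g)"
    using g h by (simp add: smult_e MR.m_assoc flip: M.smult_mult_right)
  finally show "?c \<odot> (e g \<otimes> e h) = ?c \<odot> (e h \<otimes> e g)" .
qed (use g h in simp_all)

lemma e_one: "e \<one>\<^bsub>G\<^esub> = \<one>"
  using e_\<Gamma>[of "\<one>\<^bsub>G\<^esub>"] by (simp add: \<Gamma>_one)

text \<open>The multiplier is the identity off the carriers, so that it commutes and is idempotent on the
  whole type, as \<^const>\<open>Finite_Set.fold\<close> requires.\<close>

definition E :: "'g set \<Rightarrow> 'a" where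
  "E U = Finite_Set.fold
    (\<lambda>u y. if u \<in> carrier G \<and> y \<in> carrier M then e u \<otimes> y else y) \<one> U"

lemma comp_fun_idem_e:
  "comp_fun_idem (\<lambda>u y. if u \<in> carrier G \<and> y \<in> carrier M then e u \<otimes> y else y)"
proof (unfold_locales; rule ext)
  fix u v y
  have "e u \<otimes> (e v \<otimes> y) = e v \<otimes> (e u \<otimes> y)"
    if "u \<in> carrier G" "v \<in> carrier G" "y \<in> carrier M"
    using that e_comm[OF that(1,2)] by (simp flip: MR.m_assoc)
  then show "((\<lambda>y. if u \<in> carrier G \<and> y \<in> carrier M then e u \<otimes> y else y) \<circ>
      (\<lambda>y. if v \<in> carrier G \<and> y \<in> carrier M then e v \<otimes> y else y)) y =
      ((\<lambda>y. if v \<in> carrier G \<and> y \<in> carrier M then e v \<otimes> y else y) \<circ>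
      (\<lambda>y. if u \<in> carrier G \<and> y \<in> carrier M then e u \<otimes> y else y)) y"
    by auto
next
  fix u y
  have "e u \<otimes> (e u \<otimes> y) = e u \<otimes> y" if "u \<in> carrier G" "y \<in> carrier M"
    using that e_idem[OF that(1)] by (simp flip: MR.m_assoc)
  then show "((\<lambda>y. if u \<in> carrier G \<and> y \<in> carrier M then e u \<otimes> y else y) \<circ>
      (\<lambda>y. if u \<in> carrier G \<and> y \<in> carrier M then e u \<otimes> y else y)) y =
      (if u \<in> carrier G \<and> y \<in> carrier M then e u \<otimes> y else y)"
    by simp
qed

lemma E_empty: "E {} = \<one>"
  by (simp add: E_def)

text \<open>Idempotence makes the recursion valid also when \<open>u\<close> already lies in
  \<open>U\<close>. Hence unions become products without any disjointness condition.\<close>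

lemma E_closed_insert:
  assumes "finite U" "U \<subseteq> carrier G"
  shows "E U \<in> carrier M \<and> (\<forall>u\<in>carrier G. E (insert u U) = e u \<otimes> E U)"
proof -
  interpret comp_fun_idem "\<lambda>u y. if u \<in> carrier G \<and> y \<in> carrier M then e u \<otimes> y else y"
    by (rule comp_fun_idem_e)
  have "E U \<in> carrier M" using assms
  proof (induction U)
    case (insert u U)
    then show ?case
      unfolding E_def by (subst fold_insert_idem) auto
  qed (simp add: E_def)
  with assms show ?thesis
    unfolding E_def by (subst fold_insert_idem) auto
qed

lemma E_closed [simp]: "\<lbrakk>finite U; U \<subseteq> carrier G\<rbrakk> \<Longrightarrow> E U \<in> carrier M"
  and E_insert: "\<lbrakk>finite U; U \<subseteq> carrier G; u \<in> carrier G\<rbrakk> \<Longrightarrow> E (insert u U) = e u \<otimes> E U"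
  using E_closed_insert by blast+

lemma E_Un:
  assumes "finite U" "U \<subseteq> carrier G" "finite V" "V \<subseteq> carrier G"
  shows "E (U \<union> V) = E U \<otimes> E V"
  using assms(1,2) by induction (use assms(3,4) in \<open>simp_all add: E_empty E_insert MR.m_assoc\<close>)

lemma E_mono_zero:
  assumes "E V = \<zero>" "V \<subseteq> U" "finite U" "U \<subseteq> carrier G"
  shows "E U = \<zero>"
proof -
  have "finite V" "V \<subseteq> carrier G" "V \<union> U = U"
    using assms finite_subset by auto
  then show ?thesis
    using E_Un[of V U] assms by simp
qed

lemma \<Gamma>_E:
  assumes g: "g \<in> carrier G" and V: "finite V" "V \<subseteq> carrier G"
  shows "\<Gamma> g \<otimes> E V = E (g <#\<^bsub>G\<^esub> V) \<otimes> \<Gamma> g"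
  using V
proof induction
  case empty
  then show ?case using g by (simp add: E_empty l_coset_def)
next
  case (insert v V)
  then have v: "v \<in> carrier G" and V: "finite V" "V \<subseteq> carrier G"
    and IH: "\<Gamma> g \<otimes> E V = E (g <#\<^bsub>G\<^esub> V) \<otimes> \<Gamma> g"
    by auto
  have gV: "finite (g <#\<^bsub>G\<^esub> V)" "g <#\<^bsub>G\<^esub> V \<subseteq> carrier G"
    using V g by (simp_all add: l_coset_finite G.l_coset_subset_G)
  have "\<Gamma> g \<otimes> E (insert v V) = \<Gamma> g \<otimes> e v \<otimes> E V"
    using g v V by (simp add: E_insert MR.m_assoc)
  also have "\<dots> = e (g \<otimes>\<^bsub>G\<^esub> v) \<otimes> (\<Gamma> g \<otimes> E V)"
    using g v V by (simp add: \<Gamma>_e MR.m_assoc)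
  also have "\<dots> = E (g <#\<^bsub>G\<^esub> insert v V) \<otimes> \<Gamma> g"
    using g v V gV by (simp add: IH l_coset_insert E_insert MR.m_assoc)
  finally show ?case .
qed

text \<open>Moving \<open>\<Gamma>(h)\<close> past \<open>E V = 0\<close> leaves
  \<open>E(hV) \<Gamma>(h) = 0\<close>, and the trailing \<open>\<Gamma>(h)\<close> can only be
  traded for \<open>e(h)\<close>. This extra factor accounts for the base point \<open>h\<close> in
  every prohibition.\<close>

lemma E_translate_zero:
  assumes h: "h \<in> carrier G" and V: "finite V" "V \<subseteq> carrier G" and 0: "E V = \<zero>"
  shows "E (insert h (h <#\<^bsub>G\<^esub> V)) = \<zero>"
proof -
  have hV: "finite (h <#\<^bsub>G\<^esub> V)" "h <#\<^bsub>G\<^esub> V \<subseteq> carrier G"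
    using V h by (simp_all add: l_coset_finite G.l_coset_subset_G)
  have "E (h <#\<^bsub>G\<^esub> V) \<otimes> \<Gamma> h = \<zero>"
    using \<Gamma>_E[OF h V] h by (simp add: 0)
  then have "E (h <#\<^bsub>G\<^esub> V) \<otimes> e h = \<zero>"
    using h hV by (intro mult_e_zero) simp_all
  then show ?thesis
    using E_Un[OF hV, of "{h}"] h by (simp add: E_insert E_empty)
qed

text \<open>The product \<open>e(gs) e(g)\<close> is treated first; translation by \<open>h\<close>
  then moves the two points to \<open>hgs\<close> and \<open>hg\<close> and adds
  \<open>h\<close>.\<close>

lemma E_prohibitions_I:
  assumes "W \<in> prohibitions_I K G \<sigma>"
  shows "E W = \<zero>"
proof -
  from assms obtain h g s where hgs: "h \<in> carrier G" "g \<in> carrier G" "s \<in> carrier G"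
    and 0: "\<sigma> g s = \<zero>\<^bsub>K\<^esub>" and W: "W = {h, h \<otimes>\<^bsub>G\<^esub> g, h \<otimes>\<^bsub>G\<^esub> g \<otimes>\<^bsub>G\<^esub> s}"
    by (auto simp: prohibitions_I_def)
  have "\<Gamma> g \<otimes> \<Gamma> s = \<zero>"
    using hgs by (simp add: \<Gamma>_mult 0)
  then have "\<Gamma> g \<otimes> e s = \<zero>"
    using hgs by (intro mult_e_zero) simp_all
  then have "e (g \<otimes>\<^bsub>G\<^esub> s) \<otimes> \<Gamma> g = \<zero>"
    using hgs by (simp add: \<Gamma>_e)
  then have "e (g \<otimes>\<^bsub>G\<^esub> s) \<otimes> e g = \<zero>"
    using hgs by (intro mult_e_zero) simp_all
  then have "E {g \<otimes>\<^bsub>G\<^esub> s, g} = \<zero>"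
    using hgs by (simp add: E_insert E_empty)
  from E_translate_zero[OF hgs(1) _ _ this] hgs show ?thesis
    by (simp add: W l_coset_insert insert_commute G.m_assoc) (simp add: l_coset_def)
qed

lemma E_prohibitions_II:
  assumes "W \<in> prohibitions_II K G \<sigma>"
  shows "E W = \<zero>"
proof -
  from assms obtain h g s t
    where hgst: "h \<in> carrier G" "g \<in> carrier G" "s \<in> carrier G" "t \<in> carrier G"
    and ne: "\<sigma> g (s \<otimes>\<^bsub>G\<^esub> t) \<otimes>\<^bsub>K\<^esub> \<sigma> s t \<noteq> \<sigma> g s \<otimes>\<^bsub>K\<^esub> \<sigma> (g \<otimes>\<^bsub>G\<^esub> s) t"
    and W: "W = {h, h \<otimes>\<^bsub>G\<^esub> g, h \<otimes>\<^bsub>G\<^esub> g \<otimes>\<^bsub>G\<^esub> s, h \<otimes>\<^bsub>G\<^esub> g \<otimes>\<^bsub>G\<^esub> s \<otimes>\<^bsub>G\<^esub> t}"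
    by (auto simp: prohibitions_II_def)
  let ?a = "\<sigma> g (s \<otimes>\<^bsub>G\<^esub> t) \<otimes>\<^bsub>K\<^esub> \<sigma> s t" and ?b = "\<sigma> g s \<otimes>\<^bsub>K\<^esub> \<sigma> (g \<otimes>\<^bsub>G\<^esub> s) t"
  \<comment> \<open>Each bracketing of \<open>\<Gamma>(g) \<Gamma>(s) \<Gamma>(t)\<close> is a
    multiple of this one element, with the two sides of the cocycle identity as coefficients.
    Commutativity of the idempotents makes the two elements literally equal.\<close>
  let ?z = "e (g \<otimes>\<^bsub>G\<^esub> s) \<otimes> e g \<otimes> \<Gamma> (g \<otimes>\<^bsub>G\<^esub> s \<otimes>\<^bsub>G\<^esub> t)"
  have "?a \<odot> ?z = \<sigma> s t \<odot> (e (g \<otimes>\<^bsub>G\<^esub> s) \<otimes> (\<Gamma> g \<otimes> \<Gamma> (s \<otimes>\<^bsub>G\<^esub> t)))"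
    using hgst by (simp add: \<Gamma>_mult[of g] M.smult_mult_right G.m_assoc MR.m_assoc K.m_comm flip: M.smult_assoc1)
  also have "\<dots> = \<sigma> s t \<odot> (\<Gamma> g \<otimes> e s \<otimes> \<Gamma> (s \<otimes>\<^bsub>G\<^esub> t))"
    using hgst by (simp add: \<Gamma>_e MR.m_assoc)
  also have "\<dots> = \<Gamma> g \<otimes> (\<Gamma> s \<otimes> \<Gamma> t)"
    using hgst by (simp add: \<Gamma>_mult[of s] M.smult_mult_right MR.m_assoc)
  also have "\<dots> = (\<Gamma> g \<otimes> \<Gamma> s) \<otimes> \<Gamma> t"
    using hgst by (simp add: MR.m_assoc)
  also have "\<dots> = \<sigma> g s \<odot> (e g \<otimes> (\<Gamma> (g \<otimes>\<^bsub>G\<^esub> s) \<otimes> \<Gamma> t))"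
    using hgst by (simp add: \<Gamma>_mult[of g] M.smult_mult_left MR.m_assoc)
  also have "\<dots> = ?b \<odot> (e g \<otimes> e (g \<otimes>\<^bsub>G\<^esub> s) \<otimes> \<Gamma> (g \<otimes>\<^bsub>G\<^esub> s \<otimes>\<^bsub>G\<^esub> t))"
    using hgst by (simp add: \<Gamma>_mult[of "g \<otimes>\<^bsub>G\<^esub> s"] smult_rules MR.m_assoc)
  also have "\<dots> = ?b \<odot> ?z"
    using hgst by (simp add: e_comm[of g])
  finally have "?z = \<zero>"
    using hgst ne by (intro smult_eq_imp_zero[of ?a ?b]) simp_all
  \<comment> \<open>Trading the trailing \<open>\<Gamma>(gst)\<close> for \<open>e(gst)\<close>
    produces the last point of the prohibition.\<close>
  then have "e (g \<otimes>\<^bsub>G\<^esub> s) \<otimes> e g \<otimes> e (g \<otimes>\<^bsub>G\<^esub> s \<otimes>\<^bsub>G\<^esub> t) = \<zero>"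
    using hgst by (intro mult_e_zero) simp_all
  then have "E {g \<otimes>\<^bsub>G\<^esub> s, g, g \<otimes>\<^bsub>G\<^esub> s \<otimes>\<^bsub>G\<^esub> t} = \<zero>"
    using hgst by (simp add: E_insert E_empty MR.m_assoc)
  from E_translate_zero[OF hgst(1) _ _ this] hgst show ?thesis
    by (simp add: W l_coset_insert insert_commute G.m_assoc) (simp add: l_coset_def insert_commute)
qed

lemma E_eq_zero:
  assumes "finite U" "U \<in> Omega G" "U \<notin> Omega_tw K G \<sigma>"
  shows "E U = \<zero>"
proof -
  from assms obtain W where W: "W \<in> prohibitions K G \<sigma>" "W \<subseteq> U"
    by (auto simp: Omega_tw_def)
  from W(1) have "E W = \<zero>"
    using E_prohibitions_I E_prohibitions_II by (auto simp: prohibitions_def)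
  moreover have "U \<subseteq> carrier G"
    using assms(2) by (simp add: Omega_def)
  ultimately show ?thesis
    using E_mono_zero W(2) assms(1) by blast
qed

end


section \<open>The twisted partial group algebra\<close>

lemma quot_algebra_simps:
  "carrier (quot_algebra A I) = carrier (A Quot I)"
  "x \<otimes>\<^bsub>quot_algebra A I\<^esub> y = x \<otimes>\<^bsub>A Quot I\<^esub> y"
  "\<one>\<^bsub>quot_algebra A I\<^esub> = \<one>\<^bsub>A Quot I\<^esub>"
  "\<zero>\<^bsub>quot_algebra A I\<^esub> = \<zero>\<^bsub>A Quot I\<^esub>"
  "x \<oplus>\<^bsub>quot_algebra A I\<^esub> y = x \<oplus>\<^bsub>A Quot I\<^esub> y"
  "c \<odot>\<^bsub>quot_algebra A I\<^esub> x = (\<Union>y\<in>x. I +>\<^bsub>A\<^esub> (c \<odot>\<^bsub>A\<^esub> y))"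
  by (simp_all add: quot_algebra_def FactRing_def ring.defs module.defs)

text \<open>Scaling in the quotient is defined as a union over all representatives. It collapses to
  one coset because a ring ideal of a unital algebra is closed under scalars:
  \<open>c i = (c 1) i\<close>.\<close>

lemma quot_algebra_smult_coset:
  assumes A: "assoc_algebra K A" and I: "ideal I A"
    and c: "c \<in> carrier K" and x: "x \<in> carrier A"
  shows "c \<odot>\<^bsub>quot_algebra A I\<^esub> (I +>\<^bsub>A\<^esub> x) = I +>\<^bsub>A\<^esub> (c \<odot>\<^bsub>A\<^esub> x)"
proof -
  interpret I: ideal I A by fact
  interpret A: assoc_algebra K A by fact
  have *: "I +>\<^bsub>A\<^esub> (c \<odot>\<^bsub>A\<^esub> y) = I +>\<^bsub>A\<^esub> (c \<odot>\<^bsub>A\<^esub> x)" if y: "y \<in> I +>\<^bsub>A\<^esub> x" for y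
  proof -
    from y obtain i where i: "i \<in> I" "y = i \<oplus>\<^bsub>A\<^esub> x"
      by (auto simp: a_r_coset_def')
    have iA: "i \<in> carrier A" using i(1) by (rule I.a_Hcarr)
    have "c \<odot>\<^bsub>A\<^esub> i = (c \<odot>\<^bsub>A\<^esub> \<one>\<^bsub>A\<^esub>) \<otimes>\<^bsub>A\<^esub> i"
      using c iA by (simp add: A.smult_mult_left)
    also have "\<dots> \<in> I"
      using c i(1) by (intro I.I_l_closed) auto
    finally have ci: "c \<odot>\<^bsub>A\<^esub> i \<in> I" .
    have "c \<odot>\<^bsub>A\<^esub> y \<in> I +>\<^bsub>A\<^esub> (c \<odot>\<^bsub>A\<^esub> x)"
      using ci c x iA i(2) by (auto simp: a_r_coset_def' A.smult_r_distr)
    then show ?thesis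
      using c x by (intro I.a_repr_independence'[symmetric]) auto
  qed
  have "c \<odot>\<^bsub>quot_algebra A I\<^esub> (I +>\<^bsub>A\<^esub> x) = (\<Union>y\<in>I +>\<^bsub>A\<^esub> x. I +>\<^bsub>A\<^esub> (c \<odot>\<^bsub>A\<^esub> x))"
    unfolding quot_algebra_simps by (intro SUP_cong refl *)
  also have "\<dots> = I +>\<^bsub>A\<^esub> (c \<odot>\<^bsub>A\<^esub> x)"
    using I.a_rcos_self[OF x] by blast
  finally show ?thesis .
qed

lemma quot_algebra_ops:
  assumes I: "ideal I A"
  shows quot_algebra_closed: "x \<in> carrier A \<Longrightarrow> I +>\<^bsub>A\<^esub> x \<in> carrier (quot_algebra A I)"
    and quot_algebra_add: "\<lbrakk>x \<in> carrier A; y \<in> carrier A\<rbrakk> \<Longrightarrow>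
      (I +>\<^bsub>A\<^esub> x) \<oplus>\<^bsub>quot_algebra A I\<^esub> (I +>\<^bsub>A\<^esub> y) = I +>\<^bsub>A\<^esub> (x \<oplus>\<^bsub>A\<^esub> y)"
    and quot_algebra_mult: "\<lbrakk>x \<in> carrier A; y \<in> carrier A\<rbrakk> \<Longrightarrow>
      (I +>\<^bsub>A\<^esub> x) \<otimes>\<^bsub>quot_algebra A I\<^esub> (I +>\<^bsub>A\<^esub> y) = I +>\<^bsub>A\<^esub> (x \<otimes>\<^bsub>A\<^esub> y)"
    and quot_algebra_one: "\<one>\<^bsub>quot_algebra A I\<^esub> = I +>\<^bsub>A\<^esub> \<one>\<^bsub>A\<^esub>"
    and quot_algebra_zero: "\<zero>\<^bsub>quot_algebra A I\<^esub> = I"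
  using ideal.rcos_ring_hom[OF I]
  unfolding quot_algebra_simps ring_hom_def by (auto simp: FactRing_def)

lemma quot_algebra_cases:
  assumes "X \<in> carrier (quot_algebra A I)"
  obtains x where "x \<in> carrier A" "X = I +>\<^bsub>A\<^esub> x"
  using assms by (auto simp: quot_algebra_simps FactRing_def A_RCOSETS_def')

lemma assoc_algebra_quot_algebra:
  assumes A: "assoc_algebra K A" and I: "ideal I A"
  shows "assoc_algebra K (quot_algebra A I)"
proof -
  interpret F: ring "A Quot I" by (rule ideal.quotient_is_ring[OF I])
  interpret AR: ring A by (rule assoc_algebra.axioms(2)[OF A])
  interpret A: assoc_algebra K A by fact
  let ?Q = "quot_algebra A I"
  note smult = quot_algebra_smult_coset[OF A I] and ops = quot_algebra_ops[OF I]
  have ring: "ring ?Q"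
  proof (intro ringI abelian_groupI monoidI)
    fix x assume "x \<in> carrier ?Q"
    then show "\<exists>y\<in>carrier ?Q. y \<oplus>\<^bsub>?Q\<^esub> x = \<zero>\<^bsub>?Q\<^esub>"
      using F.l_neg F.a_inv_closed by (auto simp: quot_algebra_simps)
  qed (simp_all add: quot_algebra_simps F.a_assoc F.m_assoc F.l_distr F.r_distr,
    simp_all add: F.a_comm)
  have module: "module K ?Q"
  proof (rule moduleI)
    show "cring K"
      by (rule module.axioms(1)[OF assoc_algebra.axioms(1)[OF A]])
    show "abelian_group ?Q"
      by (rule ring.axioms(1)[OF ring])
  qed (auto elim!: quot_algebra_cases simp: smult ops(1-4) A.smult_l_distr A.smult_r_distr A.smult_assoc1)
  show ?thesis
    by (intro assoc_algebra.intro module ring assoc_algebra_axioms.intro)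
      (auto elim!: quot_algebra_cases simp: smult ops(1-4) A.smult_mult_left A.smult_mult_right)
qed

section \<open>Evaluation of words and the universal property of the free algebra\<close>

definition word_eval :: "('k, 'a, 'n) module_scheme \<Rightarrow> ('g \<Rightarrow> 'a) \<Rightarrow> 'g list \<Rightarrow> 'a"
  where "word_eval M \<Gamma> w = foldr (\<lambda>g y. \<Gamma> g \<otimes>\<^bsub>M\<^esub> y) w \<one>\<^bsub>M\<^esub>"

lemma word_eval_simps [simp]:
  "word_eval M \<Gamma> [] = \<one>\<^bsub>M\<^esub>"
  "word_eval M \<Gamma> (g # w) = \<Gamma> g \<otimes>\<^bsub>M\<^esub> word_eval M \<Gamma> w"
  by (simp_all add: word_eval_def)

lemma word_eval_closed:
  assumes "ring M" "\<Gamma> \<in> S \<rightarrow> carrier M" "v \<in> lists S"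
  shows "word_eval M \<Gamma> v \<in> carrier M"
proof -
  interpret ring M by fact
  show ?thesis using assms(3) by induction (use assms(2) in auto)
qed

lemma word_eval_append:
  assumes M: "ring M" and \<Gamma>: "\<Gamma> \<in> S \<rightarrow> carrier M" and v: "v \<in> lists S" and w: "w \<in> lists S"
  shows "word_eval M \<Gamma> (v @ w) = word_eval M \<Gamma> v \<otimes>\<^bsub>M\<^esub> word_eval M \<Gamma> w"
proof -
  interpret ring M by fact
  note cl = word_eval_closed[OF M \<Gamma>]
  show ?thesis using v
  proof induction
    case (Cons g v)
    then have "\<Gamma> g \<in> carrier M" using \<Gamma> by auto
    then show ?case using Cons cl[of v] cl[OF w] by (simp add: m_assoc)
  qed (use cl[OF w] in simp)
qed

context
  fixes K :: "('k, 'm) ring_scheme" and G :: "('g, 'n) monoid_scheme"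
  assumes K: "cring K"
begin

interpretation K: cring K by (rule K)

lemma structure_constants_free:
  "structure_constants K (lists (carrier G)) (\<lambda>v w. basis_vec K (v @ w)) []"
  by (unfold_locales; (intro K.basis_vec_closed)?) auto

interpretation F: structure_constants K "lists (carrier G)" "\<lambda>v w. basis_vec K (v @ w)" "[]"
  rewrites "basis_algebra K (lists (carrier G)) (\<lambda>v w. basis_vec K (v @ w)) [] = free_algebra K G"
  by (rule structure_constants_free) (simp add: free_algebra_def)

lemma assoc_algebra_free: "assoc_algebra K (free_algebra K G)"
proof (rule F.assoc_algebra_A)
  fix p q s assume "p \<in> lists (carrier G)" "q \<in> lists (carrier G)" "s \<in> lists (carrier G)"
  then have "p @ q \<in> lists (carrier G)" "q @ s \<in> lists (carrier G)"
    "p \<in> lists (carrier G)" "s \<in> lists (carrier G)"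
    by simp_all
  then show "basis_vec K (p @ q) \<otimes>\<^bsub>free_algebra K G\<^esub> basis_vec K s =
      basis_vec K p \<otimes>\<^bsub>free_algebra K G\<^esub> basis_vec K (q @ s)"
    by (simp only: F.mult_basis_vec append_assoc)
qed simp_all

lemmas linear_map_free_eqI = F.linear_map_eqI

lemma free_gen_closed: "g \<in> carrier G \<Longrightarrow> free_gen K g \<in> carrier (free_algebra K G)"
  unfolding free_gen_def free_algebra_def by (intro K.basis_vec_closed) simp

lemma free_one: "\<one>\<^bsub>free_algebra K G\<^esub> = basis_vec K []"
  by (rule F.one_A)

lemma free_Cons:
  "\<lbrakk>g \<in> carrier G; w \<in> lists (carrier G)\<rbrakk> \<Longrightarrow>
    basis_vec K (g # w) = free_gen K g \<otimes>\<^bsub>free_algebra K G\<^esub> basis_vec K w"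
  by (simp add: free_gen_def F.mult_basis_vec)

text \<open>Evaluation turns concatenation of words into products, so its linear extension is
  multiplicative on the basis and hence everywhere.\<close>

lemma free_lift:
  assumes M: "assoc_algebra K M" and \<Gamma>: "\<Gamma> \<in> carrier G \<rightarrow> carrier M"
  defines "f \<equiv> lin_ext K M (word_eval M \<Gamma>)"
  shows free_lift_linear: "linear_map K (free_algebra K G) M f"
    and free_lift_word: "w \<in> lists (carrier G) \<Longrightarrow> f (basis_vec K w) = word_eval M \<Gamma> w"
    and free_lift_gen: "g \<in> carrier G \<Longrightarrow> f (free_gen K g) = \<Gamma> g"
    and free_lift_hom: "ring_hom_ring (free_algebra K G) M f"
proof -
  interpret MR: ring M by (rule assoc_algebra.axioms(2)[OF M])
  interpret M: assoc_algebra K M by fact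
  note cl = word_eval_closed[OF MR.ring_axioms \<Gamma>]
  show lin: "linear_map K (free_algebra K G) M f"
    unfolding f_def using cl by (intro F.linear_map_lin_ext M.module_axioms)
  show word: "w \<in> lists (carrier G) \<Longrightarrow> f (basis_vec K w) = word_eval M \<Gamma> w" for w
    unfolding f_def using cl by (intro F.lin_ext_basis_vec M.module_axioms)
  show "g \<in> carrier G \<Longrightarrow> f (free_gen K g) = \<Gamma> g" for g
    using word[of "[g]"] \<Gamma> funcset_mem[OF \<Gamma>, of g] by (simp add: free_gen_def)
  show "ring_hom_ring (free_algebra K G) M f"
  proof (intro ring_hom_ringI MR.ring_axioms)
    show "ring (free_algebra K G)"
      by (rule assoc_algebra.axioms(2)[OF assoc_algebra_free])
    show "f (x \<otimes>\<^bsub>free_algebra K G\<^esub> y) = f x \<otimes>\<^bsub>M\<^esub> f y"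
      if "x \<in> carrier (free_algebra K G)" "y \<in> carrier (free_algebra K G)" for x y
      using that
      by (intro F.linear_map_multiplicativeI M lin)
        (simp_all add: word word_eval_append[OF MR.ring_axioms \<Gamma>])
    show "f \<one>\<^bsub>free_algebra K G\<^esub> = \<one>\<^bsub>M\<^esub>"
      using word[of "[]"] by (simp add: free_one)
  qed (simp_all add: linear_mapD[OF lin])
qed

end

section \<open>The ideal of relations and its quotient\<close>

context
  fixes K :: "('k, 'm) ring_scheme" and G :: "('g, 'n) monoid_scheme" and \<sigma> :: "'g \<Rightarrow> 'g \<Rightarrow> 'k"
  assumes K: "field K" and G: "group G" and \<sigma>: "\<sigma> \<in> carrier G \<rightarrow> carrier G \<rightarrow> carrier K"
begin

interpretation K: field K by (rule K)
interpretation G: group G by (rule G)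
interpretation FR: ring "free_algebra K G"
  by (rule assoc_algebra.axioms(2)[OF assoc_algebra_free[OF K.is_cring]])
interpretation F: assoc_algebra K "free_algebra K G"
  by (rule assoc_algebra_free[OF K.is_cring])

lemma twist_closed: "\<lbrakk>g \<in> carrier G; h \<in> carrier G\<rbrakk> \<Longrightarrow> \<sigma> g h \<in> carrier K"
  using \<sigma> by auto

lemma par_relatorsI:
  fixes g h
  defines "e \<equiv> free_gen K" and "F \<equiv> free_algebra K G"
  shows "\<lbrakk>g \<in> carrier G; h \<in> carrier G; \<sigma> g h = \<zero>\<^bsub>K\<^esub>\<rbrakk> \<Longrightarrow>
      e (inv\<^bsub>G\<^esub> g) \<otimes>\<^bsub>F\<^esub> e (g \<otimes>\<^bsub>G\<^esub> h) \<in> par_relators K G \<sigma>"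
    and "\<lbrakk>g \<in> carrier G; h \<in> carrier G; \<sigma> g h = \<zero>\<^bsub>K\<^esub>\<rbrakk> \<Longrightarrow>
      e (g \<otimes>\<^bsub>G\<^esub> h) \<otimes>\<^bsub>F\<^esub> e (inv\<^bsub>G\<^esub> h) \<in> par_relators K G \<sigma>"
    and "\<lbrakk>g \<in> carrier G; h \<in> carrier G\<rbrakk> \<Longrightarrow>
      e (inv\<^bsub>G\<^esub> g) \<otimes>\<^bsub>F\<^esub> e g \<otimes>\<^bsub>F\<^esub> e h \<ominus>\<^bsub>F\<^esub>
        \<sigma> g h \<odot>\<^bsub>F\<^esub> (e (inv\<^bsub>G\<^esub> g) \<otimes>\<^bsub>F\<^esub> e (g \<otimes>\<^bsub>G\<^esub> h)) \<in> par_relators K G \<sigma>"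
    and "\<lbrakk>g \<in> carrier G; h \<in> carrier G\<rbrakk> \<Longrightarrow>
      e g \<otimes>\<^bsub>F\<^esub> e h \<otimes>\<^bsub>F\<^esub> e (inv\<^bsub>G\<^esub> h) \<ominus>\<^bsub>F\<^esub>
        \<sigma> g h \<odot>\<^bsub>F\<^esub> (e (g \<otimes>\<^bsub>G\<^esub> h) \<otimes>\<^bsub>F\<^esub> e (inv\<^bsub>G\<^esub> h)) \<in> par_relators K G \<sigma>"
    and "e \<one>\<^bsub>G\<^esub> \<ominus>\<^bsub>F\<^esub> \<one>\<^bsub>F\<^esub> \<in> par_relators K G \<sigma>"
  unfolding par_relators_def Let_def e_def F_def by blast+

lemma par_relators_subset: "par_relators K G \<sigma> \<subseteq> carrier (free_algebra K G)"
  unfolding par_relators_def Let_def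
  by (auto simp: free_gen_closed[OF K.is_cring] twist_closed intro!: FR.m_closed FR.minus_closed F.smult_closed)

lemma ideal_par_ideal: "ideal (par_ideal K G \<sigma>) (free_algebra K G)"
  unfolding par_ideal_def by (rule FR.genideal_ideal[OF par_relators_subset])

lemma assoc_algebra_twisted: "assoc_algebra K (twisted_par_algebra K G \<sigma>)"
  unfolding twisted_par_algebra_def
  by (intro assoc_algebra_quot_algebra assoc_algebra_free K.is_cring ideal_par_ideal)

text \<open>By minimality of the generated ideal it is enough that the lift kills each relator. The
  relators involving the generator of the unit die because \<open>\<Gamma>(1) = 1\<close>.\<close>

lemma par_ideal_subset_kernel:
  assumes "par_rels G K M \<sigma> \<Gamma>"
  shows "par_ideal K G \<sigma> \<subseteq> a_kernel (free_algebra K G) M (lin_ext K M (word_eval M \<Gamma>))"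
proof -
  interpret M: par_rels G K M \<sigma> \<Gamma> by fact
  have \<Gamma>: "\<Gamma> \<in> carrier G \<rightarrow> carrier M" by auto
  let ?f = "lin_ext K M (word_eval M \<Gamma>)"
  interpret f: ring_hom_ring "free_algebra K G" M ?f
    by (rule free_lift_hom[OF K.is_cring M.M.assoc_algebra_axioms \<Gamma>])
  note lin = linear_mapD[OF free_lift_linear[OF K.is_cring M.M.assoc_algebra_axioms \<Gamma>]]
    and gen = free_lift_gen[OF K.is_cring M.M.assoc_algebra_axioms \<Gamma>]
  have minus: "?f (x \<ominus>\<^bsub>free_algebra K G\<^esub> y) = ?f x \<ominus>\<^bsub>M\<^esub> ?f y"
    if "x \<in> carrier (free_algebra K G)" "y \<in> carrier (free_algebra K G)" for x y
    using that by (simp add: a_minus_def)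
  have "par_relators K G \<sigma> \<subseteq> a_kernel (free_algebra K G) M ?f"
  proof
    fix x assume x: "x \<in> par_relators K G \<sigma>"
    then have "?f x = \<zero>\<^bsub>M\<^esub>"
      unfolding par_relators_def Let_def
      by (auto simp: minus lin gen free_gen_closed[OF K.is_cring] M.\<Gamma>_one M.rel_zero_left
        M.rel_zero_right M.rel_left M.rel_right M.MR.r_neg a_minus_def)
    then show "x \<in> a_kernel (free_algebra K G) M ?f"
      using x par_relators_subset unfolding a_kernel_def' by blast
  qed
  then show ?thesis
    unfolding par_ideal_def by (intro FR.genideal_minimal f.kernel_is_ideal)
qed

text \<open>This makes the idempotents \<open>e\<close> and the products \<open>E\<close> available
  in the twisted partial group algebra, where \<psi> takes its values.\<close>

lemma par_rels_twisted: "par_rels G K (twisted_par_algebra K G \<sigma>) \<sigma> (par_gen K G \<sigma>)"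
proof -
  let ?I = "par_ideal K G \<sigma>" and ?Q = "twisted_par_algebra K G \<sigma>" and ?F = "free_algebra K G"
  interpret QR: ring ?Q by (rule assoc_algebra.axioms(2)[OF assoc_algebra_twisted])
  interpret Q: assoc_algebra K ?Q by (rule assoc_algebra_twisted)
  interpret I: ideal ?I ?F by (rule ideal_par_ideal)
  note ops = quot_algebra_ops[OF ideal_par_ideal, folded twisted_par_algebra_def]
  note smult = quot_algebra_smult_coset[OF F.assoc_algebra_axioms ideal_par_ideal, folded twisted_par_algebra_def]
  note gen = free_gen_closed[OF K.is_cring]
  have rel: "x \<in> ?I" if "x \<in> par_relators K G \<sigma>" for x
    using that FR.genideal_self[OF par_relators_subset] by (auto simp: par_ideal_def)
  have zero: "?I +>\<^bsub>?F\<^esub> x = \<zero>\<^bsub>?Q\<^esub>" if "x \<in> par_relators K G \<sigma>" for x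
    using I.a_rcos_const[OF rel[OF that]] ops(5) by simp
  have eq: "?I +>\<^bsub>?F\<^esub> x = ?I +>\<^bsub>?F\<^esub> y"
    if "x \<ominus>\<^bsub>?F\<^esub> y \<in> par_relators K G \<sigma>" "x \<in> carrier ?F" "y \<in> carrier ?F" for x y
    using I.a_rcos_module_minus[OF FR.ring_axioms that(3,2)] rel[OF that(1)] that(3)
    by (intro I.a_repr_independence'[symmetric]) auto
  note par_gen_def [simp] twist_closed [simp] gen [simp] ops(1-3) [simp] smult [simp]
  show ?thesis
  proof (unfold_locales)
    fix g h assume gh: "g \<in> carrier G" "h \<in> carrier G"
    then show "\<sigma> g h \<in> carrier K" by (rule twist_closed)
    show "par_gen K G \<sigma> (inv\<^bsub>G\<^esub> g) \<otimes>\<^bsub>?Q\<^esub> par_gen K G \<sigma> g \<otimes>\<^bsub>?Q\<^esub> par_gen K G \<sigma> h =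
        \<sigma> g h \<odot>\<^bsub>?Q\<^esub> (par_gen K G \<sigma> (inv\<^bsub>G\<^esub> g) \<otimes>\<^bsub>?Q\<^esub> par_gen K G \<sigma> (g \<otimes>\<^bsub>G\<^esub> h))"
      using gh eq[OF par_relatorsI(3)[OF gh]] by simp
    show "par_gen K G \<sigma> g \<otimes>\<^bsub>?Q\<^esub> par_gen K G \<sigma> h \<otimes>\<^bsub>?Q\<^esub> par_gen K G \<sigma> (inv\<^bsub>G\<^esub> h) =
        \<sigma> g h \<odot>\<^bsub>?Q\<^esub> (par_gen K G \<sigma> (g \<otimes>\<^bsub>G\<^esub> h) \<otimes>\<^bsub>?Q\<^esub> par_gen K G \<sigma> (inv\<^bsub>G\<^esub> h))"
      using gh eq[OF par_relatorsI(4)[OF gh]] by simp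
    assume 0: "\<sigma> g h = \<zero>\<^bsub>K\<^esub>"
    show "par_gen K G \<sigma> (inv\<^bsub>G\<^esub> g) \<otimes>\<^bsub>?Q\<^esub> par_gen K G \<sigma> (g \<otimes>\<^bsub>G\<^esub> h) = \<zero>\<^bsub>?Q\<^esub>"
      using gh zero[OF par_relatorsI(1)[OF gh 0]] by simp
    show "par_gen K G \<sigma> (g \<otimes>\<^bsub>G\<^esub> h) \<otimes>\<^bsub>?Q\<^esub> par_gen K G \<sigma> (inv\<^bsub>G\<^esub> h) = \<zero>\<^bsub>?Q\<^esub>"
      using gh zero[OF par_relatorsI(2)[OF gh 0]] by simp
  next
    fix g assume "g \<in> carrier G"
    then show "par_gen K G \<sigma> g \<in> carrier ?Q"
      by simp
  next
    show "par_gen K G \<sigma> \<one>\<^bsub>G\<^esub> = \<one>\<^bsub>?Q\<^esub>"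
      using eq[OF par_relatorsI(5)] by (simp add: ops(4))
  qed
qed

end


section \<open>Factor sets and admissible sets\<close>

text \<open>All that is retained of membership in \<open>pm\<close>. The remaining information about
  \<sigma> is supplied by the prohibitions.\<close>

locale normalised_twist = G: group G + K: field K
  for G :: "('g, 'n) monoid_scheme" and K :: "('k, 'm) ring_scheme" +
  fixes \<sigma> :: "'g \<Rightarrow> 'g \<Rightarrow> 'k"
  assumes \<sigma>_closed [simp]: "\<lbrakk>g \<in> carrier G; h \<in> carrier G\<rbrakk> \<Longrightarrow> \<sigma> g h \<in> carrier K"
    and \<sigma>_one_one: "\<sigma> \<one>\<^bsub>G\<^esub> \<one>\<^bsub>G\<^esub> = \<one>\<^bsub>K\<^esub>"
    and \<sigma>_one_left: "\<lbrakk>g \<in> carrier G; \<sigma> \<one>\<^bsub>G\<^esub> g \<noteq> \<zero>\<^bsub>K\<^esub>\<rbrakk> \<Longrightarrow> \<sigma> \<one>\<^bsub>G\<^esub> g = \<one>\<^bsub>K\<^esub>"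
    and \<sigma>_one_right: "\<lbrakk>g \<in> carrier G; \<sigma> g \<one>\<^bsub>G\<^esub> \<noteq> \<zero>\<^bsub>K\<^esub>\<rbrakk> \<Longrightarrow> \<sigma> g \<one>\<^bsub>G\<^esub> = \<one>\<^bsub>K\<^esub>"

text \<open>The relations at a pair containing the unit say that \<open>\<sigma>(1, g)\<close> and
  \<open>\<sigma>(g, 1)\<close> fix \<open>\<Gamma>(g)\<close>. If one of them is not 1, then
  \<open>\<Gamma>(g) = 0\<close>, and the axiom that a vanishing product forces a vanishing factor
  makes it 0. At \<open>g = 1\<close> this is excluded by \<open>\<Gamma>(1) = 1\<close>, which is
  nonzero.\<close>

lemma normalised_twist_pm:
  fixes K :: "('k, 'm) ring_scheme" and G :: "('g, 'n) monoid_scheme"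
  assumes K: "field K" and G: "group G" and \<sigma>: "\<sigma> \<in> pm TYPE('r) K G"
  shows "normalised_twist G K \<sigma>"
proof -
  from \<sigma> obtain R :: "('k, 'r) module" and \<Gamma>
    where R: "assoc_algebra K R" and ne: "\<one>\<^bsub>R\<^esub> \<noteq> \<zero>\<^bsub>R\<^esub>" and rep: "partial_proj_rep K G R \<sigma> \<Gamma>"
    by (auto simp: pm_def)
  have "par_rels G K R \<sigma> \<Gamma>"
    using rep unfolding partial_proj_rep_def
    by (intro par_rels.intro par_rels_axioms.intro K G R assoc_algebra.axioms(2)[OF R]) blast+
  then interpret par_rels G K R \<sigma> \<Gamma> .
  have prod: "\<sigma> g h = \<zero>\<^bsub>K\<^esub>" if "g \<in> carrier G" "h \<in> carrier G" "\<Gamma> g \<otimes>\<^bsub>R\<^esub> \<Gamma> h = \<zero>\<^bsub>R\<^esub>" for g h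
    using rep that unfolding partial_proj_rep_def by blast
  have left: "\<sigma> \<one>\<^bsub>G\<^esub> g \<odot>\<^bsub>R\<^esub> \<Gamma> g = \<Gamma> g" if "g \<in> carrier G" for g
    using rel_left[OF G.one_closed that] that by (simp add: \<Gamma>_one)
  have right: "\<sigma> g \<one>\<^bsub>G\<^esub> \<odot>\<^bsub>R\<^esub> \<Gamma> g = \<Gamma> g" if "g \<in> carrier G" for g
    using rel_right[OF that G.one_closed] that by (simp add: \<Gamma>_one)
  show ?thesis
  proof (unfold_locales)
    show "\<sigma> \<one>\<^bsub>G\<^esub> \<one>\<^bsub>G\<^esub> = \<one>\<^bsub>K\<^esub>"
    proof (rule ccontr)
      assume "\<sigma> \<one>\<^bsub>G\<^esub> \<one>\<^bsub>G\<^esub> \<noteq> \<one>\<^bsub>K\<^esub>"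
      then have "\<Gamma> \<one>\<^bsub>G\<^esub> = \<zero>\<^bsub>R\<^esub>"
        using left[OF G.one_closed]
        by (intro smult_eq_imp_zero[of "\<sigma> \<one>\<^bsub>G\<^esub> \<one>\<^bsub>G\<^esub>" "\<one>\<^bsub>K\<^esub>"]) simp_all
      with ne show False by (simp add: \<Gamma>_one)
    qed
  next
    fix g assume g: "g \<in> carrier G" and nz: "\<sigma> \<one>\<^bsub>G\<^esub> g \<noteq> \<zero>\<^bsub>K\<^esub>"
    show "\<sigma> \<one>\<^bsub>G\<^esub> g = \<one>\<^bsub>K\<^esub>"
    proof (rule ccontr)
      assume "\<sigma> \<one>\<^bsub>G\<^esub> g \<noteq> \<one>\<^bsub>K\<^esub>"
      then have "\<Gamma> g = \<zero>\<^bsub>R\<^esub>"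
        using left[OF g] g
        by (intro smult_eq_imp_zero[of "\<sigma> \<one>\<^bsub>G\<^esub> g" "\<one>\<^bsub>K\<^esub>"]) simp_all
      with prod[of "\<one>\<^bsub>G\<^esub>" g] g nz show False by simp
    qed
  next
    fix g assume g: "g \<in> carrier G" and nz: "\<sigma> g \<one>\<^bsub>G\<^esub> \<noteq> \<zero>\<^bsub>K\<^esub>"
    show "\<sigma> g \<one>\<^bsub>G\<^esub> = \<one>\<^bsub>K\<^esub>"
    proof (rule ccontr)
      assume "\<sigma> g \<one>\<^bsub>G\<^esub> \<noteq> \<one>\<^bsub>K\<^esub>"
      then have "\<Gamma> g = \<zero>\<^bsub>R\<^esub>"
        using right[OF g] g
        by (intro smult_eq_imp_zero[of "\<sigma> g \<one>\<^bsub>G\<^esub>" "\<one>\<^bsub>K\<^esub>"]) simp_all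
      with prod[of g "\<one>\<^bsub>G\<^esub>"] g nz show False by simp
    qed
  qed simp
qed

context normalised_twist
begin

abbreviation "\<Omega> \<equiv> Omega_tw K G \<sigma>"
abbreviation "\<A> \<equiv> adm_algebra K G \<sigma>"
abbreviation "bv \<equiv> basis_vec K"

lemma Omega_twD:
  assumes "U \<in> \<Omega>"
  shows "U \<subseteq> carrier G" "\<one>\<^bsub>G\<^esub> \<in> U"
  using assms by (auto simp: Omega_tw_def Omega_def)

text \<open>With \<open>\<sigma>_cocycle\<close>, this is what admissibility provides: along chains
  of points inside one admissible set \<sigma> behaves like an ordinary cocycle with values in the
  nonzero scalars. The start \<open>a\<close> of the chain is free to be chosen.\<close>

lemma \<sigma>_nonzero:
  assumes U: "U \<in> \<Omega>" and a: "a \<in> U" "a \<otimes>\<^bsub>G\<^esub> g \<in> U" "a \<otimes>\<^bsub>G\<^esub> g \<otimes>\<^bsub>G\<^esub> s \<in> U"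
    and g: "g \<in> carrier G" "s \<in> carrier G"
  shows "\<sigma> g s \<noteq> \<zero>\<^bsub>K\<^esub>"
proof
  assume "\<sigma> g s = \<zero>\<^bsub>K\<^esub>"
  moreover have "a \<in> carrier G" using U a(1) Omega_twD by blast
  ultimately have "{a, a \<otimes>\<^bsub>G\<^esub> g, a \<otimes>\<^bsub>G\<^esub> g \<otimes>\<^bsub>G\<^esub> s} \<in> prohibitions K G \<sigma>"
    using g unfolding prohibitions_def prohibitions_I_def by blast
  with U a show False by (auto simp: Omega_tw_def)
qed

lemma \<sigma>_cocycle:
  assumes U: "U \<in> \<Omega>"
    and a: "a \<in> U" "a \<otimes>\<^bsub>G\<^esub> g \<in> U" "a \<otimes>\<^bsub>G\<^esub> g \<otimes>\<^bsub>G\<^esub> s \<in> U" "a \<otimes>\<^bsub>G\<^esub> g \<otimes>\<^bsub>G\<^esub> s \<otimes>\<^bsub>G\<^esub> t \<in> U"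
    and g: "g \<in> carrier G" "s \<in> carrier G" "t \<in> carrier G"
  shows "\<sigma> g (s \<otimes>\<^bsub>G\<^esub> t) \<otimes>\<^bsub>K\<^esub> \<sigma> s t = \<sigma> g s \<otimes>\<^bsub>K\<^esub> \<sigma> (g \<otimes>\<^bsub>G\<^esub> s) t"
proof (rule ccontr)
  assume "\<not> ?thesis"
  moreover have "a \<in> carrier G" using U a(1) Omega_twD by blast
  ultimately have "{a, a \<otimes>\<^bsub>G\<^esub> g, a \<otimes>\<^bsub>G\<^esub> g \<otimes>\<^bsub>G\<^esub> s, a \<otimes>\<^bsub>G\<^esub> g \<otimes>\<^bsub>G\<^esub> s \<otimes>\<^bsub>G\<^esub> t} \<in> prohibitions K G \<sigma>"
    using g unfolding prohibitions_def prohibitions_II_def by blast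
  with U a show False by (auto simp: Omega_tw_def)
qed

lemma translate_prohibition:
  assumes "W \<in> prohibitions K G \<sigma>" and x: "x \<in> carrier G"
  shows "x <#\<^bsub>G\<^esub> W \<in> prohibitions K G \<sigma>"
  using assms(1) unfolding prohibitions_def
proof
  assume "W \<in> prohibitions_I K G \<sigma>"
  then obtain h g s where *: "h \<in> carrier G" "g \<in> carrier G" "s \<in> carrier G" "\<sigma> g s = \<zero>\<^bsub>K\<^esub>"
    and W: "W = {h, h \<otimes>\<^bsub>G\<^esub> g, h \<otimes>\<^bsub>G\<^esub> g \<otimes>\<^bsub>G\<^esub> s}"
    by (auto simp: prohibitions_I_def)
  let ?h = "x \<otimes>\<^bsub>G\<^esub> h"
  have "x <#\<^bsub>G\<^esub> W = {?h, ?h \<otimes>\<^bsub>G\<^esub> g, ?h \<otimes>\<^bsub>G\<^esub> g \<otimes>\<^bsub>G\<^esub> s}"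
    using * x by (auto simp: W l_coset_def G.m_assoc)
  moreover have "?h \<in> carrier G" using * x by simp
  ultimately have "x <#\<^bsub>G\<^esub> W \<in> prohibitions_I K G \<sigma>"
    unfolding prohibitions_I_def using * by blast
  then show "x <#\<^bsub>G\<^esub> W \<in> prohibitions_I K G \<sigma> \<union> prohibitions_II K G \<sigma>" by blast
next
  assume "W \<in> prohibitions_II K G \<sigma>"
  then obtain h g s t where *: "h \<in> carrier G" "g \<in> carrier G" "s \<in> carrier G" "t \<in> carrier G"
    "\<sigma> g (s \<otimes>\<^bsub>G\<^esub> t) \<otimes>\<^bsub>K\<^esub> \<sigma> s t \<noteq> \<sigma> g s \<otimes>\<^bsub>K\<^esub> \<sigma> (g \<otimes>\<^bsub>G\<^esub> s) t"
    and W: "W = {h, h \<otimes>\<^bsub>G\<^esub> g, h \<otimes>\<^bsub>G\<^esub> g \<otimes>\<^bsub>G\<^esub> s, h \<otimes>\<^bsub>G\<^esub> g \<otimes>\<^bsub>G\<^esub> s \<otimes>\<^bsub>G\<^esub> t}"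
    by (auto simp: prohibitions_II_def)
  let ?h = "x \<otimes>\<^bsub>G\<^esub> h"
  have "x <#\<^bsub>G\<^esub> W = {?h, ?h \<otimes>\<^bsub>G\<^esub> g, ?h \<otimes>\<^bsub>G\<^esub> g \<otimes>\<^bsub>G\<^esub> s, ?h \<otimes>\<^bsub>G\<^esub> g \<otimes>\<^bsub>G\<^esub> s \<otimes>\<^bsub>G\<^esub> t}"
    using * x by (auto simp: W l_coset_def G.m_assoc)
  moreover have "?h \<in> carrier G" using * x by simp
  ultimately have "x <#\<^bsub>G\<^esub> W \<in> prohibitions_II K G \<sigma>"
    unfolding prohibitions_II_def using * by blast
  then show "x <#\<^bsub>G\<^esub> W \<in> prohibitions_I K G \<sigma> \<union> prohibitions_II K G \<sigma>" by blast
qed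

text \<open>Translation by \<open>g\<close> would carry a prohibition inside \<open>V\<close> to one
  inside \<open>U\<close>. Consequently, a product whose right-hand part is already inadmissible
  also vanishes in the other bracketing.\<close>

lemma Omega_tw_translate:
  assumes U: "U \<in> \<Omega>" and g: "g \<in> carrier G"
    and V: "V \<subseteq> carrier G" "\<one>\<^bsub>G\<^esub> \<in> V" "g <#\<^bsub>G\<^esub> V \<subseteq> U"
  shows "V \<in> \<Omega>"
  unfolding Omega_tw_def
proof (intro CollectI conjI ballI notI)
  show "V \<in> Omega G" using V by (simp add: Omega_def)
  fix W assume W: "W \<in> prohibitions K G \<sigma>" "W \<subseteq> V"
  then have "g <#\<^bsub>G\<^esub> W \<subseteq> U"
    using V(3) by (auto simp: l_coset_def)
  with translate_prohibition[OF W(1) g] U show False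
    by (auto simp: Omega_tw_def)
qed

lemma Omega_tw_mono:
  assumes "U \<in> \<Omega>" "V \<subseteq> U" "\<one>\<^bsub>G\<^esub> \<in> V"
  shows "V \<in> \<Omega>"
  using assms unfolding Omega_tw_def Omega_def by blast

text \<open>A prohibition inside the singleton has all its parameters equal to the unit. Type I is
  then excluded by \<open>\<sigma>(1, 1) = 1\<close>, type II because both sides of its inequality
  coincide.\<close>

lemma one_Omega_tw: "{\<one>\<^bsub>G\<^esub>} \<in> \<Omega>"
  unfolding Omega_tw_def
proof (intro CollectI conjI ballI notI)
  show "{\<one>\<^bsub>G\<^esub>} \<in> Omega G" by (simp add: Omega_def)
  fix W assume "W \<in> prohibitions K G \<sigma>" and sub: "W \<subseteq> {\<one>\<^bsub>G\<^esub>}"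
  then show False
    unfolding prohibitions_def
  proof (elim UnE)
    assume "W \<in> prohibitions_I K G \<sigma>"
    then obtain h g s where *: "g \<in> carrier G" "s \<in> carrier G" "\<sigma> g s = \<zero>\<^bsub>K\<^esub>"
      and W: "W = {h, h \<otimes>\<^bsub>G\<^esub> g, h \<otimes>\<^bsub>G\<^esub> g \<otimes>\<^bsub>G\<^esub> s}"
      unfolding prohibitions_I_def by blast
    from sub have h: "h = \<one>\<^bsub>G\<^esub>" "h \<otimes>\<^bsub>G\<^esub> g = \<one>\<^bsub>G\<^esub>" "h \<otimes>\<^bsub>G\<^esub> g \<otimes>\<^bsub>G\<^esub> s = \<one>\<^bsub>G\<^esub>"
      unfolding W by blast+
    have g: "g = \<one>\<^bsub>G\<^esub>" using *(1) h(1,2) by simp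
    have s: "s = \<one>\<^bsub>G\<^esub>" using *(2) h(1,3) by (simp add: g)
    show False using *(3) by (simp add: g s \<sigma>_one_one)
  next
    assume "W \<in> prohibitions_II K G \<sigma>"
    then obtain h g s t where *: "g \<in> carrier G" "s \<in> carrier G" "t \<in> carrier G"
      "\<sigma> g (s \<otimes>\<^bsub>G\<^esub> t) \<otimes>\<^bsub>K\<^esub> \<sigma> s t \<noteq> \<sigma> g s \<otimes>\<^bsub>K\<^esub> \<sigma> (g \<otimes>\<^bsub>G\<^esub> s) t"
      and W: "W = {h, h \<otimes>\<^bsub>G\<^esub> g, h \<otimes>\<^bsub>G\<^esub> g \<otimes>\<^bsub>G\<^esub> s, h \<otimes>\<^bsub>G\<^esub> g \<otimes>\<^bsub>G\<^esub> s \<otimes>\<^bsub>G\<^esub> t}"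
      unfolding prohibitions_II_def by blast
    from sub have h: "h = \<one>\<^bsub>G\<^esub>" "h \<otimes>\<^bsub>G\<^esub> g = \<one>\<^bsub>G\<^esub>" "h \<otimes>\<^bsub>G\<^esub> g \<otimes>\<^bsub>G\<^esub> s = \<one>\<^bsub>G\<^esub>"
      "h \<otimes>\<^bsub>G\<^esub> g \<otimes>\<^bsub>G\<^esub> s \<otimes>\<^bsub>G\<^esub> t = \<one>\<^bsub>G\<^esub>"
      unfolding W by blast+
    have g: "g = \<one>\<^bsub>G\<^esub>" using *(1) h(1,2) by simp
    have s: "s = \<one>\<^bsub>G\<^esub>" using *(2) h(1,3) by (simp add: g)
    have t: "t = \<one>\<^bsub>G\<^esub>" using *(3) h(1,4) by (simp add: g s)
    show False using *(4) by (simp add: g s t)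
  qed
qed

lemma l_coset_one: "V \<subseteq> carrier G \<Longrightarrow> \<one>\<^bsub>G\<^esub> <#\<^bsub>G\<^esub> V = V"
  by (force simp: l_coset_def)

lemma adm_pairs_iff: "(U, g) \<in> adm_pairs K G \<sigma> \<longleftrightarrow> U \<in> \<Omega> \<and> finite U \<and> g \<in> U"
  by (simp add: adm_pairs_def)

lemma zero_adm_algebra: "\<zero>\<^bsub>\<A>\<^esub> = (\<lambda>r. \<zero>\<^bsub>K\<^esub>)"
  and smult_adm_algebra: "c \<odot>\<^bsub>\<A>\<^esub> x = (\<lambda>r. c \<otimes>\<^bsub>K\<^esub> x r)"
  by (simp_all add: adm_algebra_def basis_algebra_def)

lemma star_basis_eq:
  assumes "g \<in> carrier G" "h \<in> carrier G"
  shows "star_basis K G \<sigma> (U, g) (V, h) =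
    (if U \<union> (g <#\<^bsub>G\<^esub> V) \<in> \<Omega>
      then \<sigma> g h \<odot>\<^bsub>\<A>\<^esub> bv (U \<union> (g <#\<^bsub>G\<^esub> V), g \<otimes>\<^bsub>G\<^esub> h) else \<zero>\<^bsub>\<A>\<^esub>)"
  using assms
  by (auto simp: star_basis_def chi_def zero_adm_algebra smult_adm_algebra fun_eq_iff basis_vec_def)

lemma adm_pairs_star:
  assumes "(U, g) \<in> adm_pairs K G \<sigma>" "(V, h) \<in> adm_pairs K G \<sigma>" "U \<union> (g <#\<^bsub>G\<^esub> V) \<in> \<Omega>"
  shows "(U \<union> (g <#\<^bsub>G\<^esub> V), g \<otimes>\<^bsub>G\<^esub> h) \<in> adm_pairs K G \<sigma>"
  using assms by (auto simp: adm_pairs_iff l_coset_def)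

lemma adm_pairsD:
  assumes "(U, g) \<in> adm_pairs K G \<sigma>"
  shows "U \<in> \<Omega>" "finite U" "g \<in> U" "g \<in> carrier G" "U \<subseteq> carrier G" "\<one>\<^bsub>G\<^esub> \<in> U"
  using assms Omega_twD by (auto simp: adm_pairs_iff)

lemma structure_constants_adm:
  "structure_constants K (adm_pairs K G \<sigma>) (star_basis K G \<sigma>) ({\<one>\<^bsub>G\<^esub>}, \<one>\<^bsub>G\<^esub>)"
proof
  show "({\<one>\<^bsub>G\<^esub>}, \<one>\<^bsub>G\<^esub>) \<in> adm_pairs K G \<sigma>"
    by (simp add: adm_pairs_iff one_Omega_tw)
  fix p q assume pq: "p \<in> adm_pairs K G \<sigma>" "q \<in> adm_pairs K G \<sigma>"
  obtain U g V h where p: "p = (U, g)" and q: "q = (V, h)" by (cases p; cases q)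
  note gh = adm_pairsD[OF pq(1)[unfolded p]] adm_pairsD[OF pq(2)[unfolded q]]
  have "bv (U \<union> (g <#\<^bsub>G\<^esub> V), g \<otimes>\<^bsub>G\<^esub> h) \<in> carrier \<A>" if "U \<union> (g <#\<^bsub>G\<^esub> V) \<in> \<Omega>"
    using pq that unfolding adm_algebra_def p q by (intro K.basis_vec_closed adm_pairs_star)
  \<comment> \<open>Proved directly, since \<open>smult_A_closed\<close> belongs to the locale whose
    assumptions are being established.\<close>
  moreover have "c \<odot>\<^bsub>\<A>\<^esub> x \<in> carrier \<A>" if "c \<in> carrier K" "x \<in> carrier \<A>" for c x
  proof -
    have "supp K (c \<odot>\<^bsub>\<A>\<^esub> x) \<subseteq> supp K x"
      using that by (auto simp: supp_def smult_adm_algebra)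
    then show ?thesis
      using that unfolding smult_adm_algebra
      by (auto simp: adm_algebra_def basis_algebra_def intro: finite_subset)
  qed
  moreover have "\<zero>\<^bsub>\<A>\<^esub> \<in> carrier \<A>"
    by (simp add: adm_algebra_def basis_algebra_def supp_def)
  ultimately have "star_basis K G \<sigma> (U, g) (V, h) \<in> carrier \<A>"
    using gh by (simp add: star_basis_eq)
  then show "star_basis K G \<sigma> p q \<in>
      carrier (basis_algebra K (adm_pairs K G \<sigma>) (star_basis K G \<sigma>) ({\<one>\<^bsub>G\<^esub>}, \<one>\<^bsub>G\<^esub>))"
    by (simp add: p q adm_algebra_def)
qed

end


section \<open>The isomorphism\<close>

context normalised_twist
begin

interpretation A: structure_constants K "adm_pairs K G \<sigma>" "star_basis K G \<sigma>" "({\<one>\<^bsub>G\<^esub>}, \<one>\<^bsub>G\<^esub>)"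
  rewrites "basis_algebra K (adm_pairs K G \<sigma>) (star_basis K G \<sigma>) ({\<one>\<^bsub>G\<^esub>}, \<one>\<^bsub>G\<^esub>) = \<A>"
  by (rule structure_constants_adm) (simp add: adm_algebra_def)

interpretation AM: module K \<A> by (rule A.module_A)

lemma adm_basis_closed: "\<lbrakk>U \<in> \<Omega>; finite U; g \<in> U\<rbrakk> \<Longrightarrow> bv (U, g) \<in> carrier \<A>"
  unfolding adm_algebra_def by (intro K.basis_vec_closed) (simp add: adm_pairs_iff)

lemma adm_mult:
  assumes "(U, g) \<in> adm_pairs K G \<sigma>" "(V, h) \<in> adm_pairs K G \<sigma>"
  shows "bv (U, g) \<otimes>\<^bsub>\<A>\<^esub> bv (V, h) =
    (if U \<union> (g <#\<^bsub>G\<^esub> V) \<in> \<Omega>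
      then \<sigma> g h \<odot>\<^bsub>\<A>\<^esub> bv (U \<union> (g <#\<^bsub>G\<^esub> V), g \<otimes>\<^bsub>G\<^esub> h) else \<zero>\<^bsub>\<A>\<^esub>)"
  using assms adm_pairsD(4)[OF assms(1)] adm_pairsD(4)[OF assms(2)]
  by (simp add: A.mult_basis_vec star_basis_eq)

lemma adm_star_closed:
  assumes "(U, g) \<in> adm_pairs K G \<sigma>" "(V, h) \<in> adm_pairs K G \<sigma>" "U \<union> (g <#\<^bsub>G\<^esub> V) \<in> \<Omega>"
  shows "bv (U \<union> (g <#\<^bsub>G\<^esub> V), g \<otimes>\<^bsub>G\<^esub> h) \<in> carrier \<A>"
  using adm_pairs_star[OF assms] by (intro adm_basis_closed) (auto dest: adm_pairsD)

lemma zero_mult: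
  assumes "x \<in> carrier \<A>"
  shows "\<zero>\<^bsub>\<A>\<^esub> \<otimes>\<^bsub>\<A>\<^esub> x = \<zero>\<^bsub>\<A>\<^esub>" "x \<otimes>\<^bsub>\<A>\<^esub> \<zero>\<^bsub>\<A>\<^esub> = \<zero>\<^bsub>\<A>\<^esub>"
  using A.mult_smult_left[of "\<zero>\<^bsub>K\<^esub>" "\<zero>\<^bsub>\<A>\<^esub>" x] A.mult_smult_right[of "\<zero>\<^bsub>K\<^esub>" x "\<zero>\<^bsub>\<A>\<^esub>"] assms
  by simp_all

text \<open>Both bracketings lead to the same set \<open>?X\<close>. If it is inadmissible both
  vanish, for an inadmissible partial union makes \<open>?X\<close> inadmissible: as a subset on the
  left, as a translated subset on the right. If it is admissible, it contains the chain
  \<open>1, g, gh, ghk\<close>, and the cocycle identity equates the scalars.\<close>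

lemma adm_assoc:
  assumes p: "(U, g) \<in> adm_pairs K G \<sigma>" and q: "(V, h) \<in> adm_pairs K G \<sigma>"
    and s: "(W, k) \<in> adm_pairs K G \<sigma>"
  shows "(bv (U, g) \<otimes>\<^bsub>\<A>\<^esub> bv (V, h)) \<otimes>\<^bsub>\<A>\<^esub> bv (W, k) =
    bv (U, g) \<otimes>\<^bsub>\<A>\<^esub> (bv (V, h) \<otimes>\<^bsub>\<A>\<^esub> bv (W, k))"
proof -
  note D = adm_pairsD[OF p] adm_pairsD[OF q] adm_pairsD[OF s]
  note cl = adm_basis_closed[OF D(1-3)] adm_basis_closed[OF D(7-9)] adm_basis_closed[OF D(13-15)]
  let ?X = "U \<union> (g <#\<^bsub>G\<^esub> V) \<union> (g \<otimes>\<^bsub>G\<^esub> h <#\<^bsub>G\<^esub> W)"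
  have X: "U \<union> (g <#\<^bsub>G\<^esub> (V \<union> (h <#\<^bsub>G\<^esub> W))) = ?X"
    using D by (simp add: l_coset_Un G.lcos_m_assoc Un_assoc)
  have L: "U \<union> (g <#\<^bsub>G\<^esub> V) \<in> \<Omega>" if "?X \<in> \<Omega>"
    using that D by (elim Omega_tw_mono) auto
  have R: "V \<union> (h <#\<^bsub>G\<^esub> W) \<in> \<Omega>" if "?X \<in> \<Omega>"
  proof (rule Omega_tw_translate[OF that D(4)])
    show "V \<union> (h <#\<^bsub>G\<^esub> W) \<subseteq> carrier G"
      using D G.l_coset_subset_G by blast
    show "g <#\<^bsub>G\<^esub> (V \<union> (h <#\<^bsub>G\<^esub> W)) \<subseteq> ?X"
      using X by blast
  qed (use D in simp)
  have left: "(bv (U, g) \<otimes>\<^bsub>\<A>\<^esub> bv (V, h)) \<otimes>\<^bsub>\<A>\<^esub> bv (W, k) =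
    (if ?X \<in> \<Omega> then (\<sigma> g h \<otimes>\<^bsub>K\<^esub> \<sigma> (g \<otimes>\<^bsub>G\<^esub> h) k) \<odot>\<^bsub>\<A>\<^esub> bv (?X, g \<otimes>\<^bsub>G\<^esub> h \<otimes>\<^bsub>G\<^esub> k) else \<zero>\<^bsub>\<A>\<^esub>)"
  proof (cases "U \<union> (g <#\<^bsub>G\<^esub> V) \<in> \<Omega>")
    case True
    note pq = adm_pairs_star[OF p q True]
    show ?thesis
      using D cl adm_star_closed[OF p q True] adm_star_closed[OF pq s]
      by (simp add: adm_mult[OF p q] True A.mult_smult_left adm_mult[OF pq s] AM.smult_assoc1)
  next
    case False
    then show ?thesis
      using L cl by (auto simp: adm_mult[OF p q] zero_mult)
  qed
  have right: "bv (U, g) \<otimes>\<^bsub>\<A>\<^esub> (bv (V, h) \<otimes>\<^bsub>\<A>\<^esub> bv (W, k)) =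
    (if ?X \<in> \<Omega> then (\<sigma> g (h \<otimes>\<^bsub>G\<^esub> k) \<otimes>\<^bsub>K\<^esub> \<sigma> h k) \<odot>\<^bsub>\<A>\<^esub> bv (?X, g \<otimes>\<^bsub>G\<^esub> h \<otimes>\<^bsub>G\<^esub> k) else \<zero>\<^bsub>\<A>\<^esub>)"
  proof (cases "V \<union> (h <#\<^bsub>G\<^esub> W) \<in> \<Omega>")
    case True
    note qs = adm_pairs_star[OF q s True]
    show ?thesis
      using D cl adm_star_closed[OF q s True] adm_star_closed[OF p qs, unfolded X]
      by (simp add: adm_mult[OF q s] True A.mult_smult_right adm_mult[OF p qs] X G.m_assoc
        K.m_comm flip: AM.smult_assoc1)
  next
    case False
    then show ?thesis
      using R cl by (auto simp: adm_mult[OF q s] zero_mult)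
  qed
  have "\<sigma> g (h \<otimes>\<^bsub>G\<^esub> k) \<otimes>\<^bsub>K\<^esub> \<sigma> h k = \<sigma> g h \<otimes>\<^bsub>K\<^esub> \<sigma> (g \<otimes>\<^bsub>G\<^esub> h) k" if "?X \<in> \<Omega>"
  proof -
    have "g \<otimes>\<^bsub>G\<^esub> h \<in> g <#\<^bsub>G\<^esub> V" "g \<otimes>\<^bsub>G\<^esub> h \<otimes>\<^bsub>G\<^esub> k \<in> g \<otimes>\<^bsub>G\<^esub> h <#\<^bsub>G\<^esub> W"
      using D by (auto simp: l_coset_def)
    then show ?thesis
      using D by (intro \<sigma>_cocycle[OF that, where a = "\<one>\<^bsub>G\<^esub>"]) simp_all
  qed
  then show ?thesis
    unfolding left right by simp
qed

lemma assoc_algebra_adm: "assoc_algebra K \<A>"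
proof (rule A.assoc_algebra_A)
  have one: "({\<one>\<^bsub>G\<^esub>}, \<one>\<^bsub>G\<^esub>) \<in> adm_pairs K G \<sigma>"
    by (rule A.unit_in_basis)
  fix q assume q: "q \<in> adm_pairs K G \<sigma>"
  obtain V h where qV: "q = (V, h)" by (cases q)
  note D = adm_pairsD[OF q[unfolded qV]]
  note cl = adm_basis_closed[OF D(1-3)]
  have "{\<one>\<^bsub>G\<^esub>} \<union> (\<one>\<^bsub>G\<^esub> <#\<^bsub>G\<^esub> V) = V" "V \<union> (h <#\<^bsub>G\<^esub> {\<one>\<^bsub>G\<^esub>}) = V"
    using D by (auto simp: l_coset_one) (auto simp: l_coset_def)
  \<comment> \<open>Admissibility of \<open>V\<close>, through the chains \<open>1, 1, h\<close> and
    \<open>1, h, h\<close>, makes both values nonzero; normalisation then makes them 1.\<close>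
  moreover have "\<sigma> \<one>\<^bsub>G\<^esub> h = \<one>\<^bsub>K\<^esub>" "\<sigma> h \<one>\<^bsub>G\<^esub> = \<one>\<^bsub>K\<^esub>"
    using D \<sigma>_one_left \<sigma>_one_right \<sigma>_nonzero[OF D(1), of "\<one>\<^bsub>G\<^esub>" "\<one>\<^bsub>G\<^esub>" h]
      \<sigma>_nonzero[OF D(1), of "\<one>\<^bsub>G\<^esub>" h "\<one>\<^bsub>G\<^esub>"]
    by simp_all
  ultimately show "star_basis K G \<sigma> ({\<one>\<^bsub>G\<^esub>}, \<one>\<^bsub>G\<^esub>) q = bv q" "star_basis K G \<sigma> q ({\<one>\<^bsub>G\<^esub>}, \<one>\<^bsub>G\<^esub>) = bv q"
    using D cl by (simp_all add: qV star_basis_eq)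
next
  fix p q s assume pqs: "p \<in> adm_pairs K G \<sigma>" "q \<in> adm_pairs K G \<sigma>" "s \<in> adm_pairs K G \<sigma>"
  then have "(bv p \<otimes>\<^bsub>\<A>\<^esub> bv q) \<otimes>\<^bsub>\<A>\<^esub> bv s = bv p \<otimes>\<^bsub>\<A>\<^esub> (bv q \<otimes>\<^bsub>\<A>\<^esub> bv s)"
    by (cases p; cases q; cases s) (simp add: adm_assoc)
  with pqs show "star_basis K G \<sigma> p q \<otimes>\<^bsub>\<A>\<^esub> bv s = bv p \<otimes>\<^bsub>\<A>\<^esub> star_basis K G \<sigma> q s"
    by (simp add: A.mult_basis_vec)
qed

interpretation AR: ring \<A>
  by (rule assoc_algebra.axioms(2)[OF assoc_algebra_adm])

definition \<gamma> :: "'g \<Rightarrow> 'g set \<times> 'g \<Rightarrow> 'k" where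
  "\<gamma> g = chi K G \<sigma> {\<one>\<^bsub>G\<^esub>, g} \<odot>\<^bsub>\<A>\<^esub> bv ({\<one>\<^bsub>G\<^esub>, g}, g)"

lemma \<gamma>_eq:
  assumes "g \<in> carrier G"
  shows "\<gamma> g = (if {\<one>\<^bsub>G\<^esub>, g} \<in> \<Omega> then bv ({\<one>\<^bsub>G\<^esub>, g}, g) else \<zero>\<^bsub>\<A>\<^esub>)"
  using assms by (auto simp: \<gamma>_def chi_def smult_adm_algebra zero_adm_algebra basis_vec_def)

lemma \<gamma>_closed [simp]: "g \<in> carrier G \<Longrightarrow> \<gamma> g \<in> carrier \<A>"
  by (simp add: \<gamma>_eq adm_basis_closed)

lemma \<gamma>_one: "\<gamma> \<one>\<^bsub>G\<^esub> = \<one>\<^bsub>\<A>\<^esub>"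
  using one_Omega_tw by (simp add: \<gamma>_eq A.one_A)

text \<open>Since \<open>V\<close> contains the unit, \<open>gV\<close> contains \<open>g\<close>,
  so the union adds only the unit to \<open>gV\<close>. This set also contains
  \<open>{1, g}\<close>, whose inadmissibility is therefore already covered by the single
  condition.\<close>

lemma \<gamma>_mult_bv:
  assumes g: "g \<in> carrier G" and q: "(V, h) \<in> adm_pairs K G \<sigma>"
  shows "\<gamma> g \<otimes>\<^bsub>\<A>\<^esub> bv (V, h) =
    (if insert \<one>\<^bsub>G\<^esub> (g <#\<^bsub>G\<^esub> V) \<in> \<Omega>
      then \<sigma> g h \<odot>\<^bsub>\<A>\<^esub> bv (insert \<one>\<^bsub>G\<^esub> (g <#\<^bsub>G\<^esub> V), g \<otimes>\<^bsub>G\<^esub> h) else \<zero>\<^bsub>\<A>\<^esub>)"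
proof -
  note D = adm_pairsD[OF q]
  have "g \<in> g <#\<^bsub>G\<^esub> V"
    using D g by (force simp: l_coset_def)
  then have X: "{\<one>\<^bsub>G\<^esub>, g} \<union> (g <#\<^bsub>G\<^esub> V) = insert \<one>\<^bsub>G\<^esub> (g <#\<^bsub>G\<^esub> V)"
    by auto
  show ?thesis
  proof (cases "{\<one>\<^bsub>G\<^esub>, g} \<in> \<Omega>")
    case True
    then have "({\<one>\<^bsub>G\<^esub>, g}, g) \<in> adm_pairs K G \<sigma>"
      by (simp add: adm_pairs_iff)
    from adm_mult[OF this q, unfolded X] show ?thesis
      using g True by (simp add: \<gamma>_eq)
  next
    case False
    then have "insert \<one>\<^bsub>G\<^esub> (g <#\<^bsub>G\<^esub> V) \<notin> \<Omega>"
      using X Omega_tw_mono[of _ "{\<one>\<^bsub>G\<^esub>, g}"] by auto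
    then show ?thesis
      using False g D by (simp add: \<gamma>_eq zero_mult adm_basis_closed)
  qed
qed

lemma \<gamma>_mult_\<gamma>:
  assumes g: "g \<in> carrier G" and h: "h \<in> carrier G"
  shows "\<gamma> g \<otimes>\<^bsub>\<A>\<^esub> \<gamma> h =
    (if {\<one>\<^bsub>G\<^esub>, g, g \<otimes>\<^bsub>G\<^esub> h} \<in> \<Omega>
      then \<sigma> g h \<odot>\<^bsub>\<A>\<^esub> bv ({\<one>\<^bsub>G\<^esub>, g, g \<otimes>\<^bsub>G\<^esub> h}, g \<otimes>\<^bsub>G\<^esub> h) else \<zero>\<^bsub>\<A>\<^esub>)"
proof -
  have X: "insert \<one>\<^bsub>G\<^esub> (g <#\<^bsub>G\<^esub> {\<one>\<^bsub>G\<^esub>, h}) = {\<one>\<^bsub>G\<^esub>, g, g \<otimes>\<^bsub>G\<^esub> h}"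
    using g h by (auto simp: l_coset_def)
  show ?thesis
  proof (cases "{\<one>\<^bsub>G\<^esub>, h} \<in> \<Omega>")
    case True
    then have "({\<one>\<^bsub>G\<^esub>, h}, h) \<in> adm_pairs K G \<sigma>"
      by (simp add: adm_pairs_iff)
    from \<gamma>_mult_bv[OF g this] show ?thesis
      using h True by (simp add: \<gamma>_eq[of h] X)
  next
    case False
    have "{\<one>\<^bsub>G\<^esub>, g, g \<otimes>\<^bsub>G\<^esub> h} \<notin> \<Omega>"
      using Omega_tw_translate[OF _ g, of _ "{\<one>\<^bsub>G\<^esub>, h}"] False h X by auto
    then show ?thesis
      using False g h by (simp add: \<gamma>_eq[of h] zero_mult)
  qed
qed

lemma \<gamma>_mult_\<gamma>_\<gamma>:
  assumes g: "g \<in> carrier G" and h: "h \<in> carrier G" and k: "k \<in> carrier G"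
  defines "X \<equiv> {\<one>\<^bsub>G\<^esub>, g, g \<otimes>\<^bsub>G\<^esub> h, g \<otimes>\<^bsub>G\<^esub> h \<otimes>\<^bsub>G\<^esub> k}"
  shows "\<gamma> g \<otimes>\<^bsub>\<A>\<^esub> \<gamma> h \<otimes>\<^bsub>\<A>\<^esub> \<gamma> k =
    (if X \<in> \<Omega>
      then (\<sigma> g h \<otimes>\<^bsub>K\<^esub> \<sigma> (g \<otimes>\<^bsub>G\<^esub> h) k) \<odot>\<^bsub>\<A>\<^esub> bv (X, g \<otimes>\<^bsub>G\<^esub> h \<otimes>\<^bsub>G\<^esub> k) else \<zero>\<^bsub>\<A>\<^esub>)"
proof -
  have X: "{\<one>\<^bsub>G\<^esub>, g, g \<otimes>\<^bsub>G\<^esub> h} \<union> (g \<otimes>\<^bsub>G\<^esub> h <#\<^bsub>G\<^esub> {\<one>\<^bsub>G\<^esub>, k}) = X"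
    using g h k by (auto simp: l_coset_def X_def)
  have sub: "{\<one>\<^bsub>G\<^esub>, g, g \<otimes>\<^bsub>G\<^esub> h} \<in> \<Omega>" "{\<one>\<^bsub>G\<^esub>, k} \<in> \<Omega>" if "X \<in> \<Omega>"
  proof -
    show "{\<one>\<^bsub>G\<^esub>, g, g \<otimes>\<^bsub>G\<^esub> h} \<in> \<Omega>"
      using that by (rule Omega_tw_mono) (auto simp: X_def)
    show "{\<one>\<^bsub>G\<^esub>, k} \<in> \<Omega>"
      using that by (rule Omega_tw_translate[where g = "g \<otimes>\<^bsub>G\<^esub> h"]) (use g h k X in auto)
  qed
  show ?thesis
  proof (cases "{\<one>\<^bsub>G\<^esub>, g, g \<otimes>\<^bsub>G\<^esub> h} \<in> \<Omega> \<and> {\<one>\<^bsub>G\<^esub>, k} \<in> \<Omega>")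
    case True
    then have p: "({\<one>\<^bsub>G\<^esub>, g, g \<otimes>\<^bsub>G\<^esub> h}, g \<otimes>\<^bsub>G\<^esub> h) \<in> adm_pairs K G \<sigma>"
      and q: "({\<one>\<^bsub>G\<^esub>, k}, k) \<in> adm_pairs K G \<sigma>"
      by (simp_all add: adm_pairs_iff)
    have "bv ({\<one>\<^bsub>G\<^esub>, g, g \<otimes>\<^bsub>G\<^esub> h}, g \<otimes>\<^bsub>G\<^esub> h) \<in> carrier \<A>" "bv ({\<one>\<^bsub>G\<^esub>, k}, k) \<in> carrier \<A>"
      using True by (simp_all add: adm_basis_closed)
    moreover have "X \<in> \<Omega> \<Longrightarrow> bv (X, g \<otimes>\<^bsub>G\<^esub> h \<otimes>\<^bsub>G\<^esub> k) \<in> carrier \<A>"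
      by (intro adm_basis_closed) (simp_all add: X_def)
    ultimately show ?thesis
      using g h k True
      by (simp add: \<gamma>_mult_\<gamma>[OF g h] \<gamma>_eq[OF k] A.mult_smult_left adm_mult[OF p q, unfolded X] AM.smult_assoc1)
  next
    case False
    with sub have "X \<notin> \<Omega>" by blast
    with False show ?thesis
      using g h k by (auto simp: \<gamma>_mult_\<gamma> \<gamma>_eq[OF k] zero_mult adm_basis_closed)
  qed
qed

lemma par_rels_adm: "par_rels G K \<A> \<sigma> \<gamma>"
proof (intro par_rels.intro par_rels_axioms.intro assoc_algebra_adm AR.ring_axioms
    G.group_axioms K.field_axioms \<gamma>_one)
  fix g h assume gh: "g \<in> carrier G" "h \<in> carrier G"
  show "\<sigma> g h \<in> carrier K" using gh by simp
  have ghh: "g \<otimes>\<^bsub>G\<^esub> h \<otimes>\<^bsub>G\<^esub> inv\<^bsub>G\<^esub> h = g" and igh: "inv\<^bsub>G\<^esub> g \<otimes>\<^bsub>G\<^esub> (g \<otimes>\<^bsub>G\<^esub> h) = h"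
    using gh by (simp_all add: G.m_assoc flip: G.m_assoc[of "inv\<^bsub>G\<^esub> g"])
  \<comment> \<open>The partial products of \<open>inv g, g, h\<close> and of
    \<open>g, h, inv h\<close> return to a point already visited. So each triple product lives on
    the same set as the double product on the other side of its relation.\<close>
  have sets: "{\<one>\<^bsub>G\<^esub>, inv\<^bsub>G\<^esub> g, \<one>\<^bsub>G\<^esub>, h} = {\<one>\<^bsub>G\<^esub>, inv\<^bsub>G\<^esub> g, h}"
    "{\<one>\<^bsub>G\<^esub>, g, g \<otimes>\<^bsub>G\<^esub> h, g} = {\<one>\<^bsub>G\<^esub>, g \<otimes>\<^bsub>G\<^esub> h, g}"
    by auto
  show "\<gamma> g \<otimes>\<^bsub>\<A>\<^esub> \<gamma> h \<otimes>\<^bsub>\<A>\<^esub> \<gamma> (inv\<^bsub>G\<^esub> h) = \<sigma> g h \<odot>\<^bsub>\<A>\<^esub> (\<gamma> (g \<otimes>\<^bsub>G\<^esub> h) \<otimes>\<^bsub>\<A>\<^esub> \<gamma> (inv\<^bsub>G\<^esub> h))"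
    using gh by (simp add: \<gamma>_mult_\<gamma>_\<gamma> \<gamma>_mult_\<gamma>[of "g \<otimes>\<^bsub>G\<^esub> h"] ghh sets AM.smult_assoc1 adm_basis_closed)
  \<comment> \<open>The preceding relation matches its scalars literally, because triple products
    are expanded from the left. This one uses the cocycle identity along
    \<open>1, inv g, 1, h\<close>.\<close>
  have "(\<sigma> (inv\<^bsub>G\<^esub> g) g \<otimes>\<^bsub>K\<^esub> \<sigma> \<one>\<^bsub>G\<^esub> h) = \<sigma> g h \<otimes>\<^bsub>K\<^esub> \<sigma> (inv\<^bsub>G\<^esub> g) (g \<otimes>\<^bsub>G\<^esub> h)"
    if "{\<one>\<^bsub>G\<^esub>, inv\<^bsub>G\<^esub> g, h} \<in> \<Omega>"
    using \<sigma>_cocycle[OF that, of "\<one>\<^bsub>G\<^esub>" "inv\<^bsub>G\<^esub> g" g h] gh by (simp add: K.m_comm)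
  then show "\<gamma> (inv\<^bsub>G\<^esub> g) \<otimes>\<^bsub>\<A>\<^esub> \<gamma> g \<otimes>\<^bsub>\<A>\<^esub> \<gamma> h = \<sigma> g h \<odot>\<^bsub>\<A>\<^esub> (\<gamma> (inv\<^bsub>G\<^esub> g) \<otimes>\<^bsub>\<A>\<^esub> \<gamma> (g \<otimes>\<^bsub>G\<^esub> h))"
    using gh by (simp add: \<gamma>_mult_\<gamma>_\<gamma> \<gamma>_mult_\<gamma>[of "inv\<^bsub>G\<^esub> g" "g \<otimes>\<^bsub>G\<^esub> h"] igh sets adm_basis_closed flip: AM.smult_assoc1)
  assume 0: "\<sigma> g h = \<zero>\<^bsub>K\<^esub>"
  \<comment> \<open>Type I prohibition with base point \<open>inv g\<close>: the chain is
    \<open>inv g, 1, h\<close>. The companion relation below uses base point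
    \<open>1\<close>.\<close>
  have "{\<one>\<^bsub>G\<^esub>, inv\<^bsub>G\<^esub> g, h} \<notin> \<Omega>"
    using \<sigma>_nonzero[of _ "inv\<^bsub>G\<^esub> g" g h] gh 0 by auto
  then show "\<gamma> (inv\<^bsub>G\<^esub> g) \<otimes>\<^bsub>\<A>\<^esub> \<gamma> (g \<otimes>\<^bsub>G\<^esub> h) = \<zero>\<^bsub>\<A>\<^esub>"
    using gh by (simp add: \<gamma>_mult_\<gamma> igh)
  have "{\<one>\<^bsub>G\<^esub>, g \<otimes>\<^bsub>G\<^esub> h, g} \<notin> \<Omega>"
    using \<sigma>_nonzero[of _ "\<one>\<^bsub>G\<^esub>" g h] gh 0 by auto
  then show "\<gamma> (g \<otimes>\<^bsub>G\<^esub> h) \<otimes>\<^bsub>\<A>\<^esub> \<gamma> (inv\<^bsub>G\<^esub> h) = \<zero>\<^bsub>\<A>\<^esub>"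
    using gh by (simp add: \<gamma>_mult_\<gamma> ghh)
qed simp


section \<open>The homomorphism from the free algebra and its surjectivity\<close>

abbreviation "\<F> \<equiv> free_algebra K G"
abbreviation "\<P> \<equiv> twisted_par_algebra K G \<sigma>"
abbreviation "\<I> \<equiv> par_ideal K G \<sigma>"

definition \<phi> :: "('g list \<Rightarrow> 'k) \<Rightarrow> 'g set \<times> 'g \<Rightarrow> 'k" where
  "\<phi> = lin_ext K \<A> (word_eval \<A> \<gamma>)"

lemma \<gamma>_funcset: "\<gamma> \<in> carrier G \<rightarrow> carrier \<A>"
  by simp

lemma \<sigma>_funcset: "\<sigma> \<in> carrier G \<rightarrow> carrier G \<rightarrow> carrier K"
  by simp

lemmas \<phi>_lift = free_lift[OF K.is_cring assoc_algebra_adm \<gamma>_funcset, folded \<phi>_def]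

lemma \<phi>_kernel: "\<I> \<subseteq> a_kernel \<F> \<A> \<phi>"
  unfolding \<phi>_def
  by (rule par_ideal_subset_kernel[OF K.field_axioms G.group_axioms \<sigma>_funcset par_rels_adm])

lemma \<phi>_image_closed:
  shows "\<lbrakk>x \<in> \<phi> ` carrier \<F>; y \<in> \<phi> ` carrier \<F>\<rbrakk> \<Longrightarrow> x \<oplus>\<^bsub>\<A>\<^esub> y \<in> \<phi> ` carrier \<F>"
    and "\<lbrakk>x \<in> \<phi> ` carrier \<F>; y \<in> \<phi> ` carrier \<F>\<rbrakk> \<Longrightarrow> x \<otimes>\<^bsub>\<A>\<^esub> y \<in> \<phi> ` carrier \<F>"
    and "\<lbrakk>c \<in> carrier K; x \<in> \<phi> ` carrier \<F>\<rbrakk> \<Longrightarrow> c \<odot>\<^bsub>\<A>\<^esub> x \<in> \<phi> ` carrier \<F>"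
    and "g \<in> carrier G \<Longrightarrow> \<gamma> g \<in> \<phi> ` carrier \<F>"
proof -
  interpret \<phi>: ring_hom_ring \<F> \<A> \<phi> by (rule \<phi>_lift(4))
  interpret F: module K \<F>
    by (rule assoc_algebra.axioms(1)[OF assoc_algebra_free[OF K.is_cring]])
  show "x \<oplus>\<^bsub>\<A>\<^esub> y \<in> \<phi> ` carrier \<F>" "x \<otimes>\<^bsub>\<A>\<^esub> y \<in> \<phi> ` carrier \<F>"
    if "x \<in> \<phi> ` carrier \<F>" "y \<in> \<phi> ` carrier \<F>" for x y
  proof -
    from that obtain a b where ab: "a \<in> carrier \<F>" "b \<in> carrier \<F>" "x = \<phi> a" "y = \<phi> b"
      by blast
    have "x \<oplus>\<^bsub>\<A>\<^esub> y = \<phi> (a \<oplus>\<^bsub>\<F>\<^esub> b)" "x \<otimes>\<^bsub>\<A>\<^esub> y = \<phi> (a \<otimes>\<^bsub>\<F>\<^esub> b)"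
      using ab by simp_all
    then show "x \<oplus>\<^bsub>\<A>\<^esub> y \<in> \<phi> ` carrier \<F>" "x \<otimes>\<^bsub>\<A>\<^esub> y \<in> \<phi> ` carrier \<F>"
      using ab(1,2) by blast+
  qed
  show "c \<odot>\<^bsub>\<A>\<^esub> x \<in> \<phi> ` carrier \<F>" if c: "c \<in> carrier K" and "x \<in> \<phi> ` carrier \<F>"
  proof -
    from that obtain a where a: "a \<in> carrier \<F>" "x = \<phi> a"
      by blast
    have "c \<odot>\<^bsub>\<A>\<^esub> x = \<phi> (c \<odot>\<^bsub>\<F>\<^esub> a)"
      using a c by (simp add: linear_map_smult[OF \<phi>_lift(1)])
    then show ?thesis
      using F.smult_closed[OF c a(1)] by blast
  qed
  show "\<gamma> g \<in> \<phi> ` carrier \<F>" if g: "g \<in> carrier G"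
    using \<phi>_lift(3)[OF g] free_gen_closed[OF K.is_cring g] by (metis imageI)
qed

lemma \<phi>_surj: "\<phi> ` carrier \<F> = carrier \<A>"
proof
  interpret \<phi>: ring_hom_ring \<F> \<A> \<phi> by (rule \<phi>_lift(4))
  show "\<phi> ` carrier \<F> \<subseteq> carrier \<A>" by auto
  have singleton: "bv ({\<one>\<^bsub>G\<^esub>, u}, \<one>\<^bsub>G\<^esub>) \<in> \<phi> ` carrier \<F>" if u: "u \<in> carrier G" "{\<one>\<^bsub>G\<^esub>, u} \<in> \<Omega>" for u
  proof -
    let ?c = "\<sigma> u (inv\<^bsub>G\<^esub> u)"
    \<comment> \<open>The chain \<open>1, u, 1\<close> stays inside the admissible set
      \<open>{1, u}\<close>.\<close>
    have "?c \<noteq> \<zero>\<^bsub>K\<^esub>"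
      using u by (intro \<sigma>_nonzero[OF u(2), where a = "\<one>\<^bsub>G\<^esub>"]) simp_all
    then have c: "?c \<in> Units K" using u by (simp add: K.field_Units)
    have cl: "bv ({\<one>\<^bsub>G\<^esub>, u}, \<one>\<^bsub>G\<^esub>) \<in> carrier \<A>"
      using u by (simp add: adm_basis_closed)
    have "{\<one>\<^bsub>G\<^esub>, u, \<one>\<^bsub>G\<^esub>} = {\<one>\<^bsub>G\<^esub>, u}" by auto
    then have "\<gamma> u \<otimes>\<^bsub>\<A>\<^esub> \<gamma> (inv\<^bsub>G\<^esub> u) = ?c \<odot>\<^bsub>\<A>\<^esub> bv ({\<one>\<^bsub>G\<^esub>, u}, \<one>\<^bsub>G\<^esub>)"
      using u by (simp add: \<gamma>_mult_\<gamma>)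
    then have "inv\<^bsub>K\<^esub> ?c \<odot>\<^bsub>\<A>\<^esub> (\<gamma> u \<otimes>\<^bsub>\<A>\<^esub> \<gamma> (inv\<^bsub>G\<^esub> u)) = bv ({\<one>\<^bsub>G\<^esub>, u}, \<one>\<^bsub>G\<^esub>)"
      using c cl K.Units_closed[OF c] by (simp flip: AM.smult_assoc1)
    moreover have "inv\<^bsub>K\<^esub> ?c \<odot>\<^bsub>\<A>\<^esub> (\<gamma> u \<otimes>\<^bsub>\<A>\<^esub> \<gamma> (inv\<^bsub>G\<^esub> u)) \<in> \<phi> ` carrier \<F>"
      using c u by (intro \<phi>_image_closed) auto
    ultimately show ?thesis by simp
  qed
  \<comment> \<open>The unit is inserted by hand because the subsets \<open>W\<close> met in the
    induction need not contain it; \<open>U\<close> stays fixed to make every intermediate set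
    admissible.\<close>
  have idem: "bv (insert \<one>\<^bsub>G\<^esub> W, \<one>\<^bsub>G\<^esub>) \<in> \<phi> ` carrier \<F>" if "finite W" "U \<in> \<Omega>" "W \<subseteq> U" for U W
    using that
  proof (induction W)
    case empty
    show ?case using singleton[of "\<one>\<^bsub>G\<^esub>"] one_Omega_tw by simp
  next
    case (insert w W)
    have X: "insert \<one>\<^bsub>G\<^esub> (insert w W) \<in> \<Omega>"
      using insert.prems Omega_twD by (intro Omega_tw_mono[OF insert.prems(1)]) auto
    have W: "insert \<one>\<^bsub>G\<^esub> W \<in> \<Omega>" and w: "{\<one>\<^bsub>G\<^esub>, w} \<in> \<Omega>"
      by (rule Omega_tw_mono[OF X]; auto)+
    have p: "({\<one>\<^bsub>G\<^esub>, w}, \<one>\<^bsub>G\<^esub>) \<in> adm_pairs K G \<sigma>" and q: "(insert \<one>\<^bsub>G\<^esub> W, \<one>\<^bsub>G\<^esub>) \<in> adm_pairs K G \<sigma>"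
      using w W insert.hyps by (simp_all add: adm_pairs_iff)
    have wG: "w \<in> carrier G" using w Omega_twD by blast
    have "{\<one>\<^bsub>G\<^esub>, w} \<union> (\<one>\<^bsub>G\<^esub> <#\<^bsub>G\<^esub> insert \<one>\<^bsub>G\<^esub> W) = insert \<one>\<^bsub>G\<^esub> (insert w W)"
      using adm_pairsD(5)[OF q] by (auto simp: l_coset_one)
    moreover have "bv (insert \<one>\<^bsub>G\<^esub> (insert w W), \<one>\<^bsub>G\<^esub>) \<in> carrier \<A>"
      using X insert.hyps by (intro adm_basis_closed) auto
    ultimately have "bv ({\<one>\<^bsub>G\<^esub>, w}, \<one>\<^bsub>G\<^esub>) \<otimes>\<^bsub>\<A>\<^esub> bv (insert \<one>\<^bsub>G\<^esub> W, \<one>\<^bsub>G\<^esub>) =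
        bv (insert \<one>\<^bsub>G\<^esub> (insert w W), \<one>\<^bsub>G\<^esub>)"
      using X adm_mult[OF p q] by (simp add: \<sigma>_one_one)
    moreover have "bv ({\<one>\<^bsub>G\<^esub>, w}, \<one>\<^bsub>G\<^esub>) \<otimes>\<^bsub>\<A>\<^esub> bv (insert \<one>\<^bsub>G\<^esub> W, \<one>\<^bsub>G\<^esub>) \<in> \<phi> ` carrier \<F>"
      using insert singleton[OF wG w] by (intro \<phi>_image_closed) auto
    ultimately show ?case by simp
  qed
  have basis: "bv p \<in> \<phi> ` carrier \<F>" if p: "p \<in> adm_pairs K G \<sigma>" for p
  proof -
    obtain U g where pU: "p = (U, g)" by (cases p)
    note D = adm_pairsD[OF p[unfolded pU]]
    have g: "{\<one>\<^bsub>G\<^esub>, g} \<in> \<Omega>"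
      using D by (intro Omega_tw_mono[OF D(1)]) auto
    have u: "(U, \<one>\<^bsub>G\<^esub>) \<in> adm_pairs K G \<sigma>" and q: "({\<one>\<^bsub>G\<^esub>, g}, g) \<in> adm_pairs K G \<sigma>"
      using D g by (simp_all add: adm_pairs_iff)
    have "U \<union> (\<one>\<^bsub>G\<^esub> <#\<^bsub>G\<^esub> {\<one>\<^bsub>G\<^esub>, g}) = U"
      using D by (auto simp: l_coset_one)
    moreover have "\<sigma> \<one>\<^bsub>G\<^esub> g = \<one>\<^bsub>K\<^esub>"
      using D \<sigma>_nonzero[OF D(1), of "\<one>\<^bsub>G\<^esub>" "\<one>\<^bsub>G\<^esub>" g] by (intro \<sigma>_one_left) simp_all
    ultimately have "bv (U, \<one>\<^bsub>G\<^esub>) \<otimes>\<^bsub>\<A>\<^esub> \<gamma> g = bv p"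
      using adm_mult[OF u q] D g adm_basis_closed[OF D(1-3)] by (simp add: \<gamma>_eq pU)
    moreover have "bv (insert \<one>\<^bsub>G\<^esub> U, \<one>\<^bsub>G\<^esub>) \<in> \<phi> ` carrier \<F>"
      by (rule idem[OF D(2,1) subset_refl])
    then have "bv (U, \<one>\<^bsub>G\<^esub>) \<otimes>\<^bsub>\<A>\<^esub> \<gamma> g \<in> \<phi> ` carrier \<F>"
      using D by (intro \<phi>_image_closed) (simp_all add: insert_absorb)
    ultimately show ?thesis by simp
  qed
  show "carrier \<A> \<subseteq> \<phi> ` carrier \<F>"
  proof
    fix x assume "x \<in> carrier \<A>"
    then show "x \<in> \<phi> ` carrier \<F>"
    proof (induction rule: A.linear_induct)
      case zero
      show ?case using \<phi>.hom_zero by (metis \<phi>.R.zero_closed imageI)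
    next
      case (add x c b)
      then show ?case by (intro \<phi>_image_closed basis)
    qed
  qed
qed

section \<open>The linear map back to the quotient and the kernel\<close>

interpretation P: par_rels G K \<P> \<sigma> "par_gen K G \<sigma>"
  by (rule par_rels_twisted[OF K.field_axioms G.group_axioms \<sigma>_funcset])

definition \<psi> :: "('g set \<times> 'g \<Rightarrow> 'k) \<Rightarrow> ('g list \<Rightarrow> 'k) set" where
  "\<psi> = lin_ext K \<P> (\<lambda>(U, g). P.E U \<otimes>\<^bsub>\<P>\<^esub> par_gen K G \<sigma> g)"

lemma \<psi>_linear: "linear_map K \<A> \<P> \<psi>"
  and \<psi>_basis: "(U, g) \<in> adm_pairs K G \<sigma> \<Longrightarrow> \<psi> (bv (U, g)) = P.E U \<otimes>\<^bsub>\<P>\<^esub> par_gen K G \<sigma> g"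
proof -
  have cl: "(\<lambda>(U, g). P.E U \<otimes>\<^bsub>\<P>\<^esub> par_gen K G \<sigma> g) p \<in> carrier \<P>" if "p \<in> adm_pairs K G \<sigma>" for p
    using that adm_pairsD by (cases p) simp
  show "linear_map K \<A> \<P> \<psi>"
    unfolding \<psi>_def by (rule A.linear_map_lin_ext[OF P.M.module_axioms cl])
  show "(U, g) \<in> adm_pairs K G \<sigma> \<Longrightarrow> \<psi> (bv (U, g)) = P.E U \<otimes>\<^bsub>\<P>\<^esub> par_gen K G \<sigma> g"
    unfolding \<psi>_def by (subst A.lin_ext_basis_vec[OF P.M.module_axioms cl]) simp_all
qed

text \<open>Moving \<open>[g]\<close> past \<open>E(V)\<close> gives
  \<open>E(gV) [g] [h] = \<sigma>(g, h) E(gV) e(g) [gh]\<close>. The factor \<open>e(g)\<close> is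
  absorbed because \<open>g\<close> lies in \<open>gV\<close>, and adding the unit to
  \<open>gV\<close> is free because \<open>e(1) = 1\<close>; the result is the image of the product
  in the target algebra.\<close>

lemma \<psi>_\<gamma>_mult:
  assumes g: "g \<in> carrier G" and y: "y \<in> carrier \<A>"
  shows "\<psi> (\<gamma> g \<otimes>\<^bsub>\<A>\<^esub> y) = par_gen K G \<sigma> g \<otimes>\<^bsub>\<P>\<^esub> \<psi> y"
proof (rule A.linear_map_eqI[OF P.M.module_axioms _ _ _ y])
  show "linear_map K \<A> \<P> (\<lambda>y. \<psi> (\<gamma> g \<otimes>\<^bsub>\<A>\<^esub> y))"
    using g by (intro A.linear_map_mult_left \<psi>_linear) simp
  show "linear_map K \<A> \<P> (\<lambda>y. par_gen K G \<sigma> g \<otimes>\<^bsub>\<P>\<^esub> \<psi> y)"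
    using g by (intro linear_mapI)
      (simp_all add: linear_mapD[OF \<psi>_linear] P.MR.r_distr P.M.smult_mult_right)
  fix q assume q': "q \<in> adm_pairs K G \<sigma>"
  obtain V h where qV: "q = (V, h)" by (cases q)
  note q = q'[unfolded qV] and D = adm_pairsD[OF q'[unfolded qV]]
  let ?gV = "g <#\<^bsub>G\<^esub> V" and ?\<Gamma> = "par_gen K G \<sigma>"
  let ?X = "insert \<one>\<^bsub>G\<^esub> ?gV"
  have "g \<otimes>\<^bsub>G\<^esub> \<one>\<^bsub>G\<^esub> \<in> ?gV"
    using D unfolding l_coset_def by blast
  then have gV: "finite ?gV" "?gV \<subseteq> carrier G" "g \<in> ?gV" "g \<otimes>\<^bsub>G\<^esub> h \<in> ?gV"
    using D g by (auto simp: l_coset_def)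
  have EX: "P.E ?X = P.E ?gV"
    using gV by (simp add: P.E_insert P.e_one)
  have Ee: "P.E ?gV \<otimes>\<^bsub>\<P>\<^esub> P.e g = P.E ?gV"
    using P.E_Un[OF gV(1,2), of "{g}"] g gV by (simp add: P.E_insert P.E_empty insert_absorb Un_absorb2)
  have "?\<Gamma> g \<otimes>\<^bsub>\<P>\<^esub> \<psi> (bv (V, h)) = P.E ?gV \<otimes>\<^bsub>\<P>\<^esub> (?\<Gamma> g \<otimes>\<^bsub>\<P>\<^esub> ?\<Gamma> h)"
    using g D gV P.\<Gamma>_E[OF g D(2,5)] by (simp add: \<psi>_basis[OF q] flip: P.MR.m_assoc)
  also have "\<dots> = \<sigma> g h \<odot>\<^bsub>\<P>\<^esub> (P.E ?gV \<otimes>\<^bsub>\<P>\<^esub> P.e g \<otimes>\<^bsub>\<P>\<^esub> ?\<Gamma> (g \<otimes>\<^bsub>G\<^esub> h))"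
    using g D gV by (simp add: P.\<Gamma>_mult[OF g D(4)] P.M.smult_mult_right P.MR.m_assoc)
  also have "\<dots> = \<sigma> g h \<odot>\<^bsub>\<P>\<^esub> (P.E ?X \<otimes>\<^bsub>\<P>\<^esub> ?\<Gamma> (g \<otimes>\<^bsub>G\<^esub> h))"
    by (simp only: Ee EX)
  also have "\<dots> = \<psi> (\<gamma> g \<otimes>\<^bsub>\<A>\<^esub> bv (V, h))"
  proof (cases "?X \<in> \<Omega>")
    case True
    then have "(?X, g \<otimes>\<^bsub>G\<^esub> h) \<in> adm_pairs K G \<sigma>"
      using gV by (simp add: adm_pairs_iff)
    then show ?thesis
      using True g D
      by (simp add: \<gamma>_mult_bv[OF g q] linear_map_smult[OF \<psi>_linear] adm_basis_closed adm_pairs_iff \<psi>_basis)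
  next
    case False
    \<comment> \<open>On the other side the product is zero by definition; here the zero comes from
      the prohibition contained in \<open>?X\<close>.\<close>
    have "P.E ?X = \<zero>\<^bsub>\<P>\<^esub>"
      using gV False by (intro P.E_eq_zero) (simp_all add: Omega_def)
    then show ?thesis
      using False g D linear_map_zero[OF AM.module_axioms P.M.module_axioms \<psi>_linear]
      by (simp add: \<gamma>_mult_bv[OF g q])
  qed
  finally show "\<psi> (\<gamma> g \<otimes>\<^bsub>\<A>\<^esub> bv q) = ?\<Gamma> g \<otimes>\<^bsub>\<P>\<^esub> \<psi> (bv q)"
    by (simp add: qV)
qed

text \<open>Both sides are linear, so words suffice. Prepending a letter multiplies by \<gamma> on
  one side and by the class of the generator on the other, which is exactly the compatibility in
  \<open>\<psi>_\<gamma>_mult\<close>.\<close>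

lemma \<psi>_\<phi>:
  assumes x: "x \<in> carrier \<F>"
  shows "\<psi> (\<phi> x) = \<I> +>\<^bsub>\<F>\<^esub> x"
proof (rule linear_map_free_eqI[OF K.is_cring P.M.module_axioms _ _ _ x])
  note I = ideal_par_ideal[OF K.field_axioms G.group_axioms \<sigma>_funcset]
  note F = assoc_algebra_free[OF K.is_cring, of G]
  note ops = quot_algebra_ops[OF I, folded twisted_par_algebra_def]
    and smult = quot_algebra_smult_coset[OF F I, folded twisted_par_algebra_def]
  show "linear_map K \<F> \<P> (\<lambda>x. \<psi> (\<phi> x))"
    by (intro linear_mapI) (simp_all add: linear_mapD[OF \<phi>_lift(1)] linear_mapD[OF \<psi>_linear])
  show "linear_map K \<F> \<P> (\<lambda>x. \<I> +>\<^bsub>\<F>\<^esub> x)"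
    by (intro linear_mapI) (simp_all add: ops(1-3) smult)
  fix w assume "w \<in> lists (carrier G)"
  then show "\<psi> (\<phi> (bv w)) = \<I> +>\<^bsub>\<F>\<^esub> bv w"
  proof induction
    case Nil
    have "\<psi> (\<phi> (bv [])) = \<psi> (bv ({\<one>\<^bsub>G\<^esub>}, \<one>\<^bsub>G\<^esub>))"
      by (simp add: \<phi>_lift(2) A.one_A)
    also have "\<dots> = \<one>\<^bsub>\<P>\<^esub>"
      by (simp add: \<psi>_basis adm_pairs_iff one_Omega_tw P.E_insert P.E_empty P.e_one P.\<Gamma>_one)
    also have "\<dots> = \<I> +>\<^bsub>\<F>\<^esub> bv []"
      by (simp only: ops(4) free_one[OF K.is_cring])
    finally show ?case .
  next
    case (Cons g w)
    have w: "bv w \<in> carrier \<F>"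
      using Cons unfolding free_algebra_def by (intro K.basis_vec_closed) simp
    have "\<psi> (\<phi> (bv (g # w))) = \<psi> (\<gamma> g \<otimes>\<^bsub>\<A>\<^esub> \<phi> (bv w))"
      using Cons by (simp add: \<phi>_lift(2))
    also have "\<dots> = par_gen K G \<sigma> g \<otimes>\<^bsub>\<P>\<^esub> (\<I> +>\<^bsub>\<F>\<^esub> bv w)"
      using Cons w by (simp add: \<psi>_\<gamma>_mult linear_map_closed[OF \<phi>_lift(1)])
    also have "\<dots> = \<I> +>\<^bsub>\<F>\<^esub> bv (g # w)"
      using Cons w unfolding par_gen_def
      by (simp add: ops(3) free_gen_closed[OF K.is_cring] free_Cons[OF K.is_cring])
    finally show ?case .
  qed
qed

lemma kernel_\<phi>: "a_kernel \<F> \<A> \<phi> = \<I>"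
proof
  interpret I: ideal \<I> \<F>
    by (rule ideal_par_ideal[OF K.field_axioms G.group_axioms \<sigma>_funcset])
  show "a_kernel \<F> \<A> \<phi> \<subseteq> \<I>"
  proof
    fix x assume "x \<in> a_kernel \<F> \<A> \<phi>"
    then have x: "x \<in> carrier \<F>" and "\<phi> x = \<zero>\<^bsub>\<A>\<^esub>"
      by (auto simp: a_kernel_def')
    then have "\<I> +>\<^bsub>\<F>\<^esub> x = \<zero>\<^bsub>\<P>\<^esub>"
      using \<psi>_\<phi>[OF x] linear_map_zero[OF AM.module_axioms P.M.module_axioms \<psi>_linear] by simp
    also have "\<dots> = \<I>"
      by (simp add: twisted_par_algebra_def quot_algebra_simps FactRing_def)
    finally show "x \<in> \<I>"
      using I.a_rcos_self[OF x] by simp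
  qed
qed (rule \<phi>_kernel)

lemma twisted_par_algebra_iso:
  "\<exists>f \<in> algebra_iso K \<P> \<A>. \<forall>g\<in>carrier G. f (par_gen K G \<sigma> g) = \<gamma> g"
proof
  interpret \<phi>: ring_hom_ring \<F> \<A> \<phi> by (rule \<phi>_lift(4))
  let ?f = "\<lambda>X. the_elem (\<phi> ` X)"
  note I = ideal_par_ideal[OF K.field_axioms G.group_axioms \<sigma>_funcset]
  note F = assoc_algebra_free[OF K.is_cring, of G]
  interpret FM: module K \<F> by (rule assoc_algebra.axioms(1)[OF F])
  have coset: "?f (\<I> +>\<^bsub>\<F>\<^esub> x) = \<phi> x" if "x \<in> carrier \<F>" for x
    using \<phi>.the_elem_simp[OF that] by (simp add: kernel_\<phi>)
  have "?f \<in> ring_iso (\<F> Quot \<I>) \<A>"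
    using \<phi>.FactRing_iso_set[OF \<phi>_surj] by (simp add: kernel_\<phi>)
  \<comment> \<open>The quotient algebra extends the ring quotient by a scalar action only, so the
    ring isomorphism transfers unchanged.\<close>
  then have "?f \<in> ring_iso \<P> \<A>"
    by (simp add: ring_iso_def ring_hom_def twisted_par_algebra_def quot_algebra_simps)
  moreover have "?f (c \<odot>\<^bsub>\<P>\<^esub> X) = c \<odot>\<^bsub>\<A>\<^esub> ?f X" if c: "c \<in> carrier K" and X: "X \<in> carrier \<P>" for c X
  proof -
    obtain x where x: "x \<in> carrier \<F>" "X = \<I> +>\<^bsub>\<F>\<^esub> x"
      using X unfolding twisted_par_algebra_def by (rule quot_algebra_cases)
    then show ?thesis
      using quot_algebra_smult_coset[OF F I c x(1)] c
      by (simp add: coset linear_map_smult[OF \<phi>_lift(1)] flip: twisted_par_algebra_def)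
  qed
  ultimately show "?f \<in> algebra_iso K \<P> \<A>"
    by (simp add: algebra_iso_def)
  show "\<forall>g\<in>carrier G. ?f (par_gen K G \<sigma> g) = \<gamma> g"
    by (simp add: par_gen_def coset free_gen_closed[OF K.is_cring] \<phi>_lift(3))
qed

end

theorem theorem5p5:
  fixes K :: "('k, 'm) ring_scheme" and G :: "('g, 'n) monoid_scheme"
    and \<sigma> :: "'g \<Rightarrow> 'g \<Rightarrow> 'k"
  assumes "field K"
    and "group G"
    and "\<sigma> \<in> pm TYPE('r) K G"
  shows "\<exists>\<phi> \<in> algebra_iso K (twisted_par_algebra K G \<sigma>) (adm_algebra K G \<sigma>).
    \<forall>g\<in>carrier G. \<phi> (par_gen K G \<sigma> g) =
      chi K G \<sigma> {\<one>\<^bsub>G\<^esub>, g} \<odot>\<^bsub>adm_algebra K G \<sigma>\<^esub> basis_vec K ({\<one>\<^bsub>G\<^esub>, g}, g)"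
proof -
  interpret normalised_twist G K \<sigma>
    by (rule normalised_twist_pm[OF assms])
  show ?thesis
    using twisted_par_algebra_iso unfolding \<gamma>_def .
qed

end
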